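(* Let $\mathcal N_{A\to B}$ be a quantum channel, let $\varepsilon,\delta\in(0,1)$, and let $A'\equiv A$ be a purifying register. Then for any $R$ satisfying $$R\le\frac1\alpha\max_{|\psi\rangle\langle\psi|_{AA'}}D_{\mathrm H}^{\varepsilon}\big(\mathcal N_{A\to B}(|\psi\rangle\langle\psi|_{AA'})\,\big\|\,\mathcal N_{A\to B}(\psi_A)\otimes\psi_{A'}\big)-\frac4\alpha\log\frac2\delta$$ (maximum over pure states on $AA'$), there exists an $(R,2\varepsilon+3\delta,\alpha)$-entanglement assisted code for classical communication over $\mathcal N_{A\to B}$. Furthermore, for any $(R,\varepsilon,\alpha)$-entanglement assisted code for classical communication over $\mathcal N_{A\to B}$, it holds that $$R\le\frac1\alpha\max_{|\psi\rangle\langle\psi|_{AA'}}D_{\mathrm H}^{\varepsilon}\big(\mathcal N_{A\to B}(|\psi\rangle\langle\psi|_{AA'})\,\big\|\,\mathcal N_{A\to B}(\psi_A)\otimes\psi_{A'}\big).$$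
   Context: Logarithms are base 2; Hilbert spaces are finite dimensional. $D_{\mathrm H}^{\varepsilon}(\rho\|\sigma)=\sup_{0\preceq\Pi\preceq I,\ \mathrm{Tr}(\Pi\rho)\ge1-\varepsilon}\log\frac{1}{\mathrm{Tr}(\Pi\sigma)}$. Classical communication with a subset promise: Alice wants to communicate a classical message $M$, uniform in $[1:2^R]$, to Bob. Bob knows a subset $S\subset[1:2^R]$ of size $|S|=2^{\alpha R}$ ($\alpha>0$) containing the message; Alice does not know $S$, only $\alpha$. An $(R,\varepsilon,\alpha)$-entanglement assisted code for classical communication over $\mathcal N_{A\to B}$ consists of an entangled pure state $|\theta\rangle_{E_AE_B}$ shared between Alice ($E_A$) and Bob ($E_B$), an encoding operation $\mathcal E:ME_A\to A$ for Alice that does not depend on $S$, and a decoding operation $\mathcal D:BE_B\to M'$ for Bob, $M'\equiv M$ (which may depend on $S$), such that for every such $S$ and all $m\in S$, Bob decodes the message $m$ incorrectly with probability at most $\varepsilon$, i.e. $\Pr(M'\ne m\mid M=m)\le\varepsilon$. *)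

theory Defs
  imports
    "Jordan_Normal_Form.Schur_Decomposition"
    "HOL-Library.Extended_Real"
begin

text \<open>
  A Hilbert space of dimension \<open>n\<close> is represented by its coordinate space (\<open>carrier_vec n\<close>), operators
  on it by \<open>carrier_mat n n\<close>. The basis vector \<open>|a\<rangle> \<otimes> |k\<rangle>\<close> of a composite of dimensions \<open>p\<close> and \<open>q\<close> has
  index \<open>a * q + k\<close>. With this convention the tensor product is strictly associative, so no
  reassociation maps are needed below.
\<close>

definition mtrace :: "complex mat \<Rightarrow> complex" where
  "mtrace X = (\<Sum>i<dim_row X. X $$ (i, i))"

text \<open>The order on \<^typ>\<open>complex\<close> makes \<open>0 \<le> z\<close> say that \<open>z\<close> is real and nonnegative, so \<open>psd n X\<close>
  entails that \<open>X\<close> is Hermitian.\<close>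

definition psd :: "nat \<Rightarrow> complex mat \<Rightarrow> bool" where
  "psd n X \<longleftrightarrow> X \<in> carrier_mat n n \<and> (\<forall>v \<in> carrier_vec n. 0 \<le> (X *\<^sub>v v) \<bullet>c v)"

definition tensor_mat :: "complex mat \<Rightarrow> complex mat \<Rightarrow> complex mat" where
  "tensor_mat X Y = mat (dim_row X * dim_row Y) (dim_col X * dim_col Y)
     (\<lambda>(i, j). X $$ (i div dim_row Y, j div dim_col Y) * Y $$ (i mod dim_row Y, j mod dim_col Y))"

definition tensor_vec :: "complex vec \<Rightarrow> complex vec \<Rightarrow> complex vec" where
  "tensor_vec u w = vec (dim_vec u * dim_vec w) (\<lambda>i. u $ (i div dim_vec w) * w $ (i mod dim_vec w))"

definition ptrace_snd :: "nat \<Rightarrow> nat \<Rightarrow> complex mat \<Rightarrow> complex mat" where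
  "ptrace_snd p q X = mat p p (\<lambda>(a, a'). \<Sum>k<q. X $$ (a * q + k, a' * q + k))"

definition ptrace_fst :: "nat \<Rightarrow> nat \<Rightarrow> complex mat \<Rightarrow> complex mat" where
  "ptrace_fst p q X = mat q q (\<lambda>(k, k'). \<Sum>a<p. X $$ (a * q + k, a * q + k'))"

definition pure_states :: "nat \<Rightarrow> complex vec set" where
  "pure_states n = {v \<in> carrier_vec n. v \<bullet>c v = 1}"

definition proj :: "complex vec \<Rightarrow> complex mat" where
  "proj v = mat (dim_vec v) (dim_vec v) (\<lambda>(i, j). v $ i * conjugate (v $ j))"

definition entangled :: "nat \<Rightarrow> nat \<Rightarrow> complex vec \<Rightarrow> bool" where
  "entangled p q v \<longleftrightarrow> \<not> (\<exists>u \<in> carrier_vec p. \<exists>w \<in> carrier_vec q. v = tensor_vec u w)"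


text \<open>
  \<open>apply_fst p r q \<Phi>\<close> is \<open>\<Phi> \<otimes> id\<close> for \<open>\<Phi>\<close> from dimension \<open>p\<close> to dimension \<open>r\<close> and a second factor of
  dimension \<open>q\<close>: writing \<open>X = (\<Sum>k k'. X\<^sub>k\<^sub>k\<^sub>' \<otimes> |k\<rangle>\<langle>k'|)\<close>, the map \<open>\<Phi>\<close> acts on each block \<open>X\<^sub>k\<^sub>k\<^sub>'\<close>.
\<close>

definition block_snd :: "nat \<Rightarrow> nat \<Rightarrow> complex mat \<Rightarrow> nat \<Rightarrow> nat \<Rightarrow> complex mat" where
  "block_snd p q X k k' = mat p p (\<lambda>(a, a'). X $$ (a * q + k, a' * q + k'))"

definition apply_fst ::
    "nat \<Rightarrow> nat \<Rightarrow> nat \<Rightarrow> (complex mat \<Rightarrow> complex mat) \<Rightarrow> complex mat \<Rightarrow> complex mat" where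
  "apply_fst p r q \<Phi> X = mat (r * q) (r * q)
     (\<lambda>(i, j). \<Phi> (block_snd p q X (i mod q) (j mod q)) $$ (i div q, j div q))"

definition linear_op :: "nat \<Rightarrow> nat \<Rightarrow> (complex mat \<Rightarrow> complex mat) \<Rightarrow> bool" where
  "linear_op p r \<Phi> \<longleftrightarrow>
     (\<forall>X \<in> carrier_mat p p. \<Phi> X \<in> carrier_mat r r) \<and>
     (\<forall>X \<in> carrier_mat p p. \<forall>Y \<in> carrier_mat p p. \<Phi> (X + Y) = \<Phi> X + \<Phi> Y) \<and>
     (\<forall>c. \<forall>X \<in> carrier_mat p p. \<Phi> (c \<cdot>\<^sub>m X) = c \<cdot>\<^sub>m \<Phi> X)"

definition completely_positive :: "nat \<Rightarrow> nat \<Rightarrow> (complex mat \<Rightarrow> complex mat) \<Rightarrow> bool" where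
  "completely_positive p r \<Phi> \<longleftrightarrow> (\<forall>q X. psd (p * q) X \<longrightarrow> psd (r * q) (apply_fst p r q \<Phi> X))"

definition trace_preserving :: "nat \<Rightarrow> (complex mat \<Rightarrow> complex mat) \<Rightarrow> bool" where
  "trace_preserving p \<Phi> \<longleftrightarrow> (\<forall>X \<in> carrier_mat p p. mtrace (\<Phi> X) = mtrace X)"

definition quantum_channel :: "nat \<Rightarrow> nat \<Rightarrow> (complex mat \<Rightarrow> complex mat) \<Rightarrow> bool" where
  "quantum_channel p r \<Phi> \<longleftrightarrow>
     linear_op p r \<Phi> \<and> completely_positive p r \<Phi> \<and> trace_preserving p \<Phi>"


definition log_recip :: "real \<Rightarrow> ereal" where
  "log_recip x = (if x = 0 then \<infinity> else ereal (log 2 (1 / x)))"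

definition tests :: "nat \<Rightarrow> real \<Rightarrow> complex mat \<Rightarrow> complex mat set" where
  "tests n \<epsilon> \<rho> = {T. psd n T \<and> psd n (1\<^sub>m n - T) \<and> 1 - \<epsilon> \<le> Re (mtrace (T * \<rho>))}"

definition D_H :: "real \<Rightarrow> complex mat \<Rightarrow> complex mat \<Rightarrow> ereal" where
  "D_H \<epsilon> \<rho> \<sigma> = (SUP T \<in> tests (dim_row \<rho>) \<epsilon> \<rho>. log_recip (Re (mtrace (T * \<sigma>))))"

text \<open>The divergence between \<open>N(|\<psi>\<rangle>\<langle>\<psi>|)\<close> and \<open>N(\<psi>\<^sub>A) \<otimes> \<psi>\<^sub>A\<^sub>'\<close>; both \<open>A\<close> and \<open>A'\<close> have dimension \<open>dA\<close>.\<close>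

definition D_H_channel ::
    "nat \<Rightarrow> nat \<Rightarrow> (complex mat \<Rightarrow> complex mat) \<Rightarrow> real \<Rightarrow> complex vec \<Rightarrow> ereal" where
  "D_H_channel dA dB N \<epsilon> \<psi> =
     D_H \<epsilon> (apply_fst dA dB dA N (proj \<psi>))
       (tensor_mat (N (ptrace_snd dA dA (proj \<psi>))) (ptrace_fst dA dA (proj \<psi>)))"

definition max_D_H ::
    "nat \<Rightarrow> nat \<Rightarrow> (complex mat \<Rightarrow> complex mat) \<Rightarrow> real \<Rightarrow> ereal" where
  "max_D_H dA dB N \<epsilon> = (SUP \<psi> \<in> pure_states (dA * dA). D_H_channel dA dB N \<epsilon> \<psi>)"


text \<open>Messages are numbered from 0 so that they coincide with basis indices of the register \<open>M\<close>.\<close>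

definition num_messages :: "real \<Rightarrow> nat" where
  "num_messages R = nat \<lfloor>2 powr R\<rfloor>"

definition promise_sets :: "real \<Rightarrow> real \<Rightarrow> nat set set" where
  "promise_sets R \<alpha> = {S. S \<subseteq> {..<num_messages R} \<and> real (card S) = 2 powr (\<alpha> * R)}"

text \<open>
  The state of \<open>B E\<^sub>B\<close> when message \<open>m\<close> is sent: \<open>N (\<E> (|m\<rangle>\<langle>m| \<otimes> |\<theta>\<rangle>\<langle>\<theta>|))\<close>, where \<open>\<E>\<close> acts on \<open>M E\<^sub>A\<close>, \<open>N\<close> on
  \<open>A\<close>, and \<open>E\<^sub>B\<close> is untouched.
\<close>

definition received_state ::
    "nat \<Rightarrow> nat \<Rightarrow> (complex mat \<Rightarrow> complex mat) \<Rightarrow> nat \<Rightarrow> nat \<Rightarrow> nat \<Rightarrow>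
     complex vec \<Rightarrow> (complex mat \<Rightarrow> complex mat) \<Rightarrow> nat \<Rightarrow> complex mat" where
  "received_state dA dB N K eA eB \<theta> \<E> m =
     apply_fst dA dB eB N
       (apply_fst (K * eA) dA eB \<E> (tensor_mat (proj (unit_vec K m)) (proj \<theta>)))"

text \<open>
  An \<open>(R, \<epsilon>, \<alpha>)\<close> code consists of the dimensions \<open>eA\<close>, \<open>eB\<close> of \<open>E\<^sub>A\<close>, \<open>E\<^sub>B\<close>, the shared state \<open>\<theta>\<close>, the
  encoder \<open>\<E>\<close>, and one decoder \<open>\<D> S\<close> for every promise \<open>S\<close>. The diagonal entry \<open>(m, m)\<close> of the decoder
  output is the probability that reading out \<open>M'\<close> yields \<open>m\<close>. Whether \<open>\<theta>\<close> is entangled is not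
  part of this predicate.
\<close>

definition ea_code ::
    "nat \<Rightarrow> nat \<Rightarrow> (complex mat \<Rightarrow> complex mat) \<Rightarrow> real \<Rightarrow> real \<Rightarrow> real \<Rightarrow> nat \<Rightarrow> nat \<Rightarrow>
     complex vec \<Rightarrow> (complex mat \<Rightarrow> complex mat) \<Rightarrow>
     (nat set \<Rightarrow> complex mat \<Rightarrow> complex mat) \<Rightarrow> bool" where
  "ea_code dA dB N R \<epsilon> \<alpha> eA eB \<theta> \<E> \<D> \<longleftrightarrow>
     (let K = num_messages R in
       \<theta> \<in> pure_states (eA * eB) \<and>
       quantum_channel (K * eA) dA \<E> \<and>
       (\<forall>S \<in> promise_sets R \<alpha>.
          quantum_channel (dB * eB) K (\<D> S) \<and>
          (\<forall>m \<in> S. 1 - Re (\<D> S (received_state dA dB N K eA eB \<theta> \<E> m) $$ (m, m)) \<le> \<epsilon>)))"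

end

theory Submission
  imports Defs "HOL-Library.FuncSet"
begin

text \<open>
  Achievability is position-based coding: Alice and Bob share one copy of the optimal state \<open>\<psi>\<close> per
  message, Alice feeds her half of copy \<open>m\<close> into the channel, and Bob has to find out which of the
  copies in his promise set is correlated with the channel output. The optimal test on the \<open>card S\<close>
  candidate copies, turned into a measurement by a Hayashi--Nagaoka inequality, errs with probability
  at most \<open>2 \<epsilon> + 4 card S \<cdot> x\<close>, where \<open>x\<close> is the optimal type II error.

  Conversely, let \<open>\<omega>\<close> be the state of \<open>A\<close>, \<open>E\<^sub>B\<close> and a copy of the message (uniform on \<open>S\<close>). The decoder is a test
  of \<open>N(\<omega>)\<close> against the product of its marginals, with type II error at most \<open>1 / card S\<close>. Orthonormalizing the
  rows of the amplitude matrix of a purification of \<open>\<omega>\<close> factors it as \<open>W V\<close> with \<open>W\<close> square; the matrix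
  \<open>W\<close> is the amplitude matrix of a pure state of \<open>A A'\<close>, and \<open>V\<close> pulls the test back to \<open>B A'\<close>.

  The maximum is attained because pairs of a unit vector and a feasible test form a compact set.
\<close>

section \<open>Operators as kernels on finite index sets\<close>

text \<open>The slack \<open>4 * log 2 (2 / \<delta>)\<close> makes \<open>card S * x\<close> at
  most \<open>(\<delta> / 2) ^ 4\<close>, which leaves the term \<open>4 * card S * x\<close> well
  below \<open>3 * \<delta>\<close>. Alice prepares one copy for every message and her encoder never
  mentions \<open>S\<close>; only Bob's measurement is restricted to the positions in
  \<open>S\<close>, which is why \<open>card S\<close> and not the number of messages enters. The
  obstacle in the converse is the size of the reference system: a purification of \<omega> may need
  a register larger than \<open>A\<close>, whereas the divergence is maximized over pure states
  whose second register has the dimension of \<open>A\<close>. A matrix with \<open>dA\<close> rows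
  has rank at most \<open>dA\<close>, and this is what makes the square factor possible. The type II
  error is at most \<open>1 / card S\<close> because under the product of the marginals the copy of
  the message is uniform and independent of all that Bob decodes; this uses that the encoder cannot
  influence the state of \<open>E\<^sub>B\<close>. Gram vectors of positive kernels, found by
  Cholesky elimination, take the place of eigenvectors throughout: they serve as purifications and
  as Kraus operators.\<close>

text \<open>An operator on the space with orthonormal basis \<open>I\<close> is represented by its kernel
  \<open>'i \<Rightarrow> 'i \<Rightarrow> complex\<close>, whose values off \<open>I \<times> I\<close> are irrelevant; arbitrary index types spare most of the
  \<open>div\<close>/\<open>mod\<close> arithmetic of composite systems.\<close>

definition sesq :: "'i set \<Rightarrow> ('i \<Rightarrow> 'i \<Rightarrow> complex) \<Rightarrow> ('i \<Rightarrow> complex) \<Rightarrow> ('i \<Rightarrow> complex) \<Rightarrow> complex" where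
  "sesq I X u v = (\<Sum>i\<in>I. \<Sum>j\<in>I. cnj (u i) * X i j * v j)"

definition pos :: "'i set \<Rightarrow> ('i \<Rightarrow> 'i \<Rightarrow> complex) \<Rightarrow> bool" where
  "pos I X \<longleftrightarrow> (\<forall>v. 0 \<le> sesq I X v v)"

definition idk :: "'i \<Rightarrow> 'i \<Rightarrow> complex" where
  "idk i j = of_bool (i = j)"

text \<open>This is the trace of the operator product, hence the swapped indices of the second
  kernel.\<close>

definition trk :: "'i set \<Rightarrow> ('i \<Rightarrow> 'i \<Rightarrow> complex) \<Rightarrow> ('i \<Rightarrow> 'i \<Rightarrow> complex) \<Rightarrow> complex" where
  "trk I X Y = (\<Sum>i\<in>I. \<Sum>j\<in>I. X i j * Y j i)"

lemma zero_le_complex_iff: "0 \<le> (z::complex) \<longleftrightarrow> 0 \<le> Re z \<and> Im z = 0"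
  by (auto simp: less_eq_complex_def)

lemma sesq_cong:
  "\<lbrakk>\<And>i j. \<lbrakk>i \<in> I; j \<in> I\<rbrakk> \<Longrightarrow> X i j = Y i j; \<And>i. i \<in> I \<Longrightarrow> u i = u' i; \<And>i. i \<in> I \<Longrightarrow> v i = v' i\<rbrakk>
    \<Longrightarrow> sesq I X u v = sesq I Y u' v'"
  by (simp add: sesq_def)

lemma pos_cong: "(\<And>i j. \<lbrakk>i \<in> I; j \<in> I\<rbrakk> \<Longrightarrow> X i j = Y i j) \<Longrightarrow> pos I X \<longleftrightarrow> pos I Y"
  by (simp add: pos_def sesq_def)

lemma sesq_reindex:
  assumes "bij_betw f J I"
  shows "sesq I X u v = sesq J (\<lambda>i j. X (f i) (f j)) (u \<circ> f) (v \<circ> f)"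
proof -
  have *: "(\<Sum>i\<in>I. g i) = (\<Sum>i\<in>J. g (f i))" for g :: "_ \<Rightarrow> complex"
    using sum.reindex_bij_betw[OF assms, of g] by simp
  show ?thesis by (simp add: sesq_def *)
qed

lemma pos_reindex:
  assumes "bij_betw f J I"
  shows "pos I X \<longleftrightarrow> pos J (\<lambda>i j. X (f i) (f j))"
proof
  show "pos I X" if "pos J (\<lambda>i j. X (f i) (f j))"
    using that by (simp add: pos_def sesq_reindex[OF assms])
  show "pos J (\<lambda>i j. X (f i) (f j))" if "pos I X"
    unfolding pos_def
  proof
    fix v :: "_ \<Rightarrow> complex"
    have inj: "inj_on f J" using assms by (simp add: bij_betw_def)
    have "sesq J (\<lambda>i j. X (f i) (f j)) v v
        = sesq I X (v \<circ> inv_into J f) (v \<circ> inv_into J f)"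
      unfolding sesq_reindex[OF assms]
      by (rule sesq_cong) (simp_all add: inv_into_f_f[OF inj])
    thus "0 \<le> sesq J (\<lambda>i j. X (f i) (f j)) v v"
      using that by (simp add: pos_def)
  qed
qed

lemma trk_reindex:
  assumes "bij_betw f J I"
  shows "trk I X Y = trk J (\<lambda>i j. X (f i) (f j)) (\<lambda>i j. Y (f i) (f j))"
proof -
  have *: "(\<Sum>i\<in>I. g i) = (\<Sum>i\<in>J. g (f i))" for g :: "_ \<Rightarrow> complex"
    using sum.reindex_bij_betw[OF assms, of g] by simp
  show ?thesis by (simp add: trk_def *)
qed

lemma sesq_add_kernel: "sesq I (\<lambda>i j. X i j + Y i j) u v = sesq I X u v + sesq I Y u v"
  by (simp add: sesq_def algebra_simps sum.distrib)

lemma sesq_diff_kernel: "sesq I (\<lambda>i j. X i j - Y i j) u v = sesq I X u v - sesq I Y u v"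
  by (simp add: sesq_def algebra_simps sum_subtractf)

lemma sesq_scale_kernel: "sesq I (\<lambda>i j. c * X i j) u v = c * sesq I X u v"
  by (simp add: sesq_def sum_distrib_left mult_ac)

lemma sesq_sum_kernel: "sesq I (\<lambda>i j. \<Sum>k\<in>K. X k i j) u v = (\<Sum>k\<in>K. sesq I (X k) u v)"
  by (induction K rule: infinite_finite_induct) (simp_all add: sesq_add_kernel, simp_all add: sesq_def)

lemma sesq_comb:
  "sesq I X (\<lambda>i. x i + c * y i) (\<lambda>i. x i + c * y i)
    = sesq I X x x + c * sesq I X x y + cnj c * sesq I X y x + cnj c * c * sesq I X y y"
  by (simp add: sesq_def algebra_simps sum.distrib sum_distrib_left)

lemma pos_sesq: "pos I X \<Longrightarrow> 0 \<le> sesq I X v v"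
  by (simp add: pos_def)

lemma pos_Re: "pos I X \<Longrightarrow> 0 \<le> Re (sesq I X v v)"
  using pos_sesq[of I X v] by (simp add: zero_le_complex_iff)

lemma pos_sum: "(\<And>k. k \<in> K \<Longrightarrow> pos I (X k)) \<Longrightarrow> pos I (\<lambda>i j. \<Sum>k\<in>K. X k i j)"
  by (simp add: pos_def sesq_sum_kernel sum_nonneg)

lemma pos_add: "\<lbrakk>pos I X; pos I Y\<rbrakk> \<Longrightarrow> pos I (\<lambda>i j. X i j + Y i j)"
  by (simp add: pos_def sesq_add_kernel)

text \<open>Polarization: the form is real at u + v and at u + i v, which compares the imaginary and
  the real parts of the two mixed values.\<close>

lemma pos_sym:
  assumes "pos I X"
  shows "sesq I X v u = cnj (sesq I X u v)"
proof -
  have "Im (sesq I X (\<lambda>i. u i + 1 * v i) (\<lambda>i. u i + 1 * v i)) = 0"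
    "Im (sesq I X (\<lambda>i. u i + \<i> * v i) (\<lambda>i. u i + \<i> * v i)) = 0"
    "Im (sesq I X u u) = 0" "Im (sesq I X v v) = 0"
    using assms by (auto simp: pos_def zero_le_complex_iff)
  thus ?thesis unfolding sesq_comb by (simp add: complex_eq_iff)
qed

lemma sesq_unit:
  assumes "finite I" "i \<in> I" "j \<in> I"
  shows "sesq I X (\<lambda>k. of_bool (k = i)) (\<lambda>k. of_bool (k = j)) = X i j"
proof -
  have "sesq I X (\<lambda>k. of_bool (k = i)) (\<lambda>k. of_bool (k = j))
      = (\<Sum>a\<in>I. if a = i then (\<Sum>b\<in>I. if b = j then X i j else 0) else 0)"
    unfolding sesq_def by (intro sum.cong refl) (auto intro!: sum.cong)
  thus ?thesis using assms by simp
qed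

lemma pos_hermitian:
  assumes "finite I" "pos I X" "i \<in> I" "j \<in> I"
  shows "X j i = cnj (X i j)"
  using pos_sym[OF assms(2), of "\<lambda>k. of_bool (k = j)" "\<lambda>k. of_bool (k = i)"] assms
  by (simp add: sesq_unit)

lemma pos_diag: "\<lbrakk>finite I; pos I X; i \<in> I\<rbrakk> \<Longrightarrow> 0 \<le> X i i"
  using pos_sesq[of I X "\<lambda>k. of_bool (k = i)"] by (simp add: sesq_unit)

section \<open>Gram kernels, Schur complements and Cholesky factorization\<close>

lemma sesq_gram:
  "sesq I (\<lambda>i j. \<Sum>k\<in>K. w k i * cnj (w k j)) u v
    = (\<Sum>k\<in>K. cnj (\<Sum>i\<in>I. u i * cnj (w k i)) * (\<Sum>i\<in>I. v i * cnj (w k i)))"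
  unfolding sesq_sum_kernel
proof (intro sum.cong refl)
  fix k
  have "cnj (\<Sum>i\<in>I. u i * cnj (w k i)) * (\<Sum>i\<in>I. v i * cnj (w k i))
      = (\<Sum>i\<in>I. cnj (u i) * w k i) * (\<Sum>i\<in>I. v i * cnj (w k i))"
    by simp
  thus "sesq I (\<lambda>i j. w k i * cnj (w k j)) u v
      = cnj (\<Sum>i\<in>I. u i * cnj (w k i)) * (\<Sum>i\<in>I. v i * cnj (w k i))"
    unfolding sesq_def sum_product by (simp only: mult_ac)
qed

lemma cnj_mult_self_nonneg: "0 \<le> cnj z * (z::complex)"
  by (simp add: zero_le_complex_iff)

lemma pos_gram: "pos I (\<lambda>i j. \<Sum>k\<in>K. w k i * cnj (w k j))"
  unfolding pos_def sesq_gram by (intro allI sum_nonneg cnj_mult_self_nonneg)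

lemma sesq_insert:
  assumes "finite I" "a \<notin> I"
  shows "sesq (insert a I) X u v = cnj (u a) * X a a * v a + cnj (u a) * (\<Sum>j\<in>I. X a j * v j)
     + (\<Sum>i\<in>I. cnj (u i) * X i a) * v a + sesq I X u v"
  using assms by (simp add: sesq_def sum.distrib sum_distrib_left sum_distrib_right mult_ac)

text \<open>Minimizing the form over the coordinate at \<open>a\<close>, with the other coordinates
  fixed, leaves the form of the Schur complement.\<close>

lemma pos_insert_schur:
  assumes "finite I" "a \<notin> I" and X: "pos (insert a I) X" and aa: "X a a \<noteq> 0"
  shows "pos I (\<lambda>i j. X i j - X i a * X a j / X a a)"
  unfolding pos_def
proof
  fix v :: "'a \<Rightarrow> complex"
  define s where "s = (\<Sum>j\<in>I. X a j * v j)"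
  \<comment> \<open>The value at \<open>a\<close> is the minimizer found by completing the
    square.\<close>
  define v' where "v' = v(a := - s / X a a)"
  have herm: "X i a = cnj (X a i)" if "i \<in> I" for i
    using pos_hermitian[OF _ X, of a i] assms that by auto
  have s': "(\<Sum>i\<in>I. cnj (v i) * X i a) = cnj s"
    by (simp add: s_def herm mult_ac)
  have v'I: "v' i = v i" if "i \<in> I" for i using that assms by (auto simp: v'_def)
  have real: "cnj (X a a) = X a a" using pos_hermitian[OF _ X, of a a] assms by auto
  have "sesq (insert a I) X v' v' = cnj (v' a) * X a a * v' a + cnj (v' a) * s + cnj s * v' a
      + sesq I X v v"
    by (simp add: sesq_insert assms v'I s_def[symmetric] s'
        cong: sum.cong) (rule sesq_cong, auto simp: v'I)
  also have "\<dots> = sesq I X v v - cnj s * s / X a a"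
    using aa real by (simp add: v'_def field_simps)
  also have "cnj s * s / X a a = sesq I (\<lambda>i j. X i a * X a j / X a a) v v"
  proof -
    have "cnj s * s / X a a = (\<Sum>i\<in>I. cnj (v i) * X i a) * (\<Sum>j\<in>I. X a j * v j) / X a a"
      by (simp only: s' s_def)
    also have "\<dots> = sesq I (\<lambda>i j. X i a * X a j / X a a) v v"
      unfolding sesq_def sum_product sum_divide_distrib by (simp add: mult_ac)
    finally show ?thesis .
  qed
  finally show "0 \<le> sesq I (\<lambda>i j. X i j - X i a * X a j / X a a) v v"
    using pos_sesq[OF X, of v'] by (simp add: sesq_diff_kernel)
qed

text \<open>Along e_j + c e_i the form has no quadratic term in c. With c = -t times the entry
  \<open>X i j\<close> it is affine in t with slope -2 |X i j|^2, and nonnegativity for all real t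
  forces the slope to vanish.\<close>

lemma pos_zero_diag:
  assumes "finite I" "pos I X" "i \<in> I" "j \<in> I" "X i i = 0"
  shows "X i j = 0"
proof -
  let ?e = "\<lambda>i k. of_bool (k = i) :: complex"
  have real: "Re (X j i) = Re (X i j)" "Im (X j i) = - Im (X i j)"
    using pos_hermitian[OF assms(1-4)] by simp_all
  define n where "n = (Re (X i j))\<^sup>2 + (Im (X i j))\<^sup>2"
  have ineq: "0 \<le> Re (X j j) - 2 * t * n" for t :: real
  proof -
    define c where "c = - of_real t * cnj (X j i)"
    have "0 \<le> Re (sesq I X (\<lambda>k. ?e j k + c * ?e i k) (\<lambda>k. ?e j k + c * ?e i k))"
      by (rule pos_Re[OF assms(2)])
    also have "\<dots> = Re (X j j) - 2 * t * n"
      unfolding sesq_comb using assms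
      by (simp add: sesq_unit c_def n_def real power2_eq_square algebra_simps)
    finally show ?thesis .
  qed
  have "n = 0"
  proof (rule ccontr)
    assume "n \<noteq> 0"
    thus False using ineq[of "(Re (X j j) + 1) / (2 * n)"] by simp
  qed
  thus ?thesis by (simp add: n_def complex_eq_iff sum_power2_eq_zero_iff)
qed

text \<open>Indices are eliminated one at a time: a zero pivot has a zero row and column, and a
  nonzero pivot splits off a rank-one term and leaves the Schur complement, which is positive
  again.\<close>

lemma pos_cholesky:
  assumes "finite I" "pos I X"
  shows "\<exists>w. \<forall>i\<in>I. \<forall>j\<in>I. X i j = (\<Sum>k\<in>I. w k i * cnj (w k j))"
  using assms
proof (induction I arbitrary: X rule: finite_induct)
  case (insert a I)
  have aa: "0 \<le> X a a" using pos_diag[OF _ insert.prems] insert.hyps by simp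
  have herm: "X i a = cnj (X a i)" if "i \<in> insert a I" for i
    using pos_hermitian[OF _ insert.prems, of a i] insert.hyps that by auto
  show ?case
  proof (cases "X a a = 0")
    case True
    have z: "X a i = 0" if "i \<in> insert a I" for i
      using pos_zero_diag[OF _ insert.prems _ that True] insert.hyps by auto
    hence z': "X i a = 0" if "i \<in> insert a I" for i using herm[OF that] that by simp
    have "sesq I X v v = sesq (insert a I) X v v" for v
      using insert.hyps by (simp add: sesq_insert z z')
    hence "pos I X" using insert.prems by (simp add: pos_def)
    then obtain w where w: "\<forall>i\<in>I. \<forall>j\<in>I. X i j = (\<Sum>k\<in>I. w k i * cnj (w k j))"
      using insert.IH by blast
    define w' where "w' k i = (if k = a \<or> i = a then 0 else w k i)" for k i
    have "X i j = (\<Sum>k\<in>insert a I. w' k i * cnj (w' k j))"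
      if "i \<in> insert a I" "j \<in> insert a I" for i j
    proof -
      have "(\<Sum>k\<in>I. w' k i * cnj (w' k j)) = X i j"
      proof (cases "i = a \<or> j = a")
        case False
        hence "i \<in> I" "j \<in> I" using that by auto
        have "(\<Sum>k\<in>I. w' k i * cnj (w' k j)) = (\<Sum>k\<in>I. w k i * cnj (w k j))"
          using False insert.hyps by (intro sum.cong refl) (auto simp: w'_def)
        thus ?thesis using w \<open>i \<in> I\<close> \<open>j \<in> I\<close> by simp
      qed (use that z z' in \<open>auto simp: w'_def\<close>)
      thus ?thesis using insert.hyps by (simp add: w'_def[of a])
    qed
    thus ?thesis by blast
  next
    case False
    then obtain r where r: "r > 0" "X a a = of_real r"
      using aa by (cases "X a a") (auto simp: zero_le_complex_iff complex_eq_iff)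
    obtain w where w: "\<forall>i\<in>I. \<forall>j\<in>I. X i j - X i a * X a j / X a a = (\<Sum>k\<in>I. w k i * cnj (w k j))"
      using insert.IH[OF pos_insert_schur[OF insert.hyps insert.prems False]] by blast
    define w' where "w' k i = (if k = a then X i a / of_real (sqrt r) else if i = a then 0 else w k i)" for k i
    have "X i j = (\<Sum>k\<in>insert a I. w' k i * cnj (w' k j))"
      if ij: "i \<in> insert a I" "j \<in> insert a I" for i j
    proof -
      have sq: "complex_of_real (sqrt r) * of_real (sqrt r) = of_real r"
        using r by (simp flip: of_real_mult)
      have 1: "w' a i * cnj (w' a j) = X i a * X a j / X a a"
        using herm[OF ij(2)] r by (simp add: w'_def sq)
      have 2: "(\<Sum>k\<in>I. w' k i * cnj (w' k j)) = X i j - X i a * X a j / X a a"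
      proof (cases "i = a \<or> j = a")
        case True
        have "(\<Sum>k\<in>I. w' k i * cnj (w' k j)) = 0"
          using True insert.hyps by (intro sum.neutral) (auto simp: w'_def)
        thus ?thesis using True False by auto
      next
        case F: False
        hence "i \<in> I" "j \<in> I" using that by auto
        have "(\<Sum>k\<in>I. w' k i * cnj (w' k j)) = (\<Sum>k\<in>I. w k i * cnj (w k j))"
          using F insert.hyps by (intro sum.cong refl) (auto simp: w'_def)
        thus ?thesis using w \<open>i \<in> I\<close> \<open>j \<in> I\<close> by simp
      qed
      show ?thesis using insert.hyps by (simp add: 1 2)
    qed
    thus ?thesis by blast
  qed
qed simp

lemma trk_gram:
  assumes "\<And>i j. \<lbrakk>i \<in> I; j \<in> I\<rbrakk> \<Longrightarrow> Y i j = (\<Sum>k\<in>K. w k i * cnj (w k j))"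
  shows "trk I X Y = (\<Sum>k\<in>K. sesq I X (w k) (w k))"
proof -
  have "trk I X Y = (\<Sum>i\<in>I. \<Sum>j\<in>I. \<Sum>k\<in>K. cnj (w k i) * X i j * w k j)"
    unfolding trk_def by (intro sum.cong refl) (simp add: assms sum_distrib_left mult_ac)
  also have "\<dots> = (\<Sum>i\<in>I. \<Sum>k\<in>K. \<Sum>j\<in>I. cnj (w k i) * X i j * w k j)"
    by (intro sum.cong refl) (rule sum.swap)
  also have "\<dots> = (\<Sum>k\<in>K. sesq I X (w k) (w k))"
    unfolding sesq_def by (rule sum.swap)
  finally show ?thesis .
qed

lemma trk_nonneg:
  assumes "finite I" "pos I X" "pos I Y"
  shows "0 \<le> trk I X Y"
proof -
  obtain w where "\<forall>i\<in>I. \<forall>j\<in>I. Y i j = (\<Sum>k\<in>I. w k i * cnj (w k j))"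
    using pos_cholesky[OF assms(1,3)] by blast
  hence "trk I X Y = (\<Sum>k\<in>I. sesq I X (w k) (w k))" by (intro trk_gram) auto
  thus ?thesis by (simp add: sum_nonneg pos_sesq[OF assms(2)])
qed

lemma sesq_idk: "finite I \<Longrightarrow> sesq I idk u v = (\<Sum>i\<in>I. cnj (u i) * v i)"
  unfolding sesq_def idk_def by (intro sum.cong refl) (simp add: of_bool_def if_distrib[of "\<lambda>x. _ * x"] if_distrib[of "\<lambda>x. x * _"] cong: if_cong)

lemma pos_idk: "finite I \<Longrightarrow> pos I idk"
  by (simp add: pos_def sesq_idk sum_nonneg cnj_mult_self_nonneg)

lemma trk_idk: "finite I \<Longrightarrow> trk I idk Y = (\<Sum>i\<in>I. Y i i)"
  unfolding trk_def idk_def by (intro sum.cong refl) (simp add: of_bool_def if_distrib[of "\<lambda>x. _ * x"] if_distrib[of "\<lambda>x. x * _"] cong: if_cong)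

section \<open>A Hayashi--Nagaoka inequality\<close>

lemma sum4_swap:
  "(\<Sum>i\<in>I. \<Sum>j\<in>J. \<Sum>k\<in>K. \<Sum>l\<in>L. f i j k l) = (\<Sum>k\<in>K. \<Sum>l\<in>L. \<Sum>i\<in>I. \<Sum>j\<in>J. (f i j k l :: 'a :: comm_monoid_add))"
proof -
  have "(\<Sum>i\<in>I. \<Sum>j\<in>J. \<Sum>k\<in>K. \<Sum>l\<in>L. f i j k l) = (\<Sum>i\<in>I. \<Sum>k\<in>K. \<Sum>j\<in>J. \<Sum>l\<in>L. f i j k l)"
    by (intro sum.cong refl) (rule sum.swap)
  also have "\<dots> = (\<Sum>k\<in>K. \<Sum>i\<in>I. \<Sum>j\<in>J. \<Sum>l\<in>L. f i j k l)" by (rule sum.swap)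
  also have "\<dots> = (\<Sum>k\<in>K. \<Sum>i\<in>I. \<Sum>l\<in>L. \<Sum>j\<in>J. f i j k l)"
    by (intro sum.cong refl) (rule sum.swap)
  also have "\<dots> = (\<Sum>k\<in>K. \<Sum>l\<in>L. \<Sum>i\<in>I. \<Sum>j\<in>J. f i j k l)"
    by (intro sum.cong refl) (rule sum.swap)
  finally show ?thesis .
qed

lemma sum_mult_sum: "(\<Sum>i\<in>I. \<Sum>j\<in>J. a i * x * b j) = (\<Sum>i\<in>I. a i) * x * (\<Sum>j\<in>J. b j :: 'a :: semiring_0)"
  by (subst sum_distrib_right, subst sum_product) (rule refl)

text \<open>The kernel is the congruence of \<open>X\<close> by \<open>G\<close>, with the adjoint
  of \<open>G\<close> on the left, so its form is the form of \<open>X\<close> at the images under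
  \<open>G\<close>.\<close>

lemma sesq_conj:
  "sesq I (\<lambda>i j. \<Sum>k\<in>K. \<Sum>l\<in>K. cnj (G k i) * X k l * G l j) u v
    = sesq K X (\<lambda>k. \<Sum>i\<in>I. G k i * u i) (\<lambda>k. \<Sum>i\<in>I. G k i * v i)"
proof -
  have "sesq I (\<lambda>i j. \<Sum>k\<in>K. \<Sum>l\<in>K. cnj (G k i) * X k l * G l j) u v
     = (\<Sum>i\<in>I. \<Sum>j\<in>I. \<Sum>k\<in>K. \<Sum>l\<in>K. cnj (G k i * u i) * X k l * (G l j * v j))"
    by (simp add: sesq_def sum_distrib_left sum_distrib_right mult_ac)
  also have "\<dots> = (\<Sum>k\<in>K. \<Sum>l\<in>K. \<Sum>i\<in>I. \<Sum>j\<in>I. cnj (G k i * u i) * X k l * (G l j * v j))"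
    by (rule sum4_swap)
  also have "\<dots> = sesq K X (\<lambda>k. \<Sum>i\<in>I. G k i * u i) (\<lambda>k. \<Sum>i\<in>I. G k i * v i)"
    unfolding sesq_def sum_mult_sum by simp
  finally show ?thesis .
qed

lemma pos_conj: "pos K X \<Longrightarrow> pos I (\<lambda>i j. \<Sum>k\<in>K. \<Sum>l\<in>K. cnj (G k i) * X k l * G l j)"
  by (simp add: pos_def sesq_conj)

lemma sesq_apply:
  assumes "finite I"
  shows "sesq I idk x (\<lambda>i. \<Sum>j\<in>I. X i j * v j) = sesq I X x v"
  by (simp add: sesq_idk[OF assms]) (simp add: sesq_def sum_distrib_left mult_ac)

lemma sesq_add_right: "sesq I X x (\<lambda>i. u i + v i) = sesq I X x u + sesq I X x v"
  by (simp add: sesq_def algebra_simps sum.distrib)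

text \<open>The form of 1 + B at v is at least the squared norm of v, so 1 + B is injective; its
  nonzero determinant then yields a right inverse.\<close>

lemma one_plus_pos_inverse:
  assumes fin: "finite I" and B: "pos I B"
  shows "\<exists>G. \<forall>i\<in>I. \<forall>j\<in>I. (\<Sum>k\<in>I. (idk i k + B i k) * G k j) = idk i j"
proof -
  define n where "n = card I"
  obtain h where h: "bij_betw h {..<n} I"
    using ex_bij_betw_nat_finite[OF fin] by (auto simp: n_def atLeast0LessThan)
  define A where "A = mat n n (\<lambda>(i, j). idk (h i) (h j) + B (h i) (h j))"
  have A: "A \<in> carrier_mat n n" by (simp add: A_def)
  have "det A \<noteq> 0"
  proof
    assume "det A = 0"
    then obtain v where v: "v \<in> carrier_vec n" "v \<noteq> 0\<^sub>v n" "A *\<^sub>v v = 0\<^sub>v n"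
      using det_0_iff_vec_prod_zero[OF A] by blast
    let ?X = "\<lambda>i j. idk (h i) (h j) + B (h i) (h j)"
    have row0: "(\<Sum>j<n. ?X i j * v $ j) = 0" if "i < n" for i
    proof -
      have "(\<Sum>j<n. ?X i j * v $ j) = (A *\<^sub>v v) $ i"
        using that v(1) by (simp add: A_def scalar_prod_def atLeast0LessThan)
      also have "\<dots> = 0" using that by (simp only: v(3) index_zero_vec)
      finally show ?thesis .
    qed
    have "sesq {..<n} ?X (($) v) (($) v) = (\<Sum>i<n. cnj (v $ i) * (\<Sum>j<n. ?X i j * v $ j))"
      by (simp add: sesq_def sum_distrib_left mult_ac)
    also have "\<dots> = 0" by (simp add: row0)
    finally have "sesq {..<n} idk (($) v) (($) v)
        + sesq {..<n} (\<lambda>i j. B (h i) (h j)) (($) v) (($) v) = 0"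
      unfolding sesq_add_kernel
      by (subst sesq_cong[of "{..<n}" idk "\<lambda>i j. idk (h i) (h j)"])
        (use h in \<open>auto simp: idk_def bij_betw_def inj_on_def\<close>)
    moreover have "0 \<le> sesq {..<n} (\<lambda>i j. B (h i) (h j)) (($) v) (($) v)"
      using B by (intro pos_sesq) (simp add: pos_reindex[OF h])
    moreover have "0 \<le> sesq {..<n} idk (($) v) (($) v)" by (intro pos_sesq pos_idk) simp
    ultimately have "sesq {..<n} idk (($) v) (($) v) = 0"
      by (auto simp: zero_le_complex_iff complex_eq_iff)
    hence "(\<Sum>i<n. cnj (v $ i) * v $ i) = 0" by (simp add: sesq_idk)
    hence "\<forall>i\<in>{..<n}. cnj (v $ i) * v $ i = 0"
      by (subst (asm) sum_nonneg_eq_0_iff) (auto simp: cnj_mult_self_nonneg)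
    hence "v = 0\<^sub>v n" using v(1) by (intro eq_vecI) auto
    thus False using v by simp
  qed
  from det_non_zero_imp_unit[OF A this]
  obtain C where C: "C \<in> carrier_mat n n" "A * C = 1\<^sub>m n"
    unfolding Units_def by (auto simp: ring_mat_simps)
  define h' where "h' = inv_into {..<n} h"
  have h': "h' i < n" "h (h' i) = i" if "i \<in> I" for i
    using that h by (auto simp: h'_def bij_betw_def inv_into_into f_inv_into_f
        dest: inv_into_into[of i h "{..<n}"])
  have hh: "h' (h k) = k" if "k < n" for k
    using that h by (simp add: h'_def bij_betw_def inv_into_f_f)
  have "(\<Sum>k\<in>I. (idk i k + B i k) * C $$ (h' k, h' j)) = idk i j" if "i \<in> I" "j \<in> I" for i j
  proof -
    have "(\<Sum>k\<in>I. (idk i k + B i k) * C $$ (h' k, h' j))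
       = (\<Sum>k<n. (idk i (h k) + B i (h k)) * C $$ (h' (h k), h' j))"
      using sum.reindex_bij_betw[OF h, of "\<lambda>k. (idk i k + B i k) * C $$ (h' k, h' j)"] by simp
    also have "\<dots> = (\<Sum>k<n. A $$ (h' i, k) * C $$ (k, h' j))"
      using that by (intro sum.cong refl) (simp add: A_def h' hh)
    also have "\<dots> = (A * C) $$ (h' i, h' j)"
      using that h' A C(1) by (simp add: scalar_prod_def atLeast0LessThan)
    also have "\<dots> = idk i j"
      using that h' unfolding C by (simp add: idk_def) metis
    finally show ?thesis .
  qed
  thus ?thesis by (intro exI[of _ "\<lambda>k j. C $$ (h' k, h' j)"]) simp
qed

lemma Re_sesq_diff:
  assumes "pos I X"
  shows "Re (sesq I X (\<lambda>i. u i - c * v i) (\<lambda>i. u i - c * v i))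
    = Re (sesq I X u u) - 2 * Re c * Re (sesq I X u v) + 2 * Im c * Im (sesq I X u v)
      + ((Re c)\<^sup>2 + (Im c)\<^sup>2) * Re (sesq I X v v)"
proof -
  have im: "Im (sesq I X v v) = 0" using pos_sesq[OF assms, of v] by (simp add: zero_le_complex_iff)
  have e: "sesq I X (\<lambda>i. u i - c * v i) (\<lambda>i. u i - c * v i)
     = sesq I X u u - c * sesq I X u v - cnj c * cnj (sesq I X u v) + cnj c * c * sesq I X v v"
    using sesq_comb[of I X u "- c" v] pos_sym[OF assms, of v u] by simp
  show ?thesis unfolding e using im
    by (simp add: algebra_simps power2_eq_square)
qed

text \<open>The Hayashi--Nagaoka inequality in the form evaluated at \<open>\<phi> = (1 + S + T) u\<close>: replacing the
  usual \<open>(S + T)\<^sup>-\<^sup>1\<^sup>/\<^sup>2\<close> by \<open>2 (1 + S + T)\<^sup>-\<^sup>1\<close> gives the same constants and needs no operator roots.\<close>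

lemma hayashi_nagaoka_form:
  fixes S T :: "'i \<Rightarrow> 'i \<Rightarrow> complex"
  assumes fin: "finite I" and S: "pos I S" and S1: "pos I (\<lambda>i j. idk i j - S i j)" and T: "pos I T"
    and phi: "\<And>i. i \<in> I \<Longrightarrow> \<phi> i = u i + (\<Sum>j\<in>I. (S i j + T i j) * u j)"
  shows "Re (sesq I idk \<phi> \<phi>) - 4 * Re (sesq I S u u)
      \<le> 2 * (Re (sesq I idk \<phi> \<phi>) - Re (sesq I S \<phi> \<phi>)) + 4 * Re (sesq I T \<phi> \<phi>)"
    and "4 * (Re (sesq I S u u) + Re (sesq I T u u)) \<le> Re (sesq I idk \<phi> \<phi>)"
proof -
  have E: "pos I idk" by (rule pos_idk[OF fin])
  have rel: "sesq I idk x \<phi> = sesq I idk x u + sesq I S x u + sesq I T x u" for x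
  proof -
    have "sesq I idk x \<phi> = sesq I idk x (\<lambda>i. u i + (\<Sum>j\<in>I. (S i j + T i j) * u j))"
      by (rule sesq_cong) (auto simp: phi)
    thus ?thesis by (simp add: sesq_add_right sesq_apply[OF fin] sesq_add_kernel)
  qed
  have r1: "Re (sesq I idk u \<phi>) = Re (sesq I idk u u) + Re (sesq I S u u) + Re (sesq I T u u)"
    by (simp add: rel)
  have r2: "Re (sesq I idk \<phi> \<phi>) = Re (sesq I idk \<phi> u) + Re (sesq I S \<phi> u) + Re (sesq I T \<phi> u)"
    by (simp add: rel)
  have r3: "Re (sesq I idk u \<phi>) = Re (sesq I idk \<phi> u)" using pos_sym[OF E, of u \<phi>] by simp
  note d = Re_sesq_diff[of I _ \<phi> _ u]
  have h2: "0 \<le> Re (sesq I idk \<phi> \<phi>) - 4 * Re (sesq I idk \<phi> u) + 4 * Re (sesq I idk u u)"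
    using pos_Re[OF E, of "\<lambda>i. \<phi> i - 2 * u i"] by (simp add: d[OF E])
  have s2: "0 \<le> Re (sesq I S \<phi> \<phi>) - 4 * Re (sesq I S \<phi> u) + 4 * Re (sesq I S u u)"
    using pos_Re[OF S, of "\<lambda>i. \<phi> i - 2 * u i"] by (simp add: d[OF S])
  have t1: "0 \<le> Re (sesq I T \<phi> \<phi>) - 2 * Re (sesq I T \<phi> u) + Re (sesq I T u u)"
    using pos_Re[OF T, of "\<lambda>i. \<phi> i - 1 * u i"] by (simp only: d[OF T]) simp
  have k: "0 \<le> (Re (sesq I idk \<phi> \<phi>) - Re (sesq I S \<phi> \<phi>))
      - 2 * (Re (sesq I idk \<phi> u) - Re (sesq I S \<phi> u)) + (Re (sesq I idk u u) - Re (sesq I S u u))"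
    using pos_Re[OF S1, of "\<lambda>i. \<phi> i - 1 * u i"]
    by (simp only: sesq_diff_kernel minus_complex.sel d[OF E] d[OF S]) simp
  have t0: "0 \<le> Re (sesq I T u u)" by (rule pos_Re[OF T])
  \<comment> \<open>With each name standing for the right-hand side of that fact, the difference of
    the two sides is 8 \<open>k\<close> + 6 \<open>s2\<close> + 4 \<open>t1\<close> +
    \<open>h2\<close> + 8 \<open>t0\<close>, after \<open>r1\<close>, \<open>r2\<close> and
    \<open>r3\<close> have been used to eliminate mixed terms. For the second inequality the
    difference is \<open>h2\<close> alone.\<close>
  show "Re (sesq I idk \<phi> \<phi>) - 4 * Re (sesq I S u u)
      \<le> 2 * (Re (sesq I idk \<phi> \<phi>) - Re (sesq I S \<phi> \<phi>)) + 4 * Re (sesq I T \<phi> \<phi>)"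
    using r1 r2 r3 h2 s2 t1 k t0 by argo
  show "4 * (Re (sesq I S u u) + Re (sesq I T u u)) \<le> Re (sesq I idk \<phi> \<phi>)"
    using r1 r2 r3 h2 by argo
qed

lemma pos_Im:
  assumes "pos I X" shows "Im (sesq I X v v) = 0"
  using pos_sesq[OF assms, of v] by (simp add: zero_le_complex_iff)

text \<open>\<open>\<Lambda> m\<close> is 4 times the congruence of \<open>T m\<close> by the
  inverse of 1 + B, where B is the sum of all tests. Every \<phi> is the image under 1 + B of some
  u, so the form inequalities apply with \<open>T m\<close> and the sum of the other tests; the
  second one says that the \<open>\<Lambda> m\<close> sum to at most the identity.\<close>

lemma hayashi_nagaoka:
  fixes T :: "'m \<Rightarrow> 'i \<Rightarrow> 'i \<Rightarrow> complex"
  assumes fin: "finite I" and finM: "finite M"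
    and T: "\<And>m. m \<in> M \<Longrightarrow> pos I (T m)"
    and T1: "\<And>m. m \<in> M \<Longrightarrow> pos I (\<lambda>i j. idk i j - T m i j)"
  obtains \<Lambda> where "\<And>m. m \<in> M \<Longrightarrow> pos I (\<Lambda> m)"
    and "pos I (\<lambda>i j. idk i j - (\<Sum>m\<in>M. \<Lambda> m i j))"
    and "\<And>m. m \<in> M \<Longrightarrow> pos I (\<lambda>i j. 2 * (idk i j - T m i j) + 4 * (\<Sum>k\<in>M - {m}. T k i j)
            - (idk i j - \<Lambda> m i j))"
proof -
  define B where "B i j = (\<Sum>m\<in>M. T m i j)" for i j
  have B: "pos I B" unfolding B_def using T by (rule pos_sum)
  obtain G where G: "\<And>i j. \<lbrakk>i \<in> I; j \<in> I\<rbrakk> \<Longrightarrow> (\<Sum>k\<in>I. (idk i k + B i k) * G k j) = idk i j"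
    using one_plus_pos_inverse[OF fin B] by blast
  define \<Lambda> where "\<Lambda> m i j = 4 * (\<Sum>k\<in>I. \<Sum>l\<in>I. cnj (G k i) * T m k l * G l j)" for m i j
  define u where "u \<phi> k = (\<Sum>i\<in>I. G k i * \<phi> i)" for \<phi> :: "'i \<Rightarrow> complex" and k
  have L: "sesq I (\<Lambda> m) \<phi> \<phi> = 4 * sesq I (T m) (u \<phi>) (u \<phi>)" for m \<phi>
    unfolding \<Lambda>_def sesq_scale_kernel sesq_conj u_def ..
  have phi: "\<phi> i = u \<phi> i + (\<Sum>j\<in>I. B i j * u \<phi> j)" if "i \<in> I" for \<phi> i
  proof -
    have "(\<Sum>k\<in>I. (idk i k + B i k) * u \<phi> k) = (\<Sum>k\<in>I. \<Sum>j\<in>I. (idk i k + B i k) * G k j * \<phi> j)"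
      by (simp add: u_def sum_distrib_left mult_ac)
    also have "\<dots> = (\<Sum>j\<in>I. (\<Sum>k\<in>I. (idk i k + B i k) * G k j) * \<phi> j)"
      by (subst sum.swap) (simp add: sum_distrib_right)
    also have "\<dots> = (\<Sum>j\<in>I. idk i j * \<phi> j)" using that by (simp add: G)
    also have "\<dots> = \<phi> i"
      using that fin by (simp add: idk_def of_bool_def if_distrib[of "\<lambda>x. x * _"] cong: if_cong)
    finally have "\<phi> i = (\<Sum>k\<in>I. idk i k * u \<phi> k) + (\<Sum>k\<in>I. B i k * u \<phi> k)"
      by (simp add: algebra_simps sum.distrib)
    also have "(\<Sum>k\<in>I. idk i k * u \<phi> k) = u \<phi> i"
      using that fin by (simp add: idk_def of_bool_def if_distrib[of "\<lambda>x. x * _"] cong: if_cong)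
    finally show ?thesis .
  qed
  define T' where "T' m i j = (\<Sum>k\<in>M - {m}. T k i j)" for m i j
  have T': "pos I (T' m)" for m unfolding T'_def by (rule pos_sum) (use T in auto)
  have BT: "B i j = T m i j + T' m i j" if "m \<in> M" for m i j
    unfolding B_def T'_def using that finM by (simp add: sum.remove)
  have HN: "Re (sesq I idk \<phi> \<phi>) - 4 * Re (sesq I (T m) (u \<phi>) (u \<phi>))
      \<le> 2 * (Re (sesq I idk \<phi> \<phi>) - Re (sesq I (T m) \<phi> \<phi>)) + 4 * Re (sesq I (T' m) \<phi> \<phi>)"
    "4 * (Re (sesq I (T m) (u \<phi>) (u \<phi>)) + Re (sesq I (T' m) (u \<phi>) (u \<phi>))) \<le> Re (sesq I idk \<phi> \<phi>)"
    if m: "m \<in> M" for m \<phi>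
    using hayashi_nagaoka_form[OF fin T[OF m] T1[OF m] T'[of m], of \<phi> "u \<phi>"] phi BT[OF m]
    by auto
  have E: "pos I idk" by (rule pos_idk[OF fin])
  have posL: "pos I (\<Lambda> m)" if "m \<in> M" for m
    unfolding pos_def L using pos_sesq[OF T[OF that]] by (simp add: zero_le_complex_iff)
  show ?thesis
  proof (rule that)
    show "pos I (\<Lambda> m)" if "m \<in> M" for m using that by (rule posL)
    show "pos I (\<lambda>i j. idk i j - (\<Sum>m\<in>M. \<Lambda> m i j))"
    proof (cases "M = {}")
      case True
      thus ?thesis using E by simp
    next
      case False
      then obtain m where m: "m \<in> M" by blast
      show ?thesis unfolding pos_def
      proof
        fix \<phi>
        have "(\<Sum>k\<in>M. sesq I (\<Lambda> k) \<phi> \<phi>) = 4 * sesq I B (u \<phi>) (u \<phi>)"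
          unfolding L B_def sesq_sum_kernel by (simp add: sum_distrib_left)
        also have "sesq I B (u \<phi>) (u \<phi>) = sesq I (T m) (u \<phi>) (u \<phi>) + sesq I (T' m) (u \<phi>) (u \<phi>)"
          unfolding sesq_add_kernel[symmetric] by (rule sesq_cong) (simp_all add: BT[OF m])
        finally show "0 \<le> sesq I (\<lambda>i j. idk i j - (\<Sum>m\<in>M. \<Lambda> m i j)) \<phi> \<phi>"
          using HN(2)[OF m, of \<phi>] pos_Im[OF E, of \<phi>] pos_Im[OF T[OF m], of "u \<phi>"]
            pos_Im[OF T', of m "u \<phi>"]
          by (simp add: sesq_diff_kernel sesq_sum_kernel zero_le_complex_iff)
      qed
    qed
    show "pos I (\<lambda>i j. 2 * (idk i j - T m i j) + 4 * (\<Sum>k\<in>M - {m}. T k i j)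
            - (idk i j - \<Lambda> m i j))" if m: "m \<in> M" for m
      unfolding pos_def
    proof
      fix \<phi>
      show "0 \<le> sesq I (\<lambda>i j. 2 * (idk i j - T m i j) + 4 * (\<Sum>k\<in>M - {m}. T k i j)
            - (idk i j - \<Lambda> m i j)) \<phi> \<phi>"
        using HN(1)[OF m, of \<phi>] pos_Im[OF E, of \<phi>] pos_Im[OF T[OF m], of \<phi>]
            pos_Im[OF T[OF m], of "u \<phi>"] pos_Im[OF T', of m \<phi>]
        unfolding T'_def[symmetric]
        by (simp add: sesq_diff_kernel sesq_add_kernel sesq_scale_kernel L zero_le_complex_iff)
    qed
  qed
qed

section \<open>Channels in coordinates\<close>

lemma psd_iff_pos: "psd n X \<longleftrightarrow> X \<in> carrier_mat n n \<and> pos {..<n} (\<lambda>i j. X $$ (i, j))"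
proof -
  have *: "(X *\<^sub>v v) \<bullet>c v = sesq {..<n} (\<lambda>i j. X $$ (i, j)) (($) v) (($) v)"
    if "X \<in> carrier_mat n n" "v \<in> carrier_vec n" for v
    using that
    by (simp add: sesq_def scalar_prod_def atLeast0LessThan sum_distrib_left sum_distrib_right mult_ac)
  have "sesq {..<n} (\<lambda>i j. X $$ (i, j)) v v
      = sesq {..<n} (\<lambda>i j. X $$ (i, j)) (($) (vec n v)) (($) (vec n v))" for v
    by (rule sesq_cong) auto
  thus ?thesis unfolding psd_def pos_def
    by (metis * vec_carrier)
qed

lemma bij_pair: "bij_betw (\<lambda>(a, k). a * q + k) ({..<p} \<times> {..<q}) {..<p * q :: nat}"
proof (rule bij_betwI[where g = "\<lambda>i. (i div q, i mod q)"])
  have "a * q + k < p * q" if "a < p" "k < q" for a k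
  proof -
    have "a * q + k < Suc a * q" using that by simp
    also have "\<dots> \<le> p * q" using that by (intro mult_right_mono) auto
    finally show ?thesis .
  qed
  thus "(\<lambda>(a, k). a * q + k) \<in> {..<p} \<times> {..<q} \<rightarrow> {..<p * q}" by auto
  show "(\<lambda>i. (i div q, i mod q)) \<in> {..<p * q} \<rightarrow> {..<p} \<times> {..<q}"
    by (auto simp: less_mult_imp_div_less intro!: mod_less_divisor gr0I)
qed auto

lemma pair_less: "\<lbrakk>a < p; k < q\<rbrakk> \<Longrightarrow> a * q + k < p * (q::nat)"
  using bij_pair[of q p] by (auto simp: bij_betw_def)

lemma sum_pair: "(\<Sum>i<p * q. f i) = (\<Sum>a<p. \<Sum>k<q. f (a * q + k :: nat))"
  using sum.reindex_bij_betw[OF bij_pair, of f q p]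
  by (simp add: sum.cartesian_product case_prod_beta)

definition pair_kernel :: "nat \<Rightarrow> complex mat \<Rightarrow> nat \<times> nat \<Rightarrow> nat \<times> nat \<Rightarrow> complex" where
  "pair_kernel q X = (\<lambda>(a, k) (a', k'). X $$ (a * q + k, a' * q + k'))"

lemma psd_iff_pos_pair:
  "psd (p * q) X \<longleftrightarrow> X \<in> carrier_mat (p * q) (p * q) \<and> pos ({..<p} \<times> {..<q}) (pair_kernel q X)"
  unfolding psd_iff_pos pos_reindex[OF bij_pair] pair_kernel_def
  by (simp add: case_prod_beta')

lemma mtrace_mult:
  assumes "X \<in> carrier_mat n n" "Y \<in> carrier_mat n n"
  shows "mtrace (X * Y) = trk {..<n} (\<lambda>i j. X $$ (i, j)) (\<lambda>i j. Y $$ (i, j))"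
  using assms by (simp add: mtrace_def trk_def scalar_prod_def atLeast0LessThan)

lemma mtrace_mult_pair:
  assumes "X \<in> carrier_mat (p * q) (p * q)" "Y \<in> carrier_mat (p * q) (p * q)"
  shows "mtrace (X * Y) = trk ({..<p} \<times> {..<q}) (pair_kernel q X) (pair_kernel q Y)"
  unfolding mtrace_mult[OF assms] trk_reindex[OF bij_pair] pair_kernel_def
  by (simp add: case_prod_beta')

lemma sum3_rotate:
  "(\<Sum>b\<in>B. \<Sum>a\<in>A. \<Sum>a'\<in>A'. f b a a') = (\<Sum>a\<in>A. \<Sum>a'\<in>A'. \<Sum>b\<in>B. (f b a a' :: 'x :: comm_monoid_add))"
proof -
  have "(\<Sum>b\<in>B. \<Sum>a\<in>A. \<Sum>a'\<in>A'. f b a a') = (\<Sum>a\<in>A. \<Sum>b\<in>B. \<Sum>a'\<in>A'. f b a a')" by (rule sum.swap)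
  also have "\<dots> = (\<Sum>a\<in>A. \<Sum>a'\<in>A'. \<Sum>b\<in>B. f b a a')"
    by (rule sum.cong[OF refl], rule sum.swap)
  finally show ?thesis .
qed

lemma sum_unit2:
  fixes a a' :: nat
  assumes "a < p" "a' < q"
  shows "(\<Sum>i<p. \<Sum>j<q. g i j * of_bool (i = a \<and> j = a')) = (g a a' :: complex)"
proof -
  have "(\<Sum>i<p. \<Sum>j<q. g i j * of_bool (i = a \<and> j = a'))
      = (\<Sum>z\<in>{..<p} \<times> {..<q}. if z = (a, a') then g (fst z) (snd z) else 0)"
    unfolding sum.cartesian_product by (intro sum.cong refl) auto
  thus ?thesis using assms by simp
qed

text \<open>These are the entries of the Choi matrix. Through them a statement about a channel
  becomes one about finite sums, in which limits can be taken entrywise.\<close>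

definition superop :: "nat \<Rightarrow> (complex mat \<Rightarrow> complex mat) \<Rightarrow> nat \<Rightarrow> nat \<Rightarrow> nat \<Rightarrow> nat \<Rightarrow> complex" where
  "superop p \<Phi> b b' a a' = \<Phi> (mat p p (\<lambda>(i, j). of_bool (i = a \<and> j = a'))) $$ (b, b')"

lemma linear_op_sum:
  assumes \<Phi>: "linear_op p r \<Phi>" and "finite Z" and b: "b < r" "b' < r"
  shows "\<Phi> (mat p p (\<lambda>(i, j). \<Sum>z\<in>Z. c z * f z i j)) $$ (b, b')
     = (\<Sum>z\<in>Z. c z * \<Phi> (mat p p (\<lambda>(i, j). f z i j)) $$ (b, b'))"
  using \<open>finite Z\<close>
proof (induction Z)
  case empty
  have "\<Phi> (0 \<cdot>\<^sub>m mat p p (\<lambda>(i, j). 0)) = 0 \<cdot>\<^sub>m \<Phi> (mat p p (\<lambda>(i, j). 0))"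
    using \<Phi> by (simp add: linear_op_def)
  moreover have "0 \<cdot>\<^sub>m mat p p (\<lambda>(i, j). 0) = (mat p p (\<lambda>(i, j). 0) :: complex mat)"
    by (rule eq_matI) auto
  moreover have "\<Phi> (mat p p (\<lambda>(i, j). 0)) \<in> carrier_mat r r"
    using \<Phi> by (simp add: linear_op_def)
  ultimately have "\<Phi> (mat p p (\<lambda>(i, j). 0)) $$ (b, b') = 0"
    using b by (metis carrier_matD index_smult_mat(1) mult_zero_left)
  thus ?case by (simp add: case_prod_beta')
next
  case (insert z Z)
  let ?F = "\<lambda>z. mat p p (\<lambda>(i, j). f z i j)"
  let ?S = "mat p p (\<lambda>(i, j). \<Sum>z\<in>Z. c z * f z i j)"
  have "mat p p (\<lambda>(i, j). \<Sum>z\<in>insert z Z. c z * f z i j) = c z \<cdot>\<^sub>m ?F z + ?S"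
    using insert.hyps by (intro eq_matI) auto
  moreover have "\<Phi> (c z \<cdot>\<^sub>m ?F z + ?S) = c z \<cdot>\<^sub>m \<Phi> (?F z) + \<Phi> ?S"
    using \<Phi> by (simp add: linear_op_def)
  moreover have "\<Phi> (?F z) \<in> carrier_mat r r" "\<Phi> ?S \<in> carrier_mat r r"
    using \<Phi> by (simp_all add: linear_op_def)
  ultimately show ?case using insert.hyps insert.IH b by simp
qed

lemma superop_apply:
  assumes \<Phi>: "linear_op p r \<Phi>" and X: "X \<in> carrier_mat p p" and b: "b < r" "b' < r"
  shows "\<Phi> X $$ (b, b') = (\<Sum>a<p. \<Sum>a'<p. superop p \<Phi> b b' a a' * X $$ (a, a'))"
proof -
  have *: "(\<Sum>z\<in>{..<p} \<times> {..<p}. X $$ z * of_bool (i = fst z \<and> j = snd z)) = X $$ (i, j)"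
    if "i < p" "j < p" for i j
  proof -
    have "(\<Sum>z\<in>{..<p} \<times> {..<p}. X $$ z * of_bool (i = fst z \<and> j = snd z))
        = (\<Sum>z\<in>{..<p} \<times> {..<p}. if z = (i, j) then X $$ z else 0)"
      by (intro sum.cong refl) auto
    thus ?thesis using that by (simp add: sum.delta)
  qed
  have "X = mat p p (\<lambda>(i, j). \<Sum>z\<in>{..<p} \<times> {..<p}. X $$ z * of_bool (i = fst z \<and> j = snd z))"
    using X by (intro eq_matI) (auto simp: * simp del: sum_mult_of_bool_eq)
  hence "\<Phi> X $$ (b, b') = \<Phi> (mat p p (\<lambda>(i, j). \<Sum>z\<in>{..<p} \<times> {..<p}. X $$ z * of_bool (i = fst z \<and> j = snd z))) $$ (b, b')"
    by simp
  also have "\<dots> = (\<Sum>z\<in>{..<p} \<times> {..<p}. X $$ z * \<Phi> (mat p p (\<lambda>(i, j). of_bool (i = fst z \<and> j = snd z))) $$ (b, b'))"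
    by (rule linear_op_sum[OF \<Phi> _ b]) simp
  also have "\<dots> = (\<Sum>a<p. \<Sum>a'<p. superop p \<Phi> b b' a a' * X $$ (a, a'))"
    by (simp add: sum.cartesian_product case_prod_beta superop_def mult.commute)
  finally show ?thesis .
qed

text \<open>The map with coefficients \<open>c\<close>, tensored with the identity, acting on
  kernels.\<close>

definition lift_fst :: "nat \<Rightarrow> (nat \<Rightarrow> nat \<Rightarrow> nat \<Rightarrow> nat \<Rightarrow> complex) \<Rightarrow>
    (nat \<times> 'k \<Rightarrow> nat \<times> 'k \<Rightarrow> complex) \<Rightarrow> nat \<times> 'k \<Rightarrow> nat \<times> 'k \<Rightarrow> complex" where
  "lift_fst p c X = (\<lambda>(b, k) (b', k'). \<Sum>a<p. \<Sum>a'<p. c b b' a a' * X (a, k) (a', k'))"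

lemma apply_fst_carrier [simp]: "apply_fst p r q \<Phi> X \<in> carrier_mat (r * q) (r * q)"
  by (simp add: apply_fst_def)

lemma pair_kernel_apply_fst:
  assumes "linear_op p r \<Phi>" and "b < r" "b' < r" "k < q" "k' < q"
  shows "pair_kernel q (apply_fst p r q \<Phi> X) (b, k) (b', k')
    = lift_fst p (superop p \<Phi>) (pair_kernel q X) (b, k) (b', k')"
proof -
  have "block_snd p q X k k' \<in> carrier_mat p p" by (simp add: block_snd_def)
  thus ?thesis using assms
    by (simp add: pair_kernel_def lift_fst_def apply_fst_def pair_less superop_apply)
      (simp add: block_snd_def)
qed

lemma apply_fst_1:
  assumes "linear_op p r \<Phi>" "X \<in> carrier_mat p p"
  shows "apply_fst p r 1 \<Phi> X = \<Phi> X"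
proof -
  have "block_snd p 1 X 0 0 = X" using assms by (auto simp: block_snd_def)
  moreover have "\<Phi> X \<in> carrier_mat r r" using assms by (simp add: linear_op_def)
  ultimately show ?thesis by (intro eq_matI) (auto simp: apply_fst_def)
qed

text \<open>Complete positivity with a second factor of dimension 1.\<close>

lemma channel_psd:
  assumes "quantum_channel p r \<Phi>" "psd p X"
  shows "psd r (\<Phi> X)"
proof -
  have "completely_positive p r \<Phi>" "psd (p * 1) X"
    using assms by (simp_all add: quantum_channel_def)
  hence "psd (r * 1) (apply_fst p r 1 \<Phi> X)"
    unfolding completely_positive_def by blast
  thus ?thesis using assms by (simp add: apply_fst_1[unfolded One_nat_def] quantum_channel_def psd_def)
qed

lemma channel_apply_fst_psd:
  "\<lbrakk>quantum_channel p r \<Phi>; psd (p * q) X\<rbrakk> \<Longrightarrow> psd (r * q) (apply_fst p r q \<Phi> X)"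
  by (simp add: quantum_channel_def completely_positive_def)

lemma superop_trace:
  assumes "quantum_channel p r \<Phi>" "a < p" "a' < p"
  shows "(\<Sum>b<r. superop p \<Phi> b b a a') = of_bool (a = a')"
proof -
  let ?E = "mat p p (\<lambda>(i, j). of_bool (i = a \<and> j = a')) :: complex mat"
  have E: "?E \<in> carrier_mat p p" by simp
  have "\<Phi> ?E \<in> carrier_mat r r" "mtrace (\<Phi> ?E) = mtrace ?E"
    using assms(1) E by (simp_all only: quantum_channel_def linear_op_def trace_preserving_def)
  hence "(\<Sum>b<r. superop p \<Phi> b b a a') = (\<Sum>i<p. of_bool (i = a \<and> i = a'))"
    by (simp add: mtrace_def superop_def)
  also have "\<dots> = (\<Sum>i<p. if i = a then of_bool (a = a') else 0)"
    by (intro sum.cong refl) auto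
  finally show ?thesis using assms by simp
qed

text \<open>No signalling: tracing out the output of a channel traces out its input, so a channel on
  the first factor leaves the state of the second unchanged.\<close>

lemma sum_lift_fst:
  assumes "quantum_channel p r \<Phi>"
  shows "(\<Sum>b<r. lift_fst p (superop p \<Phi>) X (b, k) (b, k')) = (\<Sum>a<p. X (a, k) (a, k'))"
proof -
  have "(\<Sum>b<r. lift_fst p (superop p \<Phi>) X (b, k) (b, k'))
      = (\<Sum>a<p. \<Sum>a'<p. \<Sum>b<r. superop p \<Phi> b b a a' * X (a, k) (a', k'))"
    unfolding lift_fst_def prod.case
    by (rule sum3_rotate)
  also have "\<dots> = (\<Sum>a<p. \<Sum>a'<p. of_bool (a = a') * X (a, k) (a', k'))"
    by (intro sum.cong refl) (simp add: sum_distrib_right[symmetric] superop_trace[OF assms])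
  finally show ?thesis
    by (simp add: of_bool_def if_distrib[of "\<lambda>x. x * _"] cong: if_cong)
qed

section \<open>Channels in Kraus form\<close>

definition kraus_map :: "nat \<Rightarrow> nat \<Rightarrow> 'z set \<Rightarrow> ('z \<Rightarrow> nat \<Rightarrow> nat \<Rightarrow> complex) \<Rightarrow> complex mat \<Rightarrow> complex mat" where
  "kraus_map p r Z F X = mat r r (\<lambda>(b, b'). \<Sum>a<p. \<Sum>a'<p. (\<Sum>z\<in>Z. F z b a * cnj (F z b' a')) * X $$ (a, a'))"

lemma kraus_map_linear: "linear_op p r (kraus_map p r Z F)"
  unfolding linear_op_def kraus_map_def
  by (auto intro!: eq_matI simp: algebra_simps sum.distrib sum_distrib_left)

lemma superop_kraus:
  assumes "a < p" "a' < p" "b < r" "b' < r"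
  shows "superop p (kraus_map p r Z F) b b' a a' = (\<Sum>z\<in>Z. F z b a * cnj (F z b' a'))"
proof -
  have "superop p (kraus_map p r Z F) b b' a a'
     = (\<Sum>i<p. \<Sum>j<p. (\<Sum>z\<in>Z. F z b i * cnj (F z b' j)) * of_bool (i = a \<and> j = a'))"
    using assms by (simp add: superop_def kraus_map_def)
  thus ?thesis using assms by (simp only: sum_unit2)
qed

lemma cnj_of_bool: "cnj (of_bool P) = of_bool P"
  by simp

text \<open>Each Kraus operator tensored with the identity acts by a congruence, which preserves
  positivity. The assumption is the completeness relation of the Kraus operators.\<close>

lemma kraus_channel:
  assumes tp: "\<And>a a'. \<lbrakk>a < p; a' < p\<rbrakk> \<Longrightarrow> (\<Sum>b<r. \<Sum>z\<in>Z. F z b a * cnj (F z b a')) = of_bool (a = a')"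
  shows "quantum_channel p r (kraus_map p r Z F)"
proof -
  let ?\<Phi> = "kraus_map p r Z F"
  have "completely_positive p r ?\<Phi>"
    unfolding completely_positive_def
  proof (intro allI impI)
    fix q X assume X: "psd (p * q) X"
    let ?I = "{..<r} \<times> {..<q}" and ?J = "{..<p} \<times> {..<q}"
    \<comment> \<open>\<open>G z\<close> is the adjoint of the Kraus operator tensored with the
      identity, because \<open>pos_conj\<close> conjugates the left factor.\<close>
    define G where "G z = (\<lambda>(a, k :: nat) (b, k'). of_bool (k = k') * cnj (F z b a))"
      for z
    have "pos ?I (\<lambda>i j. \<Sum>z\<in>Z. \<Sum>k\<in>?J. \<Sum>l\<in>?J. cnj (G z k i) * pair_kernel q X k l * G z l j)"
      using X by (intro pos_sum pos_conj) (simp add: psd_iff_pos_pair)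
    also have "?this \<longleftrightarrow> pos ?I (pair_kernel q (apply_fst p r q ?\<Phi> X))"
    proof (rule pos_cong)
      fix i j assume ij: "i \<in> ?I" "j \<in> ?I"
      obtain b k b' k' where [simp]: "i = (b, k)" "j = (b', k')" by (cases i, cases j)
      have d: "(\<Sum>n<q. \<Sum>n'<q. g n n' * of_bool (n = k \<and> n' = k')) = (g k k' :: complex)" for g
        using ij by (intro sum_unit2) auto
      have "(\<Sum>k\<in>?J. \<Sum>l\<in>?J. cnj (G z k i) * pair_kernel q X k l * G z l j)
          = (\<Sum>a<p. \<Sum>a'<p. F z b a * cnj (F z b' a') * pair_kernel q X (a, k) (a', k'))" for z
      proof -
        have "(\<Sum>k\<in>?J. \<Sum>l\<in>?J. cnj (G z k i) * pair_kernel q X k l * G z l j)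
          = (\<Sum>a<p. \<Sum>n<q. \<Sum>a'<p. \<Sum>n'<q.
              (F z b a * cnj (F z b' a') * pair_kernel q X (a, n) (a', n')) * of_bool (n = k \<and> n' = k'))"
          unfolding sum.cartesian_product' by (simp add: G_def mult_ac of_bool_conj cnj_of_bool)
        also have "\<dots> = (\<Sum>a<p. \<Sum>a'<p. \<Sum>n<q. \<Sum>n'<q.
              (F z b a * cnj (F z b' a') * pair_kernel q X (a, n) (a', n')) * of_bool (n = k \<and> n' = k'))"
          by (rule sum.cong[OF refl], rule sum.swap)
        finally show ?thesis by (simp only: d)
      qed
      hence "(\<Sum>z\<in>Z. \<Sum>k\<in>?J. \<Sum>l\<in>?J. cnj (G z k i) * pair_kernel q X k l * G z l j)
         = (\<Sum>z\<in>Z. \<Sum>a<p. \<Sum>a'<p. F z b a * cnj (F z b' a') * pair_kernel q X (a, k) (a', k'))"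
        by simp
      also have "\<dots> = (\<Sum>a<p. \<Sum>a'<p. \<Sum>z\<in>Z. F z b a * cnj (F z b' a') * pair_kernel q X (a, k) (a', k'))"
        by (rule sum3_rotate)
      also have "\<dots> = pair_kernel q (apply_fst p r q ?\<Phi> X) i j"
        using ij
        by (simp add: pair_kernel_apply_fst[OF kraus_map_linear] lift_fst_def superop_kraus sum_distrib_right)
      finally show "(\<Sum>z\<in>Z. \<Sum>k\<in>?J. \<Sum>l\<in>?J. cnj (G z k i) * pair_kernel q X k l * G z l j)
         = pair_kernel q (apply_fst p r q ?\<Phi> X) i j" .
    qed
    finally show "psd (r * q) (apply_fst p r q ?\<Phi> X)"
      by (simp add: psd_iff_pos_pair)
  qed
  moreover have "trace_preserving p ?\<Phi>"
    unfolding trace_preserving_def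
  proof
    fix X :: "complex mat" assume X: "X \<in> carrier_mat p p"
    have "mtrace (?\<Phi> X) = (\<Sum>b<r. \<Sum>a<p. \<Sum>a'<p. (\<Sum>z\<in>Z. F z b a * cnj (F z b a')) * X $$ (a, a'))"
      by (simp add: mtrace_def kraus_map_def)
    also have "\<dots> = (\<Sum>a<p. \<Sum>a'<p. \<Sum>b<r. (\<Sum>z\<in>Z. F z b a * cnj (F z b a')) * X $$ (a, a'))"
      by (rule sum3_rotate)
    also have "\<dots> = (\<Sum>a<p. \<Sum>a'<p. of_bool (a = a') * X $$ (a, a'))"
      by (intro sum.cong refl) (simp add: sum_distrib_right[symmetric] tp)
    also have "\<dots> = mtrace X"
      using X by (simp add: mtrace_def of_bool_def if_distrib[of "\<lambda>x. x * _"] cong: if_cong)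
    finally show "mtrace (?\<Phi> X) = mtrace X" .
  qed
  ultimately show ?thesis using kraus_map_linear by (auto simp: quantum_channel_def)
qed

section \<open>Compactness of states and tests\<close>

lemma bounded_complex_subseq:
  fixes s :: "nat \<Rightarrow> complex"
  assumes "\<And>n. norm (s n) \<le> C"
  obtains r l where "strict_mono r" "(\<lambda>n. s (r n)) \<longlonglongrightarrow> l"
proof -
  have B1: "Bseq (\<lambda>n. Re (s (f n)))" for f :: "nat \<Rightarrow> nat"
    using order_trans[OF abs_Re_le_cmod assms] by (intro BseqI'[of _ C]) simp
  have B2: "Bseq (\<lambda>n. Im (s (f n)))" for f :: "nat \<Rightarrow> nat"
    using order_trans[OF abs_Im_le_cmod assms] by (intro BseqI'[of _ C]) simp
  obtain f where f: "strict_mono f" "monoseq (\<lambda>n. Re (s (f n)))"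
    using seq_monosub[of "\<lambda>n. Re (s n)"] by auto
  obtain g where g: "strict_mono g" "monoseq (\<lambda>n. Im (s (f (g n))))"
    using seq_monosub[of "\<lambda>n. Im (s (f n))"] by auto
  obtain a where a: "(\<lambda>n. Re (s (f n))) \<longlonglongrightarrow> a"
    using Bseq_monoseq_convergent[OF B1 f(2)] by (auto simp: convergent_def)
  obtain b where b: "(\<lambda>n. Im (s (f (g n)))) \<longlonglongrightarrow> b"
    using Bseq_monoseq_convergent[OF B2[of "f \<circ> g"]] g(2) by (auto simp: convergent_def)
  have "(\<lambda>n. Complex (Re (s (f (g n)))) (Im (s (f (g n))))) \<longlonglongrightarrow> Complex a b"
    using LIMSEQ_subseq_LIMSEQ[OF a g(1)] b by (intro tendsto_Complex) (auto simp: o_def)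
  thus ?thesis using that[of "f \<circ> g" "Complex a b"] f(1) g(1)
    by (simp add: strict_mono_o)
qed

text \<open>Coordinates are treated in turn, each passing to a further subsequence of the previous
  one.\<close>

lemma bounded_family_subseq:
  fixes s :: "nat \<Rightarrow> 'z \<Rightarrow> complex"
  assumes "finite Z" "\<And>n z. z \<in> Z \<Longrightarrow> norm (s n z) \<le> C"
  shows "\<exists>r l. strict_mono r \<and> (\<forall>z\<in>Z. (\<lambda>n. s (r n) z) \<longlonglongrightarrow> l z)"
  using assms
proof (induction Z)
  case empty
  show ?case by (auto intro: exI[of _ "\<lambda>n. n"] simp: strict_mono_def)
next
  case (insert z Z)
  then obtain r l where r: "strict_mono r" and l: "\<forall>z\<in>Z. (\<lambda>n. s (r n) z) \<longlonglongrightarrow> l z"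
    by auto
  obtain r' m where r': "strict_mono r'" and m: "(\<lambda>n. s (r (r' n)) z) \<longlonglongrightarrow> m"
    using bounded_complex_subseq[of "\<lambda>n. s (r n) z" C] insert.prems by auto
  have "(\<lambda>n. s ((r \<circ> r') n) y) \<longlonglongrightarrow> (l(z := m)) y" if "y \<in> insert z Z" for y
  proof (cases "y = z")
    case False
    hence "((\<lambda>n. s (r n) y) \<circ> r') \<longlonglongrightarrow> l y"
      using that l by (intro LIMSEQ_subseq_LIMSEQ[OF _ r']) auto
    thus ?thesis using False by (simp add: o_def)
  qed (use m in simp)
  thus ?case using strict_mono_o[OF r r'] by blast
qed

section \<open>Pure states, their output kernels and feasible tests\<close>

definition unit_on :: "'j set \<Rightarrow> ('j \<Rightarrow> complex) \<Rightarrow> bool" where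
  "unit_on J f \<longleftrightarrow> (\<Sum>j\<in>J. f j * cnj (f j)) = 1"

definition out_kernel :: "nat \<Rightarrow> (nat \<Rightarrow> nat \<Rightarrow> nat \<Rightarrow> nat \<Rightarrow> complex) \<Rightarrow> (nat \<times> nat \<Rightarrow> complex) \<Rightarrow>
    nat \<times> nat \<Rightarrow> nat \<times> nat \<Rightarrow> complex" where
  "out_kernel p c f = lift_fst p c (\<lambda>x y. f x * cnj (f y))"

text \<open>The product of the two marginals of the pure state with amplitudes \<open>f\<close>,
  before the channel acts.\<close>

definition marg_kernel :: "nat \<Rightarrow> (nat \<times> nat \<Rightarrow> complex) \<Rightarrow> nat \<times> nat \<Rightarrow> nat \<times> nat \<Rightarrow> complex" where
  "marg_kernel p f = (\<lambda>(a, k) (a', k').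
     (\<Sum>z<p. f (a, z) * cnj (f (a', z))) * (\<Sum>y<p. f (y, k) * cnj (f (y, k'))))"

text \<open>The second argument of the divergence: the channel applied to the \<open>A\<close>
  marginal, tensored with the \<open>A'\<close> marginal.\<close>

definition prod_kernel :: "nat \<Rightarrow> (nat \<Rightarrow> nat \<Rightarrow> nat \<Rightarrow> nat \<Rightarrow> complex) \<Rightarrow> (nat \<times> nat \<Rightarrow> complex) \<Rightarrow>
    nat \<times> nat \<Rightarrow> nat \<times> nat \<Rightarrow> complex" where
  "prod_kernel p c f = lift_fst p c (marg_kernel p f)"

text \<open>State and test are varied together, so that the maximum over states and the supremum
  over tests become a single minimization of the type II error.\<close>

definition feasible :: "nat \<Rightarrow> nat \<Rightarrow> (nat \<Rightarrow> nat \<Rightarrow> nat \<Rightarrow> nat \<Rightarrow> complex) \<Rightarrow> real \<Rightarrow>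
    (nat \<times> nat \<Rightarrow> complex) \<Rightarrow> (nat \<times> nat \<Rightarrow> nat \<times> nat \<Rightarrow> complex) \<Rightarrow> bool" where
  "feasible p r c \<epsilon> f t \<longleftrightarrow> unit_on ({..<p} \<times> {..<p}) f \<and>
     pos ({..<r} \<times> {..<p}) t \<and> pos ({..<r} \<times> {..<p}) (\<lambda>i j. idk i j - t i j) \<and>
     1 - \<epsilon> \<le> Re (trk ({..<r} \<times> {..<p}) t (out_kernel p c f))"

text \<open>Complete positivity speaks of matrices, so the kernel is first written out as a
  matrix.\<close>

lemma lift_fst_pos:
  fixes X :: "nat \<times> nat \<Rightarrow> nat \<times> nat \<Rightarrow> complex"
  assumes \<Phi>: "quantum_channel p r \<Phi>" and X: "pos ({..<p} \<times> {..<q}) X"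
  shows "pos ({..<r} \<times> {..<q}) (lift_fst p (superop p \<Phi>) X)"
proof -
  define M where "M = mat (p * q) (p * q) (\<lambda>(i, j). X (i div q, i mod q) (j div q, j mod q))"
  have M: "pair_kernel q M i j = X i j" if "i \<in> {..<p} \<times> {..<q}" "j \<in> {..<p} \<times> {..<q}" for i j
    using that by (auto simp: pair_kernel_def M_def pair_less)
  have "psd (p * q) M"
    unfolding psd_iff_pos_pair using X by (simp add: pos_cong[OF M]) (simp add: M_def)
  hence "pos ({..<r} \<times> {..<q}) (pair_kernel q (apply_fst p r q \<Phi> M))"
    using channel_apply_fst_psd[OF \<Phi>] by (simp add: psd_iff_pos_pair)
  also have "?this \<longleftrightarrow> ?thesis"
  proof (rule pos_cong)
    fix i j assume ij: "i \<in> {..<r} \<times> {..<q}" "j \<in> {..<r} \<times> {..<q}"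
    obtain b k b' k' where [simp]: "i = (b, k)" "j = (b', k')" by (cases i, cases j)
    have "linear_op p r \<Phi>" using \<Phi> by (simp add: quantum_channel_def)
    thus "pair_kernel q (apply_fst p r q \<Phi> M) i j = lift_fst p (superop p \<Phi>) X i j"
      using ij by (simp add: pair_kernel_apply_fst) (simp add: lift_fst_def M)
  qed
  finally show ?thesis .
qed

text \<open>Both marginals are Gram kernels, so their tensor product is one as well, with products
  of the vectors labelled by the pair \<open>(y, z)\<close>.\<close>

lemma pos_marg_kernel: "pos I (marg_kernel p f)"
proof -
  have "pos I (\<lambda>i j. \<Sum>(y, z)\<in>{..<p} \<times> {..<p}. f (fst i, z) * f (y, snd i) * cnj (f (fst j, z) * f (y, snd j)))"
    using pos_gram[where I = I and K = "{..<p} \<times> {..<p}" and w = "\<lambda>(y, z) i. f (fst i, z) * f (y, snd i)"]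
    by (simp add: case_prod_beta')
  also have "?this \<longleftrightarrow> pos I (marg_kernel p f)"
    by (rule pos_cong)
      (simp add: marg_kernel_def case_prod_beta' sum_product sum.cartesian_product mult_ac)
  finally show ?thesis .
qed

lemma pos_prod_kernel:
  "quantum_channel p r \<Phi> \<Longrightarrow> pos ({..<r} \<times> {..<p}) (prod_kernel p (superop p \<Phi>) f)"
  unfolding prod_kernel_def by (rule lift_fst_pos[OF _ pos_marg_kernel])

text \<open>The form at e_i - c e_j for c = 1, -1, i, -i bounds the real and the imaginary part by
  the mean of two diagonal entries, each at most 1. Compactness of the set of tests needs such a
  uniform bound.\<close>

lemma pos_le_one_entry:
  assumes fin: "finite I" and t: "pos I t" "pos I (\<lambda>i j. idk i j - t i j)" and ij: "i \<in> I" "j \<in> I"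
  shows "norm (t i j) \<le> 2"
proof -
  let ?e = "\<lambda>i k. of_bool (k = i) :: complex"
  have d: "Re (t i i) \<le> 1" if "i \<in> I" for i
    using pos_diag[OF fin t(2) that] by (simp add: zero_le_complex_iff idk_def)
  have "0 \<le> Re (sesq I t (\<lambda>k. ?e i k - c * ?e j k) (\<lambda>k. ?e i k - c * ?e j k))" for c
    by (rule pos_Re[OF t(1)])
  hence "0 \<le> Re (t i i) - 2 * Re c * Re (t i j) + 2 * Im c * Im (t i j) + ((Re c)\<^sup>2 + (Im c)\<^sup>2) * Re (t j j)" for c
    unfolding Re_sesq_diff[OF t(1)] sesq_unit[OF fin ij] sesq_unit[OF fin ij(1) ij(1)]
      sesq_unit[OF fin ij(2) ij(2)] .
  from this[of 1] this[of "-1"] this[of \<i>] this[of "-\<i>"] d[OF ij(1)] d[OF ij(2)]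
  have "\<bar>Re (t i j)\<bar> \<le> 1" "\<bar>Im (t i j)\<bar> \<le> 1" by simp_all
  thus ?thesis using cmod_le[of "t i j"] by simp
qed

lemma unit_on_entry:
  assumes "finite J" "unit_on J f" "j \<in> J"
  shows "norm (f j) \<le> 1"
proof -
  have "(\<Sum>j\<in>J. (norm (f j))\<^sup>2) = 1"
    using assms(2) unfolding unit_on_def complex_norm_square[symmetric] of_real_sum[symmetric]
    by (simp only: of_real_eq_1_iff)
  moreover have "(norm (f j))\<^sup>2 \<le> (\<Sum>j\<in>J. (norm (f j))\<^sup>2)"
    by (rule member_le_sum) (use assms in auto)
  ultimately show ?thesis by (simp add: abs_square_le_1)
qed

lemma tendsto_sesq:
  assumes "\<And>i j. \<lbrakk>i \<in> I; j \<in> I\<rbrakk> \<Longrightarrow> (\<lambda>n. X n i j) \<longlonglongrightarrow> Y i j"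
  shows "(\<lambda>n. sesq I (X n) u v) \<longlonglongrightarrow> sesq I Y u v"
  unfolding sesq_def by (intro tendsto_intros assms)

lemma pos_limit:
  assumes "\<And>n. pos I (X n)" and "\<And>i j. \<lbrakk>i \<in> I; j \<in> I\<rbrakk> \<Longrightarrow> (\<lambda>n. X n i j) \<longlonglongrightarrow> Y i j"
  shows "pos I Y"
  unfolding pos_def
proof
  fix v
  have lim: "(\<lambda>n. sesq I (X n) v v) \<longlonglongrightarrow> sesq I Y v v"
    by (rule tendsto_sesq) (rule assms(2))
  have "0 \<le> Re (sesq I Y v v)"
    by (rule LIMSEQ_le_const[OF tendsto_Re[OF lim]]) (use pos_Re[OF assms(1)] in auto)
  moreover have "Im (sesq I Y v v) = 0"
    using tendsto_Im[OF lim] by (simp add: pos_Im[OF assms(1)] LIMSEQ_const_iff)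
  ultimately show "0 \<le> sesq I Y v v" by (simp add: zero_le_complex_iff)
qed

lemma tendsto_trk:
  assumes "\<And>i j. \<lbrakk>i \<in> I; j \<in> I\<rbrakk> \<Longrightarrow> (\<lambda>n. X n i j) \<longlonglongrightarrow> X' i j"
    and "\<And>i j. \<lbrakk>i \<in> I; j \<in> I\<rbrakk> \<Longrightarrow> (\<lambda>n. Y n i j) \<longlonglongrightarrow> Y' i j"
  shows "(\<lambda>n. trk I (X n) (Y n)) \<longlonglongrightarrow> trk I X' Y'"
  unfolding trk_def by (intro tendsto_intros assms)

lemma tendsto_lift_fst:
  assumes "\<And>x y. \<lbrakk>x \<in> {..<p} \<times> K; y \<in> {..<p} \<times> K\<rbrakk> \<Longrightarrow> (\<lambda>n. X n x y) \<longlonglongrightarrow> Y x y"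
    and "i \<in> B \<times> K" "j \<in> B \<times> K"
  shows "(\<lambda>n. lift_fst p c (X n) i j) \<longlonglongrightarrow> lift_fst p c Y i j"
  using assms(2,3) unfolding lift_fst_def
  by (cases i, cases j) (auto intro!: tendsto_intros assms(1))

lemma sum_unit_on: "unit_on (A \<times> B) f \<Longrightarrow> (\<Sum>a\<in>A. \<Sum>k\<in>B. f (a, k) * cnj (f (a, k))) = 1"
  by (simp add: unit_on_def sum.cartesian_product')

lemma trk_idk_out:
  assumes \<Phi>: "quantum_channel p r \<Phi>" and f: "unit_on ({..<p} \<times> {..<p}) f"
  shows "trk ({..<r} \<times> {..<p}) idk (out_kernel p (superop p \<Phi>) f) = 1"
proof -
  have "trk ({..<r} \<times> {..<p}) idk (out_kernel p (superop p \<Phi>) f)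
      = (\<Sum>b<r. \<Sum>k<p. out_kernel p (superop p \<Phi>) f (b, k) (b, k))"
    by (simp add: trk_idk sum.cartesian_product')
  also have "\<dots> = (\<Sum>k<p. \<Sum>b<r. out_kernel p (superop p \<Phi>) f (b, k) (b, k))"
    by (rule sum.swap)
  also have "\<dots> = (\<Sum>k<p. \<Sum>a<p. f (a, k) * cnj (f (a, k)))"
    unfolding out_kernel_def by (simp add: sum_lift_fst[OF \<Phi>])
  also have "\<dots> = 1"
    by (subst sum.swap) (rule sum_unit_on[OF f])
  finally show ?thesis .
qed

text \<open>Feasibility is a closed and bounded condition and the error is continuous in the
  entries, so a minimizing sequence has a subsequence that converges entrywise to a minimizer.
  Working with the error instead of its logarithm treats error 0 like any other value.\<close>

lemma minimal_test_exists:
  assumes p: "0 < p" and \<Phi>: "quantum_channel p r \<Phi>" and \<epsilon>: "0 < \<epsilon>"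
  defines "c \<equiv> superop p \<Phi>" and "I \<equiv> {..<r} \<times> {..<p}"
  obtains f t where "feasible p r c \<epsilon> f t"
    and "\<And>f' t'. feasible p r c \<epsilon> f' t' \<Longrightarrow>
      Re (trk I t (prod_kernel p c f)) \<le> Re (trk I t' (prod_kernel p c f'))"
proof -
  let ?J = "{..<p} \<times> {..<p}"
  let ?g = "\<lambda>f t. Re (trk I t (prod_kernel p c f))"
  define V where "V = {?g f t | f t. feasible p r c \<epsilon> f t}"
  have fin: "finite I" "finite ?J" by (simp_all add: I_def)
  have nonneg: "0 \<le> ?g f t" if "feasible p r c \<epsilon> f t" for f t
  proof -
    have "0 \<le> trk I t (prod_kernel p c f)"
      using that pos_prod_kernel[OF \<Phi>] by (intro trk_nonneg[OF fin(1)]) (simp_all add: feasible_def c_def I_def)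
    thus ?thesis by (simp add: zero_le_complex_iff)
  qed
  hence bdd: "bdd_below V" by (auto simp: V_def intro!: bdd_belowI[of _ 0])
  have "V \<noteq> {}"
  proof -
    \<comment> \<open>The state |00> with the trivial test is feasible; it exists because
      \<open>0 < p\<close>.\<close>
    define f :: "nat \<times> nat \<Rightarrow> complex" where "f z = of_bool (z = (0, 0))" for z
    have uf: "unit_on ?J f"
    proof -
      have "(\<Sum>j\<in>?J. f j * cnj (f j)) = (\<Sum>j\<in>?J. if j = (0, 0) then 1 else 0)"
        by (intro sum.cong refl) (simp add: f_def)
      thus ?thesis using p by (simp add: unit_on_def)
    qed
    have "trk I idk (out_kernel p c f) = 1"
      unfolding I_def c_def by (rule trk_idk_out[OF \<Phi> uf])
    hence "feasible p r c \<epsilon> f idk"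
      using uf \<epsilon> pos_idk[OF fin(1)] unfolding feasible_def I_def[symmetric]
      by (simp add: pos_def sesq_def)
    thus ?thesis by (auto simp: V_def)
  qed
  have "\<exists>f t. feasible p r c \<epsilon> f t \<and> ?g f t < Inf V + 1 / real (Suc n)" for n
    using cInf_lessD[OF \<open>V \<noteq> {}\<close>, of "Inf V + 1 / real (Suc n)"] by (auto simp: V_def)
  then obtain F T where FT: "\<And>n. feasible p r c \<epsilon> (F n) (T n)"
    and g: "\<And>n. ?g (F n) (T n) < Inf V + 1 / real (Suc n)"
    by metis
  have "\<exists>r f. strict_mono r \<and> (\<forall>x\<in>?J. (\<lambda>n. F (r n) x) \<longlonglongrightarrow> f x)"
    by (rule bounded_family_subseq[OF fin(2)], rule unit_on_entry[OF fin(2)])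
      (use FT in \<open>auto simp: feasible_def\<close>)
  then obtain r1 f where r1: "strict_mono r1" and f: "\<And>x. x \<in> ?J \<Longrightarrow> (\<lambda>n. F (r1 n) x) \<longlonglongrightarrow> f x"
    by blast
  have Tb: "norm (T (r1 n) (fst z) (snd z)) \<le> 2" if "z \<in> I \<times> I" for n z
    using pos_le_one_entry[OF fin(1)] FT that by (auto simp: feasible_def I_def)
  \<comment> \<open>The tests are thinned along the subsequence already chosen for the
    states.\<close>
  have "\<exists>r t'. strict_mono r \<and> (\<forall>z\<in>I \<times> I. (\<lambda>n. T (r1 (r n)) (fst z) (snd z)) \<longlonglongrightarrow> t' z)"
    by (rule bounded_family_subseq[of "I \<times> I" "\<lambda>n z. T (r1 n) (fst z) (snd z)", OF _ Tb])
      (use fin in auto)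
  then obtain r2 t' where r2: "strict_mono r2"
    and t': "\<And>z. z \<in> I \<times> I \<Longrightarrow> (\<lambda>n. T (r1 (r2 n)) (fst z) (snd z)) \<longlonglongrightarrow> t' z"
    by blast
  define s where "s = r1 \<circ> r2"
  define t where "t i j = t' (i, j)" for i j
  have s: "strict_mono s" using strict_mono_o[OF r1 r2] by (simp add: s_def)
  have Fs: "(\<lambda>n. F (s n) x) \<longlonglongrightarrow> f x" if "x \<in> ?J" for x
    using LIMSEQ_subseq_LIMSEQ[OF f[OF that] r2] by (simp add: s_def o_def)
  have Ts: "(\<lambda>n. T (s n) i j) \<longlonglongrightarrow> t i j" if "i \<in> I" "j \<in> I" for i j
    using t'[of "(i, j)"] that by (simp add: s_def t_def)
  have outs: "(\<lambda>n. out_kernel p c (F (s n)) i j) \<longlonglongrightarrow> out_kernel p c f i j" if "i \<in> I" "j \<in> I" for i j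
    unfolding out_kernel_def
    by (rule tendsto_lift_fst[where K = "{..<p}" and B = "{..<r}"])
      (use that in \<open>auto simp: I_def intro!: tendsto_intros Fs\<close>)
  have margs: "(\<lambda>n. marg_kernel p (F (s n)) x y) \<longlonglongrightarrow> marg_kernel p f x y" if "x \<in> ?J" "y \<in> ?J" for x y
    using that unfolding marg_kernel_def by (auto intro!: tendsto_intros Fs)
  have prods: "(\<lambda>n. prod_kernel p c (F (s n)) i j) \<longlonglongrightarrow> prod_kernel p c f i j" if "i \<in> I" "j \<in> I" for i j
    unfolding prod_kernel_def
    by (rule tendsto_lift_fst[where K = "{..<p}" and B = "{..<r}", OF margs])
      (use that in \<open>auto simp: I_def\<close>)
  have "unit_on ?J f"
  proof -
    have "(\<lambda>n. \<Sum>j\<in>?J. F (s n) j * cnj (F (s n) j)) \<longlonglongrightarrow> (\<Sum>j\<in>?J. f j * cnj (f j))"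
      by (intro tendsto_intros Fs)
    thus ?thesis using FT by (simp add: feasible_def unit_on_def LIMSEQ_const_iff)
  qed
  moreover have "pos I t" by (rule pos_limit[OF _ Ts]) (use FT in \<open>auto simp: feasible_def I_def\<close>)
  moreover have "pos I (\<lambda>i j. idk i j - t i j)"
    by (rule pos_limit[where X = "\<lambda>n i j. idk i j - T (s n) i j"])
      (use FT in \<open>auto simp: feasible_def I_def[symmetric] intro!: tendsto_intros Ts\<close>)
  moreover have "1 - \<epsilon> \<le> Re (trk I t (out_kernel p c f))"
    by (rule LIMSEQ_le_const[OF tendsto_Re[OF tendsto_trk[OF Ts outs]]])
      (use FT in \<open>auto simp: feasible_def I_def\<close>)
  ultimately have feas: "feasible p r c \<epsilon> f t" by (simp add: feasible_def I_def)
  have "?g f t \<le> Inf V"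
  proof -
    have "(\<lambda>n. Inf V + 1 / real (Suc (s n))) \<longlonglongrightarrow> Inf V + 0"
      using LIMSEQ_subseq_LIMSEQ[OF LIMSEQ_inverse_real_of_nat s]
      by (intro tendsto_intros) (simp add: o_def inverse_eq_divide)
    moreover have "(\<lambda>n. ?g (F (s n)) (T (s n))) \<longlonglongrightarrow> ?g f t"
      by (rule tendsto_Re[OF tendsto_trk[OF Ts prods]])
    ultimately show ?thesis
      using LIMSEQ_le[of "\<lambda>n. ?g (F (s n)) (T (s n))" "?g f t"] less_imp_le[OF g] by simp
  qed
  moreover have "Inf V \<le> ?g f' t'" if "feasible p r c \<epsilon> f' t'" for f' t'
    by (rule cInf_lower[OF _ bdd]) (use that in \<open>auto simp: V_def\<close>)
  ultimately have "?g f t \<le> ?g f' t'" if "feasible p r c \<epsilon> f' t'" for f' t'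
    using that order_trans by metis
  thus ?thesis using that[OF feas] by simp
qed

section \<open>The channel divergence and its maximizer\<close>

definition state_fun :: "nat \<Rightarrow> complex vec \<Rightarrow> nat \<times> nat \<Rightarrow> complex" where
  "state_fun q \<psi> = (\<lambda>(a, k). \<psi> $ (a * q + k))"

lemma pure_states_iff:
  "\<psi> \<in> pure_states (p * q) \<longleftrightarrow> \<psi> \<in> carrier_vec (p * q) \<and> unit_on ({..<p} \<times> {..<q}) (state_fun q \<psi>)"
proof -
  have "\<psi> \<bullet>c \<psi> = (\<Sum>z\<in>{..<p} \<times> {..<q}. state_fun q \<psi> z * cnj (state_fun q \<psi> z))"
    if "\<psi> \<in> carrier_vec (p * q)"
    using that
    by (simp add: scalar_prod_def atLeast0LessThan sum_pair sum.cartesian_product state_fun_def pair_less case_prod_beta')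
  thus ?thesis by (auto simp: pure_states_def unit_on_def)
qed

lemma pair_kernel_proj:
  assumes "\<psi> \<in> carrier_vec (p * q)" "i \<in> {..<p} \<times> {..<q}" "j \<in> {..<p} \<times> {..<q}"
  shows "pair_kernel q (proj \<psi>) i j = state_fun q \<psi> i * cnj (state_fun q \<psi> j)"
  using assms by (auto simp: pair_kernel_def proj_def state_fun_def pair_less)

lemma pair_kernel_one_minus:
  assumes "X \<in> carrier_mat (p * q) (p * q)" "i \<in> {..<p} \<times> {..<q}" "j \<in> {..<p} \<times> {..<q}"
  shows "pair_kernel q (1\<^sub>m (p * q) - X) i j = idk i j - pair_kernel q X i j"
proof -
  have "inj_on (\<lambda>(a, k). a * q + k) ({..<p} \<times> {..<q})"
    using bij_pair by (simp add: bij_betw_def)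
  hence "(case i of (a, k) \<Rightarrow> a * q + k) = (case j of (a, k) \<Rightarrow> a * q + k) \<longleftrightarrow> i = j"
    using assms by (simp add: inj_on_eq_iff)
  thus ?thesis using assms
    by (auto simp: pair_kernel_def idk_def pair_less split: prod.splits)
qed

lemma tensor_mat_carrier:
  "\<lbrakk>X \<in> carrier_mat p p; Y \<in> carrier_mat q q\<rbrakk> \<Longrightarrow> tensor_mat X Y \<in> carrier_mat (p * q) (p * q)"
  by (simp add: tensor_mat_def)

lemma pair_kernel_tensor:
  assumes "X \<in> carrier_mat p p" "Y \<in> carrier_mat q q" "a < p" "a' < p" "k < q" "k' < q"
  shows "pair_kernel q (tensor_mat X Y) (a, k) (a', k') = X $$ (a, a') * Y $$ (k, k')"
  using assms by (simp add: pair_kernel_def tensor_mat_def pair_less)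

lemma log_recip_antimono: "\<lbrakk>0 \<le> x; x \<le> y\<rbrakk> \<Longrightarrow> log_recip y \<le> log_recip x"
  by (auto simp: log_recip_def frac_le)

context
  fixes dA dB :: nat and N :: "complex mat \<Rightarrow> complex mat"
  assumes N: "quantum_channel dA dB N"
begin

lemma linear_N: "linear_op dA dB N"
  using N by (simp add: quantum_channel_def)

lemma mtrace_out:
  assumes \<psi>: "\<psi> \<in> carrier_vec (dA * dA)" and T: "T \<in> carrier_mat (dB * dA) (dB * dA)"
  shows "mtrace (T * apply_fst dA dB dA N (proj \<psi>))
    = trk ({..<dB} \<times> {..<dA}) (pair_kernel dA T) (out_kernel dA (superop dA N) (state_fun dA \<psi>))"
proof -
  have "pair_kernel dA (apply_fst dA dB dA N (proj \<psi>)) i j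
      = out_kernel dA (superop dA N) (state_fun dA \<psi>) i j"
    if "i \<in> {..<dB} \<times> {..<dA}" "j \<in> {..<dB} \<times> {..<dA}" for i j
    using that by (auto simp: pair_kernel_apply_fst[OF linear_N] out_kernel_def lift_fst_def pair_kernel_proj[OF \<psi>])
  thus ?thesis unfolding mtrace_mult_pair[OF T apply_fst_carrier] by (simp add: trk_def)
qed

lemma mtrace_prod:
  assumes \<psi>: "\<psi> \<in> carrier_vec (dA * dA)" and T: "T \<in> carrier_mat (dB * dA) (dB * dA)"
  shows "mtrace (T * tensor_mat (N (ptrace_snd dA dA (proj \<psi>))) (ptrace_fst dA dA (proj \<psi>)))
    = trk ({..<dB} \<times> {..<dA}) (pair_kernel dA T) (prod_kernel dA (superop dA N) (state_fun dA \<psi>))"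
proof -
  let ?A = "ptrace_snd dA dA (proj \<psi>)" and ?B = "ptrace_fst dA dA (proj \<psi>)"
  have A: "?A \<in> carrier_mat dA dA" and B: "?B \<in> carrier_mat dA dA"
    by (simp_all add: ptrace_snd_def ptrace_fst_def)
  have NA: "N ?A \<in> carrier_mat dB dB" using linear_N A by (simp add: linear_op_def)
  have Ai: "?A $$ (a, a') = (\<Sum>k<dA. state_fun dA \<psi> (a, k) * cnj (state_fun dA \<psi> (a', k)))"
    if "a < dA" "a' < dA" for a a'
    using that \<psi> by (simp add: ptrace_snd_def proj_def state_fun_def pair_less)
  have Bi: "?B $$ (k, k') = (\<Sum>a<dA. state_fun dA \<psi> (a, k) * cnj (state_fun dA \<psi> (a, k')))"
    if "k < dA" "k' < dA" for k k'
    using that \<psi> by (simp add: ptrace_fst_def proj_def state_fun_def pair_less)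
  have "pair_kernel dA (tensor_mat (N ?A) ?B) i j = prod_kernel dA (superop dA N) (state_fun dA \<psi>) i j"
    if "i \<in> {..<dB} \<times> {..<dA}" "j \<in> {..<dB} \<times> {..<dA}" for i j
    using that
    by (auto simp: pair_kernel_tensor[OF NA B] superop_apply[OF linear_N A] Ai Bi prod_kernel_def
        lift_fst_def marg_kernel_def sum_distrib_right mult.assoc)
  thus ?thesis unfolding mtrace_mult_pair[OF T tensor_mat_carrier[OF NA B]] by (simp add: trk_def)
qed

lemma tests_iff:
  assumes \<psi>: "\<psi> \<in> pure_states (dA * dA)"
  shows "T \<in> tests (dB * dA) \<epsilon> (apply_fst dA dB dA N (proj \<psi>)) \<longleftrightarrow>
    T \<in> carrier_mat (dB * dA) (dB * dA) \<and>
    feasible dA dB (superop dA N) \<epsilon> (state_fun dA \<psi>) (pair_kernel dA T)"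
proof (cases "T \<in> carrier_mat (dB * dA) (dB * dA)")
  case True
  have \<psi>': "\<psi> \<in> carrier_vec (dA * dA)" using \<psi> by (simp add: pure_states_def)
  have "pos ({..<dB} \<times> {..<dA}) (pair_kernel dA (1\<^sub>m (dB * dA) - T))
    \<longleftrightarrow> pos ({..<dB} \<times> {..<dA}) (\<lambda>i j. idk i j - pair_kernel dA T i j)"
    by (rule pos_cong) (rule pair_kernel_one_minus[OF True])
  thus ?thesis using True \<psi>
    by (simp add: tests_def feasible_def psd_iff_pos_pair minus_carrier_mat[OF True] mtrace_out[OF \<psi>'] pure_states_iff)
next
  case False
  thus ?thesis by (simp add: tests_def psd_def)
qed

lemma D_H_channel_eq:
  assumes \<psi>: "\<psi> \<in> pure_states (dA * dA)"
  shows "D_H_channel dA dB N \<epsilon> \<psi> =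
    (SUP T \<in> {T \<in> carrier_mat (dB * dA) (dB * dA).
        feasible dA dB (superop dA N) \<epsilon> (state_fun dA \<psi>) (pair_kernel dA T)}.
      log_recip (Re (trk ({..<dB} \<times> {..<dA}) (pair_kernel dA T)
        (prod_kernel dA (superop dA N) (state_fun dA \<psi>)))))"
proof -
  have \<psi>': "\<psi> \<in> carrier_vec (dA * dA)" using \<psi> by (simp add: pure_states_def)
  have "dim_row (apply_fst dA dB dA N (proj \<psi>)) = dB * dA" by (simp add: apply_fst_def)
  thus ?thesis unfolding D_H_channel_def D_H_def
    by (intro SUP_cong) (auto simp: tests_iff[OF \<psi>] mtrace_prod[OF \<psi>'])
qed

text \<open>Kernels constructed in the proof are arbitrary functions; this turns a feasible pair
  into a vector and a matrix that compete in the suprema of the definitions, with the same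
  error.\<close>

lemma feasible_representation:
  assumes "feasible dA dB c \<epsilon> f t"
  obtains \<psi> T where "\<psi> \<in> pure_states (dA * dA)" "T \<in> carrier_mat (dB * dA) (dB * dA)"
    and "feasible dA dB c \<epsilon> (state_fun dA \<psi>) (pair_kernel dA T)"
    and "trk ({..<dB} \<times> {..<dA}) (pair_kernel dA T) (prod_kernel dA c (state_fun dA \<psi>))
      = trk ({..<dB} \<times> {..<dA}) t (prod_kernel dA c f)"
proof -
  let ?I = "{..<dB} \<times> {..<dA}" and ?J = "{..<dA} \<times> {..<dA}"
  define \<psi> where "\<psi> = vec (dA * dA) (\<lambda>i. f (i div dA, i mod dA))"
  define T where "T = mat (dB * dA) (dB * dA) (\<lambda>(i, j). t (i div dA, i mod dA) (j div dA, j mod dA))"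
  have f: "state_fun dA \<psi> z = f z" if "z \<in> ?J" for z
    using that by (auto simp: state_fun_def \<psi>_def pair_less)
  have t: "pair_kernel dA T i j = t i j" if "i \<in> ?I" "j \<in> ?I" for i j
    using that by (auto simp: pair_kernel_def T_def pair_less)
  have u: "unit_on ?J (state_fun dA \<psi>) \<longleftrightarrow> unit_on ?J f"
    unfolding unit_on_def by (simp add: f del: mem_Sigma_iff)
  have out: "out_kernel dA c (state_fun dA \<psi>) i j = out_kernel dA c f i j"
    and prod: "prod_kernel dA c (state_fun dA \<psi>) i j = prod_kernel dA c f i j"
    if "i \<in> ?I" "j \<in> ?I" for i j
    using that by (auto simp: out_kernel_def prod_kernel_def marg_kernel_def lift_fst_def f)
  have trk: "trk ?I (pair_kernel dA T) (prod_kernel dA c (state_fun dA \<psi>)) = trk ?I t (prod_kernel dA c f)"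
    "trk ?I (pair_kernel dA T) (out_kernel dA c (state_fun dA \<psi>)) = trk ?I t (out_kernel dA c f)"
    unfolding trk_def by (intro sum.cong refl; simp only: t prod out)+
  have pos: "pos ?I (pair_kernel dA T) \<longleftrightarrow> pos ?I t"
    "pos ?I (\<lambda>i j. idk i j - pair_kernel dA T i j) \<longleftrightarrow> pos ?I (\<lambda>i j. idk i j - t i j)"
    by (rule pos_cong, simp only: t)+
  show ?thesis
  proof
    show "\<psi> \<in> pure_states (dA * dA)"
      using assms u by (simp add: pure_states_iff feasible_def) (simp add: \<psi>_def)
    show "T \<in> carrier_mat (dB * dA) (dB * dA)" by (simp add: T_def)
    show "feasible dA dB c \<epsilon> (state_fun dA \<psi>) (pair_kernel dA T)"
      using assms by (simp add: feasible_def u pos trk)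
  qed (rule trk(1))
qed

lemma log_recip_le_max_D_H:
  assumes "feasible dA dB (superop dA N) \<epsilon> f t"
  shows "log_recip (Re (trk ({..<dB} \<times> {..<dA}) t (prod_kernel dA (superop dA N) f))) \<le> max_D_H dA dB N \<epsilon>"
proof -
  obtain \<psi> T where *: "\<psi> \<in> pure_states (dA * dA)" "T \<in> carrier_mat (dB * dA) (dB * dA)"
    "feasible dA dB (superop dA N) \<epsilon> (state_fun dA \<psi>) (pair_kernel dA T)"
    "trk ({..<dB} \<times> {..<dA}) (pair_kernel dA T) (prod_kernel dA (superop dA N) (state_fun dA \<psi>))
      = trk ({..<dB} \<times> {..<dA}) t (prod_kernel dA (superop dA N) f)"
    using feasible_representation[OF assms] by blast
  have "log_recip (Re (trk ({..<dB} \<times> {..<dA}) t (prod_kernel dA (superop dA N) f)))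
      \<le> D_H_channel dA dB N \<epsilon> \<psi>"
    unfolding D_H_channel_eq[OF *(1)] *(4)[symmetric] by (rule SUP_upper) (use * in simp)
  also have "\<dots> \<le> max_D_H dA dB N \<epsilon>"
    unfolding max_D_H_def by (rule SUP_upper[OF *(1)])
  finally show ?thesis .
qed

text \<open>\<open>log_recip\<close> is antitone on nonnegative reals, so a pair with the least
  error attains both suprema at once.\<close>

lemma max_D_H_attained:
  assumes "0 < dA" "0 < \<epsilon>"
  obtains \<psi> f t where "\<psi> \<in> pure_states (dA * dA)" "D_H_channel dA dB N \<epsilon> \<psi> = max_D_H dA dB N \<epsilon>"
    and "feasible dA dB (superop dA N) \<epsilon> f t"
    and "max_D_H dA dB N \<epsilon> = log_recip (Re (trk ({..<dB} \<times> {..<dA}) t (prod_kernel dA (superop dA N) f)))"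
proof -
  let ?I = "{..<dB} \<times> {..<dA}" and ?c = "superop dA N"
  let ?g = "\<lambda>f t. Re (trk ?I t (prod_kernel dA ?c f))"
  obtain f t where ft: "feasible dA dB ?c \<epsilon> f t"
    and min: "\<And>f' t'. feasible dA dB ?c \<epsilon> f' t' \<Longrightarrow> ?g f t \<le> ?g f' t'"
    using minimal_test_exists[OF assms(1) N assms(2)] by blast
  have "0 \<le> trk ?I t (prod_kernel dA ?c f)"
    using ft pos_prod_kernel[OF N] by (intro trk_nonneg) (simp_all add: feasible_def)
  hence nonneg: "0 \<le> ?g f t" by (simp add: zero_le_complex_iff)
  obtain \<psi> T where *: "\<psi> \<in> pure_states (dA * dA)" "T \<in> carrier_mat (dB * dA) (dB * dA)"
    "feasible dA dB ?c \<epsilon> (state_fun dA \<psi>) (pair_kernel dA T)"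
    "trk ?I (pair_kernel dA T) (prod_kernel dA ?c (state_fun dA \<psi>)) = trk ?I t (prod_kernel dA ?c f)"
    using feasible_representation[OF ft] by blast
  have le: "D_H_channel dA dB N \<epsilon> \<psi>' \<le> log_recip (?g f t)" if "\<psi>' \<in> pure_states (dA * dA)" for \<psi>'
    unfolding D_H_channel_eq[OF that] by (rule SUP_least) (auto intro!: log_recip_antimono nonneg min)
  hence "max_D_H dA dB N \<epsilon> \<le> log_recip (?g f t)"
    unfolding max_D_H_def by (rule SUP_least)
  moreover have "log_recip (?g f t) \<le> D_H_channel dA dB N \<epsilon> \<psi>"
    unfolding D_H_channel_eq[OF *(1)] *(4)[symmetric] by (rule SUP_upper) (use * in simp)
  moreover have "D_H_channel dA dB N \<epsilon> \<psi> \<le> max_D_H dA dB N \<epsilon>"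
    unfolding max_D_H_def by (rule SUP_upper[OF *(1)])
  ultimately show ?thesis using that[OF *(1) _ ft] by (metis order_antisym order_trans)
qed

end

text \<open>Gram-Schmidt on the rows of \<Omega>. A row that depends on the earlier ones adds a zero
  row to \<open>V\<close>, recorded by \<open>\<not> P k\<close>; thus \<open>n\<close> labels
  suffice even where \<open>n\<close> orthonormal vectors do not exist. \<open>V\<close> is a
  partial isometry, and since the matching columns of \<open>W\<close> vanish, \<open>W\<close> has
  the same norm as \<Omega>.\<close>

lemma rows_orthonormalize:
  fixes \<Omega> :: "nat \<Rightarrow> 'c \<Rightarrow> complex"
  assumes fin: "finite C"
  shows "\<exists>W V P. (\<forall>a<n. \<forall>c\<in>C. \<Omega> a c = (\<Sum>k<n. W a k * V k c)) \<and>
    (\<forall>k<n. \<forall>l<n. (\<Sum>c\<in>C. V k c * cnj (V l c)) = of_bool (k = l \<and> P k)) \<and>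
    (\<forall>a<n. \<forall>k<n. \<not> P k \<longrightarrow> W a k = 0)"
proof (induction n)
  case (Suc n)
  from Suc.IH obtain W V P where IH:
    "(\<forall>a<n. \<forall>c\<in>C. \<Omega> a c = (\<Sum>k<n. W a k * V k c)) \<and>
     (\<forall>k<n. \<forall>l<n. (\<Sum>c\<in>C. V k c * cnj (V l c)) = of_bool (k = l \<and> P k)) \<and>
     (\<forall>a<n. \<forall>k<n. \<not> P k \<longrightarrow> W a k = 0)"
    by (elim exE)
  have W: "\<Omega> a c = (\<Sum>k<n. W a k * V k c)" if "a < n" "c \<in> C" for a c
    using IH that by simp
  have V: "(\<Sum>c\<in>C. V k c * cnj (V l c)) = of_bool (k = l \<and> P k)" if "k < n" "l < n" for k l
    using IH that by simp
  have P: "W a k = 0" if "a < n" "k < n" "\<not> P k" for a k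
    using IH that by simp
  define g where "g k = (\<Sum>c\<in>C. \<Omega> n c * cnj (V k c))" for k
  define r where "r c = \<Omega> n c - (\<Sum>k<n. g k * V k c)" for c
  define s where "s = sqrt (\<Sum>c\<in>C. (norm (r c))\<^sup>2)"
  have g0: "g k = 0" if "k < n" "\<not> P k" for k
  proof -
    have "(\<Sum>c\<in>C. V k c * cnj (V k c)) = 0" using V[of k k] that by simp
    hence "complex_of_real (\<Sum>c\<in>C. (norm (V k c))\<^sup>2) = 0"
      by (simp only: of_real_sum complex_norm_square)
    hence "\<forall>c\<in>C. V k c = 0" using fin by (simp add: sum_nonneg_eq_0_iff flip: of_real_sum of_real_power)
    thus ?thesis by (simp add: g_def)
  qed
  have r_orth: "(\<Sum>c\<in>C. r c * cnj (V l c)) = 0" if "l < n" for l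
  proof -
    have "(\<Sum>c\<in>C. r c * cnj (V l c)) = g l - (\<Sum>c\<in>C. \<Sum>k<n. g k * (V k c * cnj (V l c)))"
      by (simp add: r_def g_def algebra_simps sum_subtractf sum_distrib_left sum_distrib_right)
    also have "(\<Sum>c\<in>C. \<Sum>k<n. g k * (V k c * cnj (V l c))) = (\<Sum>k<n. g k * (\<Sum>c\<in>C. V k c * cnj (V l c)))"
      by (subst sum.swap) (simp add: sum_distrib_left)
    also have "\<dots> = (\<Sum>k<n. if k = l then g l else 0)"
      by (intro sum.cong refl) (use V that g0 in auto)
    finally show ?thesis using that by simp
  qed
  have rr: "(\<Sum>c\<in>C. r c * cnj (r c)) = of_real (s\<^sup>2)"
  proof -
    have "s\<^sup>2 = (\<Sum>c\<in>C. (norm (r c))\<^sup>2)" by (simp add: s_def sum_nonneg)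
    thus ?thesis by (simp only: of_real_sum complex_norm_square)
  qed
  have r0: "r c = 0" if "s = 0" "c \<in> C" for c
    using that fin by (simp add: s_def sum_nonneg_eq_0_iff)
  define W' where "W' a k = (if a < n then if k < n then W a k else 0 else if k < n then g k else of_real s)" for a k
  \<comment> \<open>If \<open>s = 0\<close>, division by zero makes the new row zero, in agreement
    with \<open>\<not> P' n\<close>.\<close>
  define V' where "V' k c = (if k < n then V k c else r c / of_real s)" for k c
  define P' where "P' k = (if k < n then P k else s \<noteq> 0)" for k
  have "\<Omega> a c = (\<Sum>k<Suc n. W' a k * V' k c)" if "a < Suc n" "c \<in> C" for a c
  proof (cases "a < n")
    case False
    hence "a = n" using that by simp
    moreover have "(\<Sum>k<n. W' n k * V' k c) = (\<Sum>k<n. g k * V k c)"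
      by (simp add: W'_def V'_def)
    ultimately show ?thesis using r0[OF _ that(2)]
      by (cases "s = 0") (simp_all add: W'_def V'_def r_def)
  qed (use that in \<open>simp add: W'_def V'_def W\<close>)
  moreover have "(\<Sum>c\<in>C. V' k c * cnj (V' l c)) = of_bool (k = l \<and> P' k)" if "k < Suc n" "l < Suc n" for k l
  proof -
    consider "k < n" "l < n" | "k < n" "l = n" | "k = n" "l < n" | "k = n" "l = n"
      using \<open>k < Suc n\<close> \<open>l < Suc n\<close> unfolding less_Suc_eq by blast
    thus ?thesis
    proof cases
      case 2
      have "(\<Sum>c\<in>C. V' k c * cnj (V' l c)) = cnj (\<Sum>c\<in>C. r c * cnj (V k c)) / of_real s"
        using 2 by (simp add: V'_def sum_divide_distrib mult_ac)
      thus ?thesis using 2 by (simp add: r_orth)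
    next
      case 3
      have "(\<Sum>c\<in>C. V' k c * cnj (V' l c)) = (\<Sum>c\<in>C. r c * cnj (V l c)) / of_real s"
        using 3 by (simp add: V'_def sum_divide_distrib)
      thus ?thesis using 3 by (simp add: r_orth)
    next
      case 4
      have "(\<Sum>c\<in>C. V' k c * cnj (V' l c)) = (\<Sum>c\<in>C. r c * cnj (r c)) / (of_real s * of_real s)"
        using 4 by (simp add: V'_def sum_divide_distrib)
      also have "\<dots> = of_bool (s \<noteq> 0)" unfolding rr by (simp add: power2_eq_square)
      finally show ?thesis using 4 by (simp add: P'_def)
    qed (simp add: V'_def P'_def V)
  qed
  moreover have "W' a k = 0" if "a < Suc n" "k < Suc n" "\<not> P' k" for a k
    using that P g0 by (auto simp: W'_def P'_def less_Suc_eq split: if_splits)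
  ultimately show ?case by (intro exI[of _ W'] exI[of _ V'] exI[of _ P']) simp
qed simp

section \<open>Converse\<close>

lemma sum_pairs:
  "(\<Sum>x\<in>B \<times> K. \<Sum>y\<in>B' \<times> K'. g x y) = (\<Sum>b\<in>B. \<Sum>b'\<in>B'. \<Sum>k\<in>K. \<Sum>k'\<in>K'. (g (b, k) (b', k') :: 'x :: comm_monoid_add))"
proof -
  have "(\<Sum>x\<in>B \<times> K. \<Sum>y\<in>B' \<times> K'. g x y) = (\<Sum>b\<in>B. \<Sum>k\<in>K. \<Sum>b'\<in>B'. \<Sum>k'\<in>K'. g (b, k) (b', k'))"
    by (simp add: sum.cartesian_product')
  also have "\<dots> = (\<Sum>b\<in>B. \<Sum>b'\<in>B'. \<Sum>k\<in>K. \<Sum>k'\<in>K'. g (b, k) (b', k'))"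
    by (rule sum.cong[OF refl], rule sum.swap)
  finally show ?thesis .
qed

text \<open>Congruence by the identity tensored with the transpose of \<open>V\<close>: an operator
  with second factor \<open>E\<close> becomes one with second factor \<open>K\<close>.\<close>

definition local_conj :: "'e set \<Rightarrow> ('k \<Rightarrow> 'e \<Rightarrow> complex) \<Rightarrow> ('b \<times> 'e \<Rightarrow> 'b \<times> 'e \<Rightarrow> complex) \<Rightarrow>
    'b \<times> 'k \<Rightarrow> 'b \<times> 'k \<Rightarrow> complex" where
  "local_conj E V Q = (\<lambda>(b, k) (b', k'). \<Sum>e\<in>E. \<Sum>e'\<in>E. cnj (V k e) * Q (b, e) (b', e') * V k' e')"

lemma sesq_local_conj:
  "sesq (B \<times> K) (local_conj E V Q) u v
    = sesq (B \<times> E) Q (\<lambda>(b, e). \<Sum>k\<in>K. V k e * u (b, k)) (\<lambda>(b, e). \<Sum>k\<in>K. V k e * v (b, k))"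
proof -
  have "sesq (B \<times> K) (local_conj E V Q) u v = (\<Sum>b\<in>B. \<Sum>b'\<in>B. \<Sum>k\<in>K. \<Sum>k'\<in>K. \<Sum>e\<in>E. \<Sum>e'\<in>E.
      cnj (V k e * u (b, k)) * Q (b, e) (b', e') * (V k' e' * v (b', k')))"
    unfolding sesq_def sum_pairs
    by (simp add: local_conj_def sum_distrib_left sum_distrib_right mult_ac)
  also have "\<dots> = (\<Sum>b\<in>B. \<Sum>b'\<in>B. \<Sum>e\<in>E. \<Sum>e'\<in>E. \<Sum>k\<in>K. \<Sum>k'\<in>K.
      cnj (V k e * u (b, k)) * Q (b, e) (b', e') * (V k' e' * v (b', k')))"
    by (rule sum.cong[OF refl], rule sum.cong[OF refl], rule sum4_swap)
  also have "\<dots> = sesq (B \<times> E) Q (\<lambda>(b, e). \<Sum>k\<in>K. V k e * u (b, k)) (\<lambda>(b, e). \<Sum>k\<in>K. V k e * v (b, k))"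
    unfolding sesq_def sum_pairs sum_mult_sum by simp
  finally show ?thesis .
qed

text \<open>Duality of the two pictures: pulling the test back amounts to pushing the state forward
  through \<open>V\<close>.\<close>

lemma trk_local_conj:
  "trk (B \<times> K) (local_conj E V Q) Y
    = trk (B \<times> E) Q (\<lambda>(b, e) (b', e'). \<Sum>k\<in>K. \<Sum>k'\<in>K. V k e * Y (b, k) (b', k') * cnj (V k' e'))"
proof -
  have "trk (B \<times> K) (local_conj E V Q) Y = (\<Sum>b\<in>B. \<Sum>b'\<in>B. \<Sum>k\<in>K. \<Sum>k'\<in>K. \<Sum>e\<in>E. \<Sum>e'\<in>E.
      Q (b, e) (b', e') * (V k' e' * Y (b', k') (b, k) * cnj (V k e)))"
    unfolding trk_def sum_pairs
    by (simp add: local_conj_def sum_distrib_left sum_distrib_right mult_ac)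
  also have "\<dots> = (\<Sum>b\<in>B. \<Sum>b'\<in>B. \<Sum>e\<in>E. \<Sum>e'\<in>E. \<Sum>k\<in>K. \<Sum>k'\<in>K.
      Q (b, e) (b', e') * (V k' e' * Y (b', k') (b, k) * cnj (V k e)))"
    by (rule sum.cong[OF refl], rule sum.cong[OF refl], rule sum4_swap)
  also have "\<dots> = (\<Sum>b\<in>B. \<Sum>b'\<in>B. \<Sum>e\<in>E. \<Sum>e'\<in>E. \<Sum>k'\<in>K. \<Sum>k\<in>K.
      Q (b, e) (b', e') * (V k' e' * Y (b', k') (b, k) * cnj (V k e)))"
    by (rule sum.cong[OF refl], rule sum.cong[OF refl], rule sum.cong[OF refl], rule sum.cong[OF refl],
        rule sum.swap)
  also have "\<dots> = trk (B \<times> E) Q (\<lambda>(b, e) (b', e'). \<Sum>k\<in>K. \<Sum>k'\<in>K. V k e * Y (b, k) (b', k') * cnj (V k' e'))"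
    unfolding trk_def sum_pairs by (simp add: sum_distrib_left)
  finally show ?thesis .
qed

section \<open>Linearity of the trace pairing, and decoders as effects\<close>

lemma trk_add_left: "trk I (\<lambda>i j. X i j + Y i j) Z = trk I X Z + trk I Y Z"
  by (simp add: trk_def algebra_simps sum.distrib)

lemma trk_diff_left: "trk I (\<lambda>i j. X i j - Y i j) Z = trk I X Z - trk I Y Z"
  by (simp add: trk_def algebra_simps sum_subtractf)

lemma trk_scale_left: "trk I (\<lambda>i j. c * X i j) Z = c * trk I X Z"
  by (simp add: trk_def sum_distrib_left mult.assoc)

lemma trk_sum_left: "trk I (\<lambda>i j. \<Sum>m\<in>M. X m i j) Y = (\<Sum>m\<in>M. trk I (X m) Y)"
  unfolding trk_def sum_distrib_right by (rule sum3_rotate[symmetric])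

lemma trk_sum_right: "trk I X (\<lambda>i j. \<Sum>m\<in>M. Y m i j) = (\<Sum>m\<in>M. trk I X (Y m))"
  unfolding trk_def sum_distrib_left by (rule sum3_rotate[symmetric])

lemma trk_cong:
  "\<lbrakk>\<And>i j. \<lbrakk>i \<in> I; j \<in> I\<rbrakk> \<Longrightarrow> X i j = X' i j; \<And>i j. \<lbrakk>i \<in> I; j \<in> I\<rbrakk> \<Longrightarrow> Y i j = Y' i j\<rbrakk>
    \<Longrightarrow> trk I X Y = trk I X' Y'"
  by (simp add: trk_def)

lemma trk_scale_right: "trk I X (\<lambda>i j. c * Y i j) = c * trk I X Y"
  by (simp add: trk_def sum_distrib_left mult_ac)

lemma pos_eqI: "\<lbrakk>pos I X; \<And>i j. \<lbrakk>i \<in> I; j \<in> I\<rbrakk> \<Longrightarrow> X i j = Y i j\<rbrakk> \<Longrightarrow> pos I Y"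
  by (simp add: pos_def sesq_def)

text \<open>The effect whose expectation is the probability of reading out \<open>m\<close>. The index pairs are swapped
  because \<^const>\<open>trk\<close> contracts \<open>X i j\<close> with \<open>Y j i\<close>.\<close>

definition readout :: "nat \<Rightarrow> nat \<Rightarrow> (complex mat \<Rightarrow> complex mat) \<Rightarrow> nat \<Rightarrow>
    nat \<times> nat \<Rightarrow> nat \<times> nat \<Rightarrow> complex" where
  "readout n q D m = (\<lambda>(b, e) (b', e'). superop n D m m (b' * q + e') (b * q + e))"

lemma readout_apply:
  assumes D: "linear_op (p * q) K D" and m: "m < K" and X: "X \<in> carrier_mat (p * q) (p * q)"
  shows "D X $$ (m, m) = trk ({..<p} \<times> {..<q}) (readout (p * q) q D m) (pair_kernel q X)"
proof -
  have "D X $$ (m, m) = (\<Sum>i<p * q. \<Sum>j<p * q. superop (p * q) D m m i j * X $$ (i, j))"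
    by (rule superop_apply[OF D X m m])
  also have "\<dots> = trk {..<p * q} (\<lambda>i j. superop (p * q) D m m j i) (\<lambda>i j. X $$ (i, j))"
    unfolding trk_def by (rule sum.swap)
  also have "\<dots> = trk ({..<p} \<times> {..<q}) (readout (p * q) q D m) (pair_kernel q X)"
    unfolding trk_reindex[OF bij_pair] by (simp add: readout_def pair_kernel_def case_prod_beta')
  finally show ?thesis .
qed

lemma pos_rank_one: "pos I (\<lambda>i j. w i * cnj (w j))"
  using pos_gram[where I = I and K = "{()}" and w = "\<lambda>_. w"] by simp

text \<open>The decoder is fed the rank-one operator of an arbitrary vector v. Its diagonal output
  entry at m is the value of the form, the other diagonal entries are nonnegative, and all of them
  sum to the squared norm of v.\<close>

lemma readout_pos:
  assumes D: "quantum_channel (p * q) K D" and m: "m < K"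
  defines "I \<equiv> {..<p} \<times> {..<q}"
  shows "pos I (readout (p * q) q D m)"
    and "pos I (\<lambda>i j. idk i j - readout (p * q) q D m i j)"
proof -
  have lin: "linear_op (p * q) K D" using D by (simp add: quantum_channel_def)
  have "0 \<le> sesq I (readout (p * q) q D m) v v
      \<and> 0 \<le> sesq I idk v v - sesq I (readout (p * q) q D m) v v" for v
  proof -
    define w where "w i = v (i div q, i mod q)" for i
    define X where "X = mat (p * q) (p * q) (\<lambda>(i, j). w i * cnj (w j))"
    have X: "X \<in> carrier_mat (p * q) (p * q)" by (simp add: X_def)
    have Xij: "pair_kernel q X i j = v i * cnj (v j)" if "i \<in> I" "j \<in> I" for i j
      using that by (auto simp: I_def pair_kernel_def X_def w_def pair_less)
    have "psd (p * q) X"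
      unfolding psd_iff_pos using X by (auto intro!: pos_eqI[OF pos_rank_one[of _ w]] simp: X_def)
    hence DX: "psd K (D X)" by (rule channel_psd[OF D])
    have diag: "0 \<le> D X $$ (k, k)" if "k < K" for k
      using pos_diag[of "{..<K}" "\<lambda>i j. D X $$ (i, j)" k] DX that by (simp add: psd_iff_pos)
    have e: "sesq I (readout (p * q) q D m) v v = D X $$ (m, m)"
      unfolding readout_apply[OF lin m X] I_def[symmetric]
      by (simp add: trk_def sesq_def Xij mult_ac)
    have "mtrace (D X) = mtrace X"
      using D X by (simp add: quantum_channel_def trace_preserving_def)
    also have "\<dots> = (\<Sum>z\<in>I. v z * cnj (v z))"
      by (simp add: mtrace_def X_def sum_pair w_def I_def sum.cartesian_product' pair_less)
    finally have "sesq I idk v v = mtrace (D X)" by (simp add: sesq_idk I_def mult_ac)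
    also have "\<dots> = (\<Sum>k<K. D X $$ (k, k))"
      using DX by (auto simp: mtrace_def psd_def)
    also have "\<dots> = D X $$ (m, m) + (\<Sum>k\<in>{..<K} - {m}. D X $$ (k, k))"
      using m by (simp add: sum.remove)
    finally have "sesq I idk v v - sesq I (readout (p * q) q D m) v v = (\<Sum>k\<in>{..<K} - {m}. D X $$ (k, k))"
      by (simp add: e)
    also have "0 \<le> \<dots>" by (rule sum_nonneg) (use diag in auto)
    finally show ?thesis using diag[OF m] e by simp
  qed
  thus "pos I (readout (p * q) q D m)" "pos I (\<lambda>i j. idk i j - readout (p * q) q D m i j)"
    by (simp_all add: pos_def sesq_diff_kernel)
qed

section \<open>Encoder inputs and the converse bound\<close>

abbreviation message_state :: "nat \<Rightarrow> complex vec \<Rightarrow> nat \<Rightarrow> complex mat" where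
  "message_state K \<theta> m \<equiv> tensor_mat (proj (unit_vec K m)) (proj \<theta>)"

lemma message_state_carrier:
  "\<theta> \<in> carrier_vec (p * q) \<Longrightarrow> message_state K \<theta> m \<in> carrier_mat (K * p * q) (K * p * q)"
  by (simp add: tensor_mat_def proj_def mult.assoc)

lemma pair_kernel_message_state:
  assumes "\<theta> \<in> carrier_vec (p * q)" "m < K" "n < K" "n' < K" "a < p" "a' < p" "e < q" "e' < q"
  shows "pair_kernel q (message_state K \<theta> m) (n * p + a, e) (n' * p + a', e')
    = of_bool (n = m \<and> n' = m) * state_fun q \<theta> (a, e) * cnj (state_fun q \<theta> (a', e'))"
proof -
  have *: "(n * p + a) * q + e = n * (p * q) + (a * q + e)" for n a e by (simp add: algebra_simps)
  have "a * q + e < p * q" "a' * q + e' < p * q" using assms by (simp_all add: pair_less)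
  thus ?thesis using assms pair_less[of n K "a * q + e" "p * q"] pair_less[of n' K "a' * q + e'" "p * q"]
    by (simp add: pair_kernel_def tensor_mat_def proj_def * state_fun_def unit_vec_def)
qed

lemma psd_message_state:
  assumes "\<theta> \<in> carrier_vec (p * q)"
  shows "psd (K * p * q) (message_state K \<theta> m)"
proof -
  define w where "w i = unit_vec K m $ (i div (p * q)) * \<theta> $ (i mod (p * q))" for i
  have "message_state K \<theta> m $$ (i, j) = w i * cnj (w j)" if "i < K * p * q" "j < K * p * q" for i j
  proof -
    have "i < K * (p * q)" "j < K * (p * q)" using that by (simp_all add: mult.assoc)
    hence "i div (p * q) < K" "j div (p * q) < K" "i mod (p * q) < p * q" "j mod (p * q) < p * q"
      by (auto simp: less_mult_imp_div_less intro!: mod_less_divisor gr0I)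
    thus ?thesis using assms that
      by (simp add: tensor_mat_def proj_def w_def mult_ac)
  qed
  thus ?thesis unfolding psd_iff_pos
    using message_state_carrier[OF assms] by (auto intro!: pos_eqI[OF pos_rank_one[of _ w]])
qed

text \<open>A single promise set and its decoder suffice. \<open>K\<close> may exceed
  \<open>card S\<close>, because the test built here uses only the outcomes in
  \<open>S\<close>.\<close>

lemma ea_converse:
  assumes N: "quantum_channel dA dB N"
    and E: "quantum_channel (K * eA) dA \<E>" and D: "quantum_channel (dB * eB) K D"
    and \<theta>: "\<theta> \<in> pure_states (eA * eB)"
    and S: "S \<subseteq> {..<K}" "S \<noteq> {}"
    and dec: "\<And>m. m \<in> S \<Longrightarrow> 1 - Re (D (received_state dA dB N K eA eB \<theta> \<E> m) $$ (m, m)) \<le> \<epsilon>"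
  shows "ereal (log 2 (card S)) \<le> max_D_H dA dB N \<epsilon>"
proof -
  let ?c = "superop dA N"
  let ?A = "{..<dA} \<times> {..<eB}" and ?B = "{..<dB} \<times> {..<eB}"
    and ?I = "{..<dB} \<times> {..<dA}" and ?J = "{..<dA} \<times> {..<dA}"
  have finS: "finite S" using S finite_subset by blast
  define L where "L = real (card S)"
  have L: "L > 0" using finS S by (simp add: L_def card_gt_0_iff)
  define h where "h = complex_of_real (1 / L)"
  have hL: "h * of_nat (card S) = 1" using L by (simp add: h_def L_def)
  have \<theta>c: "\<theta> \<in> carrier_vec (eA * eB)" and \<theta>u: "unit_on ({..<eA} \<times> {..<eB}) (state_fun eB \<theta>)"
    using \<theta> by (simp_all add: pure_states_iff)
  have linN: "linear_op dA dB N" and linE: "linear_op (K * eA) dA \<E>" and linD: "linear_op (dB * eB) K D"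
    using N E D by (simp_all add: quantum_channel_def)
  define \<tau> where "\<tau> e e' = (\<Sum>a<eA. state_fun eB \<theta> (a, e) * cnj (state_fun eB \<theta> (a, e')))" for e e'
  have tr\<tau>: "(\<Sum>e<eB. \<tau> e e) = 1"
    using \<theta>u unfolding unit_on_def \<tau>_def by (subst sum.swap) (simp add: sum.cartesian_product')
  define \<omega> where "\<omega> m = apply_fst (K * eA) dA eB \<E> (message_state K \<theta> m)" for m
  have psd\<omega>: "psd (dA * eB) (\<omega> m)" for m
    unfolding \<omega>_def by (rule channel_apply_fst_psd[OF E psd_message_state[OF \<theta>c]])
  \<comment> \<open>The encoder does not touch \<open>E\<^sub>B\<close>, so Bob's half is in the
    same state for every message. The bound on the type II error rests on this.\<close>
  have marg: "(\<Sum>a<dA. pair_kernel eB (\<omega> m) (a, e) (a, e')) = \<tau> e e'"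
    if m: "m \<in> S" and e: "e < eB" "e' < eB" for m e e'
  proof -
    have mK: "m < K" using m S by auto
    have "(\<Sum>a<dA. pair_kernel eB (\<omega> m) (a, e) (a, e'))
        = (\<Sum>a<dA. lift_fst (K * eA) (superop (K * eA) \<E>) (pair_kernel eB (message_state K \<theta> m)) (a, e) (a, e'))"
      unfolding \<omega>_def using e by (intro sum.cong refl pair_kernel_apply_fst[OF linE]) auto
    also have "\<dots> = (\<Sum>x<K * eA. pair_kernel eB (message_state K \<theta> m) (x, e) (x, e'))"
      by (rule sum_lift_fst[OF E])
    also have "\<dots> = (\<Sum>n<K. \<Sum>a<eA. of_bool (n = m) * (state_fun eB \<theta> (a, e) * cnj (state_fun eB \<theta> (a, e'))))"
      unfolding sum_pair using e mK by (intro sum.cong refl) (simp add: pair_kernel_message_state[OF \<theta>c])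
    also have "\<dots> = (\<Sum>n<K. if n = m then \<tau> e e' else 0)"
      by (intro sum.cong refl) (simp add: \<tau>_def)
    finally show ?thesis using mK by simp
  qed
  have "\<exists>w. \<forall>i\<in>?A. \<forall>j\<in>?A. pair_kernel eB (\<omega> m) i j = (\<Sum>z\<in>?A. w z i * cnj (w z j))" for m
    by (rule pos_cholesky) (use psd\<omega>[of m] in \<open>auto simp: psd_iff_pos_pair\<close>)
  then obtain w where w0: "\<forall>m. \<forall>i\<in>?A. \<forall>j\<in>?A. pair_kernel eB (\<omega> m) i j = (\<Sum>z\<in>?A. w m z i * cnj (w m z j))"
    using choice[of "\<lambda>m w. \<forall>i\<in>?A. \<forall>j\<in>?A. pair_kernel eB (\<omega> m) i j = (\<Sum>z\<in>?A. w z i * cnj (w z j))"]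
    by blast
  have w: "pair_kernel eB (\<omega> m) i j = (\<Sum>z\<in>?A. w m z i * cnj (w m z j))" if "i \<in> ?A" "j \<in> ?A" for m i j
    using w0 that by blast
  \<comment> \<open>The columns collect everything outside \<open>A\<close>: Bob's half, the copy of
    the message and the label of the purification. The factor \<open>s\<close> is a square root of
    \<open>h\<close>, which gives each message the probability \<open>1 / L\<close>.\<close>
  define C where "C = {..<eB} \<times> (S \<times> ?A)"
  define s where "s = complex_of_real (1 / sqrt L)"
  have ss: "s * cnj s = h"
    using L by (simp add: s_def h_def flip: of_real_mult)
  define \<Omega> where "\<Omega> a = (\<lambda>(e, m, z). s * w m z (a, e))" for a :: nat
  have \<Omega>2: "(\<Sum>z\<in>?A. \<Omega> a (e, m, z) * cnj (\<Omega> a' (e', m, z))) = h * pair_kernel eB (\<omega> m) (a, e) (a', e')"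
    if "a < dA" "a' < dA" "e < eB" "e' < eB" for a a' e e' m
  proof -
    have "(\<Sum>z\<in>?A. \<Omega> a (e, m, z) * cnj (\<Omega> a' (e', m, z)))
       = (\<Sum>z\<in>?A. (s * cnj s) * (w m z (a, e) * cnj (w m z (a', e'))))"
      by (simp add: \<Omega>_def mult_ac)
    thus ?thesis using that by (simp only: ss sum_distrib_left[symmetric]) (simp add: w)
  qed
  have sumC: "(\<Sum>c\<in>C. F c) = (\<Sum>e<eB. \<Sum>m\<in>S. \<Sum>z\<in>?A. F (e, m, z))" for F :: "_ \<Rightarrow> complex"
    unfolding C_def by (subst sum.cartesian_product', rule sum.cong[OF refl], rule sum.cartesian_product')
  have finC: "finite C" using finS by (simp add: C_def)
  obtain W V P where WVP: "(\<forall>a<dA. \<forall>c\<in>C. \<Omega> a c = (\<Sum>k<dA. W a k * V k c)) \<and>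
    (\<forall>k<dA. \<forall>l<dA. (\<Sum>c\<in>C. V k c * cnj (V l c)) = of_bool (k = l \<and> P k)) \<and>
    (\<forall>a<dA. \<forall>k<dA. \<not> P k \<longrightarrow> W a k = 0)"
    using rows_orthonormalize[OF finC, where n = dA and \<Omega> = \<Omega>] by (elim exE)
  have W: "\<Omega> a c = (\<Sum>k<dA. W a k * V k c)" if "a < dA" "c \<in> C" for a c
    using WVP that by simp
  have V: "(\<Sum>c\<in>C. V k c * cnj (V l c)) = of_bool (k = l \<and> P k)" if "k < dA" "l < dA" for k l
    using WVP that by simp
  have P: "W a k = 0" if "a < dA" "k < dA" "\<not> P k" for a k
    using WVP that by simp
  have Vsum: "(\<Sum>c\<in>C. (\<Sum>k<dA. V k c * x k) * cnj (\<Sum>k<dA. V k c * x k)) = (\<Sum>k<dA. of_bool (P k) * (x k * cnj (x k)))"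
    for x
  proof -
    have "(\<Sum>c\<in>C. (\<Sum>k<dA. V k c * x k) * cnj (\<Sum>k<dA. V k c * x k))
        = (\<Sum>c\<in>C. \<Sum>k<dA. \<Sum>l<dA. (V k c * cnj (V l c)) * (x k * cnj (x l)))"
      by (simp add: sum_product mult_ac)
    also have "\<dots> = (\<Sum>k<dA. \<Sum>l<dA. (\<Sum>c\<in>C. V k c * cnj (V l c)) * (x k * cnj (x l)))"
      by (subst sum3_rotate) (simp add: sum_distrib_right)
    also have "\<dots> = (\<Sum>k<dA. \<Sum>l<dA. if l = k then of_bool (P k) * (x k * cnj (x k)) else 0)"
      by (intro sum.cong refl) (auto simp: V)
    finally show ?thesis by simp
  qed
  \<comment> \<open>The square factor read as amplitudes of a pure state of \<open>A A'\<close>; its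
    norm is that of \<Omega> because \<open>V\<close> is isometric where \<open>W\<close> does not
    vanish.\<close>
  define f where "f = (\<lambda>(a, k). W a k)"
  have f_unit: "unit_on ?J f"
  proof -
    have "(\<Sum>j\<in>?J. f j * cnj (f j)) = (\<Sum>a<dA. \<Sum>k<dA. of_bool (P k) * (W a k * cnj (W a k)))"
      unfolding sum.cartesian_product' by (intro sum.cong refl) (use P in \<open>auto simp: f_def\<close>)
    also have "\<dots> = (\<Sum>a<dA. \<Sum>c\<in>C. \<Omega> a c * cnj (\<Omega> a c))"
      by (intro sum.cong refl) (simp add: W Vsum[symmetric] mult.commute)
    also have "\<dots> = (\<Sum>a<dA. \<Sum>e<eB. \<Sum>m\<in>S. \<Sum>z\<in>?A. \<Omega> a (e, m, z) * cnj (\<Omega> a (e, m, z)))"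
      unfolding sumC ..
    also have "\<dots> = (\<Sum>a<dA. \<Sum>e<eB. \<Sum>m\<in>S. h * pair_kernel eB (\<omega> m) (a, e) (a, e))"
      by (intro sum.cong refl) (simp add: \<Omega>2)
    also have "\<dots> = (\<Sum>e<eB. \<Sum>m\<in>S. h * (\<Sum>a<dA. pair_kernel eB (\<omega> m) (a, e) (a, e)))"
      by (subst sum3_rotate) (simp add: sum_distrib_left)
    also have "\<dots> = (\<Sum>e<eB. \<Sum>m\<in>S. h * \<tau> e e)"
      by (intro sum.cong refl) (simp add: marg)
    also have "\<dots> = h * of_nat (card S) * (\<Sum>e<eB. \<tau> e e)"
      by (simp add: sum_distrib_left mult_ac)
    finally show ?thesis by (simp add: hL tr\<tau> unit_on_def)
  qed
  define Q where "Q m = readout (dB * eB) eB D m" for m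
  have Q: "pos ?B (Q m)" "pos ?B (\<lambda>i j. idk i j - Q m i j)" if "m \<in> S" for m
    using readout_pos[OF D, of m] that S by (auto simp: Q_def)
  \<comment> \<open>The test on \<open>B\<close>, \<open>E\<^sub>B\<close>, the message copy and the
    purification label is the sum over m of \<open>Q m\<close> tensor |m><m| tensor the identity. It
    is block diagonal in \<open>(m, z)\<close>, so its pullback along \<open>V\<close> is a sum over
    these labels.\<close>
  define T where "T i j = (\<Sum>m\<in>S. \<Sum>z\<in>?A. local_conj {..<eB} (\<lambda>k e. V k (e, m, z)) (Q m) i j)" for i j
  have sesqT: "sesq ?I T v v = (\<Sum>m\<in>S. \<Sum>z\<in>?A. sesq ?B (Q m)
      (\<lambda>(b, e). \<Sum>k<dA. V k (e, m, z) * v (b, k)) (\<lambda>(b, e). \<Sum>k<dA. V k (e, m, z) * v (b, k)))" for v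
    unfolding T_def sesq_sum_kernel sesq_local_conj ..
  have posT: "pos ?I T"
    unfolding pos_def sesqT by (intro allI sum_nonneg pos_sesq Q)
  \<comment> \<open>Each \<open>Q m\<close> is at most the identity, and the pullback of the
    identity is the projection onto the labels with \<open>P\<close>.\<close>
  have T1: "pos ?I (\<lambda>i j. idk i j - T i j)"
    unfolding pos_def
  proof
    fix v :: "nat \<times> nat \<Rightarrow> complex"
    define u where "u b c = (\<Sum>k<dA. V k c * v (b, k))" for b c
    have "sesq ?I T v v \<le> (\<Sum>m\<in>S. \<Sum>z\<in>?A. sesq ?B idk
      (\<lambda>(b, e). \<Sum>k<dA. V k (e, m, z) * v (b, k)) (\<lambda>(b, e). \<Sum>k<dA. V k (e, m, z) * v (b, k)))"
      unfolding sesqT using pos_sesq[OF Q(2)]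
      by (intro sum_mono) (simp add: sesq_diff_kernel)
    also have "\<dots> = (\<Sum>m\<in>S. \<Sum>z\<in>?A. \<Sum>b<dB. \<Sum>e<eB. u b (e, m, z) * cnj (u b (e, m, z)))"
      by (simp add: sesq_idk sum.cartesian_product' u_def mult.commute)
    also have "\<dots> = (\<Sum>b<dB. \<Sum>e<eB. \<Sum>m\<in>S. \<Sum>z\<in>?A. u b (e, m, z) * cnj (u b (e, m, z)))"
      by (rule sum4_swap)
    also have "\<dots> = (\<Sum>b<dB. \<Sum>c\<in>C. u b c * cnj (u b c))"
      unfolding sumC ..
    also have "\<dots> = (\<Sum>b<dB. \<Sum>k<dA. of_bool (P k) * (v (b, k) * cnj (v (b, k))))"
      unfolding u_def Vsum ..
    also have "\<dots> \<le> (\<Sum>b<dB. \<Sum>k<dA. v (b, k) * cnj (v (b, k)))"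
      by (intro sum_mono) (auto simp: less_eq_complex_def)
    also have "\<dots> = sesq ?I idk v v"
      by (simp add: sesq_idk sum.cartesian_product' mult.commute)
    finally show "0 \<le> sesq ?I (\<lambda>i j. idk i j - T i j) v v"
      by (simp add: sesq_diff_kernel)
  qed
  \<comment> \<open>The channel acts on \<open>A\<close> and \<open>V\<close> on the reference, so
    the two commute and the input kernel can be pushed through \<open>V\<close> before the channel
    acts. This is used for the joint state and for the product of the marginals.\<close>
  have trT: "trk ?I T (lift_fst dA ?c Z) = (\<Sum>m\<in>S. trk ?B (Q m) (lift_fst dA ?c (Z' m)))"
    if Z: "\<And>m a a' e e'. \<lbrakk>m \<in> S; a < dA; a' < dA; e < eB; e' < eB\<rbrakk> \<Longrightarrow>
      (\<Sum>z\<in>?A. \<Sum>k<dA. \<Sum>k'<dA. V k (e, m, z) * Z (a, k) (a', k') * cnj (V k' (e', m, z))) = Z' m (a, e) (a', e')"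
    for Z Z'
  proof -
    have "trk ?I T (lift_fst dA ?c Z) = (\<Sum>m\<in>S. trk ?B (Q m) (\<lambda>i j. \<Sum>z\<in>?A.
        (\<lambda>(b, e) (b', e'). \<Sum>k<dA. \<Sum>k'<dA. V k (e, m, z) * lift_fst dA ?c Z (b, k) (b', k') * cnj (V k' (e', m, z))) i j))"
      unfolding T_def trk_sum_left trk_sum_right trk_local_conj ..
    also have "\<dots> = (\<Sum>m\<in>S. trk ?B (Q m) (lift_fst dA ?c (Z' m)))"
    proof (intro sum.cong refl trk_cong)
      fix m i j assume m: "m \<in> S" and ij: "i \<in> ?B" "j \<in> ?B"
      obtain b e b' e' where [simp]: "i = (b, e)" "j = (b', e')" by (cases i, cases j)
      have e: "e < eB" "e' < eB" using ij by auto
      have "(\<Sum>z\<in>?A. \<Sum>k<dA. \<Sum>k'<dA. V k (e, m, z) * lift_fst dA ?c Z (b, k) (b', k') * cnj (V k' (e', m, z)))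
          = (\<Sum>z\<in>?A. \<Sum>k<dA. \<Sum>k'<dA. \<Sum>a<dA. \<Sum>a'<dA. ?c b b' a a' *
              (V k (e, m, z) * Z (a, k) (a', k') * cnj (V k' (e', m, z))))"
        by (intro sum.cong refl) (simp add: lift_fst_def sum_distrib_left sum_distrib_right mult_ac)
      also have "\<dots> = (\<Sum>z\<in>?A. \<Sum>a<dA. \<Sum>a'<dA. \<Sum>k<dA. \<Sum>k'<dA. ?c b b' a a' *
              (V k (e, m, z) * Z (a, k) (a', k') * cnj (V k' (e', m, z))))"
        by (rule sum.cong[OF refl], rule sum4_swap)
      also have "\<dots> = (\<Sum>a<dA. \<Sum>a'<dA. \<Sum>z\<in>?A. \<Sum>k<dA. \<Sum>k'<dA. ?c b b' a a' *
              (V k (e, m, z) * Z (a, k) (a', k') * cnj (V k' (e', m, z))))"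
        by (rule sum3_rotate)
      also have "\<dots> = (\<Sum>a<dA. \<Sum>a'<dA. ?c b b' a a' * Z' m (a, e) (a', e'))"
        unfolding sum_distrib_left[symmetric] by (intro sum.cong refl) (use Z[OF m _ _ e] in simp)
      finally show "(\<Sum>z\<in>?A. (\<lambda>(b, e) (b', e'). \<Sum>k<dA. \<Sum>k'<dA. V k (e, m, z) *
          lift_fst dA ?c Z (b, k) (b', k') * cnj (V k' (e', m, z))) i j) = lift_fst dA ?c (Z' m) i j"
        by (simp add: lift_fst_def)
    qed
    finally show ?thesis .
  qed
  have VW: "(\<Sum>k<dA. \<Sum>k'<dA. V k (e, m, z) * (f (a, k) * cnj (f (a', k'))) * cnj (V k' (e', m, z)))
      = \<Omega> a (e, m, z) * cnj (\<Omega> a' (e', m, z))"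
    if "m \<in> S" "z \<in> ?A" "a < dA" "a' < dA" "e < eB" "e' < eB" for m z a a' e e'
  proof -
    have "(e, m, z) \<in> C" "(e', m, z) \<in> C" using that by (auto simp: C_def)
    thus ?thesis using that by (simp add: W f_def sum_product mult_ac)
  qed
  have lift_h: "lift_fst dA ?c (\<lambda>x y. h * X x y) = (\<lambda>i j. h * lift_fst dA ?c X i j)" for X :: "nat \<times> nat \<Rightarrow> nat \<times> nat \<Rightarrow> complex"
    by (auto simp: lift_fst_def fun_eq_iff sum_distrib_left mult_ac)
  have read: "trk ?B (Q m) (lift_fst dA ?c X') = D (apply_fst dA dB eB N X) $$ (m, m)"
    if m: "m \<in> S" and X: "\<And>i j. \<lbrakk>i \<in> ?A; j \<in> ?A\<rbrakk> \<Longrightarrow> pair_kernel eB X i j = X' i j" for m X X'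
  proof -
    have mK: "m < K" using m S by auto
    have "pair_kernel eB (apply_fst dA dB eB N X) i j = lift_fst dA ?c X' i j" if "i \<in> ?B" "j \<in> ?B" for i j
      using that by (auto simp: pair_kernel_apply_fst[OF linN] lift_fst_def X)
    thus ?thesis
      unfolding readout_apply[OF linD mK apply_fst_carrier] Q_def by (intro trk_cong) auto
  qed
  have Reh: "Re (h * x) = Re x / L" for x by (simp add: h_def)
  have out: "1 - \<epsilon> \<le> Re (trk ?I T (out_kernel dA ?c f))"
  proof -
    have "trk ?I T (out_kernel dA ?c f)
        = (\<Sum>m\<in>S. trk ?B (Q m) (lift_fst dA ?c (\<lambda>x y. h * pair_kernel eB (\<omega> m) x y)))"
      unfolding out_kernel_def by (rule trT) (simp add: VW \<Omega>2 del: mem_Sigma_iff)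
    also have "\<dots> = (\<Sum>m\<in>S. h * D (received_state dA dB N K eA eB \<theta> \<E> m) $$ (m, m))"
      unfolding lift_h trk_scale_right by (intro sum.cong refl) (simp add: read received_state_def \<omega>_def)
    finally have "Re (trk ?I T (out_kernel dA ?c f))
        = (\<Sum>m\<in>S. Re (D (received_state dA dB N K eA eB \<theta> \<E> m) $$ (m, m)) / L)"
      by (simp add: Reh del: times_complex.sel)
    also have "\<dots> \<ge> (\<Sum>m\<in>S. (1 - \<epsilon>) / L)"
      using dec L by (intro sum_mono divide_right_mono) (auto simp: algebra_simps)
    also have "(\<Sum>m\<in>S. (1 - \<epsilon>) / L) = 1 - \<epsilon>" using L by (simp add: L_def)
    finally show ?thesis .
  qed
  have prod: "Re (trk ?I T (prod_kernel dA ?c f)) \<le> 1 / L"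
  proof -
    \<comment> \<open>Pushed through \<open>V\<close>, the product of the marginals becomes
      \<open>h\<close> times the same input \<open>X'\<close> for every message. All outcome
      probabilities thus come from the single output \<open>D Y\<close>, and those in
      \<open>S\<close> sum to at most 1.\<close>
    define A where "A a a' = (\<Sum>z<dA. f (a, z) * cnj (f (a', z)))" for a a'
    define X' where "X' = (\<lambda>(a, e) (a', e'). A a a' * \<tau> e e')"
    define X where "X = mat (dA * eB) (dA * eB) (\<lambda>(i, j). X' (i div eB, i mod eB) (j div eB, j mod eB))"
    have XX': "pair_kernel eB X i j = X' i j" if "i \<in> ?A" "j \<in> ?A" for i j
      using that by (auto simp: pair_kernel_def X_def pair_less)
    have "pos ?A X'"
    proof (rule pos_eqI)
      show "pos ?A (\<lambda>i j. \<Sum>k\<in>{..<dA} \<times> {..<eA}. (\<lambda>(z, x) (a, e). f (a, z) * state_fun eB \<theta> (x, e)) k i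
          * cnj ((\<lambda>(z, x) (a, e). f (a, z) * state_fun eB \<theta> (x, e)) k j))"
        by (rule pos_gram)
    qed (auto simp: X'_def A_def \<tau>_def sum_product sum.cartesian_product' mult_ac)
    hence "pos ?A (pair_kernel eB X)" by (rule pos_eqI) (rule XX'[symmetric])
    hence "psd (dA * eB) X" unfolding psd_iff_pos_pair by (simp add: X_def)
    define Y where "Y = apply_fst dA dB eB N X"
    have Y: "psd (dB * eB) Y" unfolding Y_def by (rule channel_apply_fst_psd[OF N \<open>psd (dA * eB) X\<close>])
    hence DY: "psd K (D Y)" by (rule channel_psd[OF D])
    have diag: "0 \<le> Re (D Y $$ (k, k))" if "k < K" for k
      using pos_diag[of "{..<K}" "\<lambda>i j. D Y $$ (i, j)" k] DY that by (simp add: psd_iff_pos zero_le_complex_iff)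
    have "(\<Sum>k<K. D Y $$ (k, k)) = mtrace (D Y)" using DY by (auto simp: mtrace_def psd_def)
    also have "\<dots> = mtrace Y"
      using D Y by (auto simp: quantum_channel_def trace_preserving_def psd_def)
    also have "\<dots> = (\<Sum>b<dB. \<Sum>e<eB. pair_kernel eB Y (b, e) (b, e))"
      using Y by (auto simp: mtrace_def psd_def sum_pair pair_kernel_def)
    also have "\<dots> = (\<Sum>e<eB. \<Sum>b<dB. lift_fst dA ?c (pair_kernel eB X) (b, e) (b, e))"
      unfolding Y_def by (subst sum.swap) (simp add: pair_kernel_apply_fst[OF linN])
    also have "\<dots> = (\<Sum>e<eB. \<Sum>a<dA. A a a * \<tau> e e)"
      unfolding sum_lift_fst[OF N] by (simp add: XX') (simp add: X'_def)
    also have "\<dots> = (\<Sum>a<dA. A a a) * (\<Sum>e<eB. \<tau> e e)"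
      by (subst sum.swap) (simp add: sum_product)
    also have "(\<Sum>a<dA. A a a) = 1" using f_unit by (simp add: A_def unit_on_def sum.cartesian_product')
    finally have "Re (\<Sum>k<K. D Y $$ (k, k)) = 1" by (simp add: tr\<tau>)
    hence tot: "(\<Sum>k<K. Re (D Y $$ (k, k))) = 1" by simp
    have "trk ?I T (prod_kernel dA ?c f) = (\<Sum>m\<in>S. trk ?B (Q m) (lift_fst dA ?c (\<lambda>x y. h * X' x y)))"
      unfolding prod_kernel_def
    proof (rule trT)
      fix m a a' e e' assume *: "m \<in> S" "a < dA" "a' < dA" "e < eB" "e' < eB"
      have "(\<Sum>z\<in>?A. \<Sum>k<dA. \<Sum>k'<dA. V k (e, m, z) * marg_kernel dA f (a, k) (a', k') * cnj (V k' (e', m, z)))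
         = (\<Sum>z\<in>?A. \<Sum>k<dA. \<Sum>k'<dA. \<Sum>y<dA. A a a' *
             (V k (e, m, z) * (f (y, k) * cnj (f (y, k'))) * cnj (V k' (e', m, z))))"
        by (simp add: marg_kernel_def A_def[symmetric] sum_distrib_left sum_distrib_right mult_ac)
      also have "\<dots> = (\<Sum>z\<in>?A. \<Sum>y<dA. \<Sum>k<dA. \<Sum>k'<dA. A a a' *
             (V k (e, m, z) * (f (y, k) * cnj (f (y, k'))) * cnj (V k' (e', m, z))))"
        by (rule sum.cong[OF refl], rule sum3_rotate[symmetric])
      also have "\<dots> = (\<Sum>z\<in>?A. \<Sum>y<dA. A a a' * (\<Omega> y (e, m, z) * cnj (\<Omega> y (e', m, z))))"
        unfolding sum_distrib_left[symmetric]
        by (intro sum.cong refl arg_cong[where f = "(*) (A a a')"]) (use * VW in auto)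
      also have "\<dots> = (\<Sum>y<dA. \<Sum>z\<in>?A. A a a' * (\<Omega> y (e, m, z) * cnj (\<Omega> y (e', m, z))))"
        by (rule sum.swap)
      also have "\<dots> = (\<Sum>y<dA. A a a' * (h * pair_kernel eB (\<omega> m) (y, e) (y, e')))"
        using * by (simp add: \<Omega>2 sum_distrib_left[symmetric])
      also have "\<dots> = A a a' * h * (\<Sum>y<dA. pair_kernel eB (\<omega> m) (y, e) (y, e'))"
        by (simp add: sum_distrib_left mult_ac)
      finally show "(\<Sum>z\<in>?A. \<Sum>k<dA. \<Sum>k'<dA. V k (e, m, z) * marg_kernel dA f (a, k) (a', k') * cnj (V k' (e', m, z)))
         = h * X' (a, e) (a', e')"
        using * by (simp add: marg X'_def)
    qed
    also have "\<dots> = (\<Sum>m\<in>S. h * D Y $$ (m, m))"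
      unfolding lift_h trk_scale_right Y_def by (intro sum.cong refl) (simp add: read XX' del: mem_Sigma_iff)
    finally have "Re (trk ?I T (prod_kernel dA ?c f)) = (\<Sum>m\<in>S. Re (D Y $$ (m, m))) / L"
      by (simp add: Reh sum_divide_distrib del: times_complex.sel)
    also have "\<dots> \<le> (\<Sum>k<K. Re (D Y $$ (k, k))) / L"
      using S diag L by (intro divide_right_mono sum_mono2) auto
    finally show ?thesis by (simp add: tot)
  qed
  have "0 \<le> trk ?I T (prod_kernel dA ?c f)"
    by (intro trk_nonneg posT pos_prod_kernel[OF N]) simp
  hence "log_recip (1 / L) \<le> log_recip (Re (trk ?I T (prod_kernel dA ?c f)))"
    using prod by (intro log_recip_antimono) (auto simp: zero_le_complex_iff)
  also have "\<dots> \<le> max_D_H dA dB N \<epsilon>"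
    by (rule log_recip_le_max_D_H[OF N]) (use f_unit posT T1 out in \<open>simp add: feasible_def\<close>)
  finally show ?thesis using L by (simp add: log_recip_def L_def)
qed

section \<open>Position-based coding\<close>

lemma sum_PiE_split:
  assumes "m \<in> I"
  shows "(\<Sum>y\<in>Pi\<^sub>E I F. g y) = (\<Sum>a\<in>F m. \<Sum>i\<in>Pi\<^sub>E (I - {m}) F. g (i(m := a)))"
proof -
  have I: "insert m (I - {m}) = I" using assms by auto
  have "Pi\<^sub>E I F = (\<lambda>(a, i). i(m := a)) ` (F m \<times> Pi\<^sub>E (I - {m}) F)"
    using PiE_insert_eq[of m "I - {m}" F] unfolding I .
  moreover have "inj_on (\<lambda>(a, i). i(m := a)) (F m \<times> Pi\<^sub>E (I - {m}) F)"
    by (rule inj_combinator) simp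
  ultimately have "(\<Sum>y\<in>Pi\<^sub>E I F. g y) = (\<Sum>z\<in>F m \<times> Pi\<^sub>E (I - {m}) F. g ((\<lambda>(a, i). i(m := a)) z))"
    by (simp add: sum.reindex)
  thus ?thesis by (simp add: sum.cartesian_product')
qed

text \<open>The operator \<open>t\<close> on \<open>B\<close> and factor \<open>m\<close>, tensored
  with the identity on all other factors.\<close>

definition on_position :: "nat set \<Rightarrow> nat \<Rightarrow> (nat \<times> nat \<Rightarrow> nat \<times> nat \<Rightarrow> complex) \<Rightarrow>
    nat \<times> (nat \<Rightarrow> nat) \<Rightarrow> nat \<times> (nat \<Rightarrow> nat) \<Rightarrow> complex" where
  "on_position I m t = (\<lambda>(b, j) (b', j'). t (b, j m) (b', j' m) * of_bool (\<forall>l\<in>I - {m}. j l = j' l))"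

text \<open>The identity on the other positions collapses the two sums over the remaining letters
  into one, a partial trace.\<close>

lemma on_position_sum:
  fixes h :: "nat \<times> (nat \<Rightarrow> nat) \<Rightarrow> nat \<times> (nat \<Rightarrow> nat) \<Rightarrow> complex"
  assumes I: "finite I" "m \<in> I" and fin: "\<And>l. l \<in> I \<Longrightarrow> finite (F l)"
  shows "(\<Sum>x\<in>B \<times> Pi\<^sub>E I F. \<Sum>y\<in>B \<times> Pi\<^sub>E I F. on_position I m t x y * h x y)
    = (\<Sum>x\<in>B \<times> F m. \<Sum>y\<in>B \<times> F m. t x y *
        (\<Sum>i\<in>Pi\<^sub>E (I - {m}) F. h (fst x, i(m := snd x)) (fst y, i(m := snd y))))"
proof -
  let ?R = "Pi\<^sub>E (I - {m}) F"
  have finR: "finite ?R" using I fin by (intro finite_PiE) auto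
  have eq: "(\<forall>l\<in>I - {m}. i l = i' l) \<longleftrightarrow> i = i'" if "i \<in> ?R" "i' \<in> ?R" for i i'
    using PiE_ext[OF that] by auto
  have "(\<Sum>x\<in>B \<times> Pi\<^sub>E I F. \<Sum>y\<in>B \<times> Pi\<^sub>E I F. on_position I m t x y * h x y)
      = (\<Sum>b\<in>B. \<Sum>b'\<in>B. \<Sum>a\<in>F m. \<Sum>i\<in>?R. \<Sum>a'\<in>F m. \<Sum>i'\<in>?R.
          on_position I m t (b, i(m := a)) (b', i'(m := a')) * h (b, i(m := a)) (b', i'(m := a')))"
    unfolding sum_pairs sum_PiE_split[OF I(2)] ..
  also have "\<dots> = (\<Sum>b\<in>B. \<Sum>b'\<in>B. \<Sum>a\<in>F m. \<Sum>a'\<in>F m. \<Sum>i\<in>?R. \<Sum>i'\<in>?R.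
          on_position I m t (b, i(m := a)) (b', i'(m := a')) * h (b, i(m := a)) (b', i'(m := a')))"
    by (rule sum.cong[OF refl], rule sum.cong[OF refl], rule sum.cong[OF refl], rule sum.swap)
  also have "\<dots> = (\<Sum>b\<in>B. \<Sum>b'\<in>B. \<Sum>a\<in>F m. \<Sum>a'\<in>F m. \<Sum>i\<in>?R. \<Sum>i'\<in>?R.
          if i' = i then t (b, a) (b', a') * h (b, i(m := a)) (b', i(m := a')) else 0)"
  proof (intro sum.cong refl)
    fix b b' a a' i i' assume i: "i \<in> ?R" "i' \<in> ?R"
    show "on_position I m t (b, i(m := a)) (b', i'(m := a')) * h (b, i(m := a)) (b', i'(m := a'))
        = (if i' = i then t (b, a) (b', a') * h (b, i(m := a)) (b', i(m := a')) else 0)"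
      using eq[OF i] by (auto simp: on_position_def)
  qed
  also have "\<dots> = (\<Sum>b\<in>B. \<Sum>b'\<in>B. \<Sum>a\<in>F m. \<Sum>a'\<in>F m. \<Sum>i\<in>?R.
      t (b, a) (b', a') * h (b, i(m := a)) (b', i(m := a')))"
    using finR by (intro sum.cong refl) simp
  also have "\<dots> = (\<Sum>x\<in>B \<times> F m. \<Sum>y\<in>B \<times> F m. t x y *
        (\<Sum>i\<in>Pi\<^sub>E (I - {m}) F. h (fst x, i(m := snd x)) (fst y, i(m := snd y))))"
    unfolding sum_pairs by (simp add: sum_distrib_left)
  finally show ?thesis .
qed

lemma sesq_on_position:
  assumes I: "finite I" "m \<in> I" and fin: "\<And>l. l \<in> I \<Longrightarrow> finite (F l)"
  shows "sesq (B \<times> Pi\<^sub>E I F) (on_position I m t) u v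
    = (\<Sum>i\<in>Pi\<^sub>E (I - {m}) F. sesq (B \<times> F m) t (\<lambda>(b, a). u (b, i(m := a))) (\<lambda>(b, a). v (b, i(m := a))))"
proof -
  have "sesq (B \<times> Pi\<^sub>E I F) (on_position I m t) u v
      = (\<Sum>x\<in>B \<times> Pi\<^sub>E I F. \<Sum>y\<in>B \<times> Pi\<^sub>E I F. on_position I m t x y * (cnj (u x) * v y))"
    by (simp add: sesq_def mult_ac)
  also have "\<dots> = (\<Sum>x\<in>B \<times> F m. \<Sum>y\<in>B \<times> F m. \<Sum>i\<in>Pi\<^sub>E (I - {m}) F. t x y *
        (cnj (u (fst x, i(m := snd x))) * v (fst y, i(m := snd y))))"
    unfolding sum_distrib_left[symmetric] by (rule on_position_sum[OF assms])
  also have "\<dots> = (\<Sum>i\<in>Pi\<^sub>E (I - {m}) F. \<Sum>x\<in>B \<times> F m. \<Sum>y\<in>B \<times> F m. t x y *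
        (cnj (u (fst x, i(m := snd x))) * v (fst y, i(m := snd y))))"
    by (rule sum3_rotate[symmetric])
  also have "\<dots> = (\<Sum>i\<in>Pi\<^sub>E (I - {m}) F. sesq (B \<times> F m) t (\<lambda>(b, a). u (b, i(m := a))) (\<lambda>(b, a). v (b, i(m := a))))"
    by (simp add: sesq_def case_prod_beta' mult_ac)
  finally show ?thesis .
qed

lemma pos_on_position:
  assumes "finite I" "m \<in> I" "\<And>l. l \<in> I \<Longrightarrow> finite (F l)" "pos (B \<times> F m) t"
  shows "pos (B \<times> Pi\<^sub>E I F) (on_position I m t)"
  unfolding pos_def
proof
  fix v
  show "0 \<le> sesq (B \<times> Pi\<^sub>E I F) (on_position I m t) v v"
    by (subst sesq_on_position[OF assms(1-3)]) (simp_all add: sum_nonneg pos_sesq[OF assms(4)])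
qed

lemma on_position_idk:
  assumes "m \<in> I" "x \<in> B \<times> Pi\<^sub>E I F" "y \<in> B \<times> Pi\<^sub>E I F"
  shows "on_position I m idk x y = idk x y"
proof -
  obtain b j b' j' where [simp]: "x = (b, j)" "y = (b', j')" by (cases x, cases y)
  have "j = j' \<longleftrightarrow> j m = j' m \<and> (\<forall>l\<in>I - {m}. j l = j' l)"
    using PiE_ext[of j I F j'] assms by auto
  thus ?thesis by (auto simp: on_position_def idk_def)
qed

lemma on_position_diff: "on_position I m (\<lambda>i j. s i j - t i j) x y = on_position I m s x y - on_position I m t x y"
  by (auto simp: on_position_def case_prod_beta')

lemma trk_on_position:
  assumes I: "finite I" "m \<in> I" and fin: "\<And>l. l \<in> I \<Longrightarrow> finite (F l)"
  shows "trk (B \<times> Pi\<^sub>E I F) (on_position I m t) Y = trk (B \<times> F m) t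
      (\<lambda>x y. \<Sum>i\<in>Pi\<^sub>E (I - {m}) F. Y (fst x, i(m := snd x)) (fst y, i(m := snd y)))"
  unfolding trk_def by (rule on_position_sum[OF assms])

text \<open>Measure and prepare: the Kraus operators |m><w|, with w running through the Gram vectors
  of \<open>\<Lambda> m\<close>, write the outcome m into the output register.\<close>

lemma povm_decoder:
  assumes g: "bij_betw g {..<q} J" and finM: "finite M" and M: "M \<subseteq> {..<K}"
    and \<Lambda>: "\<And>m. m \<in> M \<Longrightarrow> pos J (\<Lambda> m)"
    and sum: "\<And>i j. \<lbrakk>i \<in> J; j \<in> J\<rbrakk> \<Longrightarrow> (\<Sum>m\<in>M. \<Lambda> m i j) = idk i j"
  shows "\<exists>D. quantum_channel q K D \<and> (\<forall>m\<in>M. \<forall>X\<in>carrier_mat q q.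
    D X $$ (m, m) = trk {..<q} (\<lambda>i j. \<Lambda> m (g i) (g j)) (\<lambda>i j. X $$ (i, j)))"
proof -
  have finJ: "finite J" using bij_betw_finite[OF g] by simp
  have gJ: "g i \<in> J" if "i < q" for i using g that by (auto simp: bij_betw_def)
  have "\<exists>w. \<forall>i\<in>J. \<forall>j\<in>J. \<Lambda> m i j = (\<Sum>k\<in>J. w k i * cnj (w k j))" if "m \<in> M" for m
    by (rule pos_cholesky[OF finJ \<Lambda>[OF that]])
  then obtain w where w0: "\<forall>m\<in>M. \<forall>i\<in>J. \<forall>j\<in>J. \<Lambda> m i j = (\<Sum>k\<in>J. w m k i * cnj (w m k j))"
    using bchoice[of M "\<lambda>m w. \<forall>i\<in>J. \<forall>j\<in>J. \<Lambda> m i j = (\<Sum>k\<in>J. w k i * cnj (w k j))"] by blast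
  have w: "(\<Sum>k\<in>J. cnj (w m k (g i)) * w m k (g j)) = \<Lambda> m (g j) (g i)" if "m \<in> M" "i < q" "j < q" for m i j
    using w0 that gJ by (simp add: mult.commute)
  define F where "F = (\<lambda>(m, k) n i. of_bool (n = m) * cnj (w m k (g i)))"
  define D where "D = kraus_map q K (M \<times> J) F"
  have FF: "(\<Sum>z\<in>M \<times> J. F z n i * cnj (F z n j)) = of_bool (n \<in> M) * \<Lambda> n (g j) (g i)"
    if "i < q" "j < q" for n i j
  proof -
    have "(\<Sum>z\<in>M \<times> J. F z n i * cnj (F z n j))
        = (\<Sum>m\<in>M. if m = n then (\<Sum>k\<in>J. cnj (w n k (g i)) * w n k (g j)) else 0)"
      unfolding sum.cartesian_product' by (intro sum.cong refl) (auto simp: F_def)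
    thus ?thesis using finM that by (simp add: w)
  qed
  have "quantum_channel q K D"
    unfolding D_def
  proof (rule kraus_channel)
    fix i j assume ij: "i < q" "j < q"
    have "(\<Sum>n<K. \<Sum>z\<in>M \<times> J. F z n i * cnj (F z n j)) = (\<Sum>n<K. if n \<in> M then \<Lambda> n (g j) (g i) else 0)"
      by (intro sum.cong refl) (simp add: FF ij)
    also have "\<dots> = (\<Sum>n\<in>M. \<Lambda> n (g j) (g i))"
      using M by (simp add: sum.inter_restrict[symmetric] Int_absorb1)
    also have "\<dots> = of_bool (i = j)"
      using ij gJ g by (auto simp: sum idk_def bij_betw_def inj_on_eq_iff)
    finally show "(\<Sum>n<K. \<Sum>z\<in>M \<times> J. F z n i * cnj (F z n j)) = of_bool (i = j)" .
  qed
  moreover have "D X $$ (m, m) = trk {..<q} (\<lambda>i j. \<Lambda> m (g i) (g j)) (\<lambda>i j. X $$ (i, j))"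
    if "m \<in> M" "X \<in> carrier_mat q q" for m X
  proof -
    have "m < K" using that M by auto
    hence "D X $$ (m, m) = (\<Sum>i<q. \<Sum>j<q. (\<Sum>z\<in>M \<times> J. F z m i * cnj (F z m j)) * X $$ (i, j))"
      by (simp add: D_def kraus_map_def)
    also have "\<dots> = (\<Sum>i<q. \<Sum>j<q. \<Lambda> m (g j) (g i) * X $$ (i, j))"
      using that by (intro sum.cong refl) (simp add: FF)
    also have "\<dots> = trk {..<q} (\<lambda>i j. \<Lambda> m (g i) (g j)) (\<lambda>i j. X $$ (i, j))"
      unfolding trk_def by (rule sum.swap)
    finally show ?thesis .
  qed
  ultimately show ?thesis by blast
qed

text \<open>A word \<open>j\<close> labels the basis vector \<open>\<Otimes>\<^sub>l |j l\<rangle>\<close> of a tensor product with factors of dimension \<open>d l\<close>.\<close>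

definition words :: "nat set \<Rightarrow> (nat \<Rightarrow> nat) \<Rightarrow> (nat \<Rightarrow> nat) set" where
  "words I d = (\<Pi>\<^sub>E l\<in>I. {..<d l})"

section \<open>Product states over many positions and their reductions\<close>

definition amplitude :: "nat set \<Rightarrow> (nat \<Rightarrow> nat \<times> nat \<Rightarrow> complex) \<Rightarrow>
    (nat \<Rightarrow> nat) \<Rightarrow> (nat \<Rightarrow> nat) \<Rightarrow> complex" where
  "amplitude I \<psi> i j = (\<Prod>l\<in>I. \<psi> l (i l, j l))"

definition reduced :: "(nat \<Rightarrow> nat) \<Rightarrow> (nat \<Rightarrow> nat \<times> nat \<Rightarrow> complex) \<Rightarrow>
    nat \<Rightarrow> nat \<Rightarrow> nat \<Rightarrow> complex" where
  "reduced d \<psi> l k k' = (\<Sum>a<d l. \<psi> l (a, k) * cnj (\<psi> l (a, k')))"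

text \<open>Bob's state for message \<open>m\<close>: Alice's half of copy \<open>m\<close> has
  passed the channel, and her halves of the other copies are traced out.\<close>

definition sent_kernel :: "nat set \<Rightarrow> (nat \<Rightarrow> nat) \<Rightarrow> (nat \<Rightarrow> nat \<times> nat \<Rightarrow> complex) \<Rightarrow>
    (nat \<Rightarrow> nat \<Rightarrow> nat \<Rightarrow> nat \<Rightarrow> complex) \<Rightarrow> nat \<Rightarrow>
    nat \<times> (nat \<Rightarrow> nat) \<Rightarrow> nat \<times> (nat \<Rightarrow> nat) \<Rightarrow> complex" where
  "sent_kernel I d \<psi> c m = (\<lambda>(b, j) (b', j'). out_kernel (d m) c (\<psi> m) (b, j m) (b', j' m) *
     (\<Prod>l\<in>I - {m}. reduced d \<psi> l (j l) (j' l)))"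

context
  fixes I :: "nat set" and d :: "nat \<Rightarrow> nat" and \<psi> :: "nat \<Rightarrow> nat \<times> nat \<Rightarrow> complex"
  assumes finI: "finite I" and \<psi>: "\<And>l. l \<in> I \<Longrightarrow> unit_on ({..<d l} \<times> {..<d l}) (\<psi> l)"
begin

lemma reduced_trace: "l \<in> I \<Longrightarrow> (\<Sum>k<d l. reduced d \<psi> l k k) = 1"
  unfolding reduced_def by (subst sum.swap) (rule sum_unit_on[OF \<psi>])

lemma finite_words: "finite (words I d)"
  unfolding words_def by (intro finite_PiE finI) simp

lemma amplitude_unit: "unit_on (words I d \<times> words I d) (\<lambda>(i, j). amplitude I \<psi> i j)"
proof -
  have "(\<Sum>z\<in>words I d \<times> words I d. (\<lambda>(i, j). amplitude I \<psi> i j) z * cnj ((\<lambda>(i, j). amplitude I \<psi> i j) z))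
      = (\<Sum>i\<in>words I d. \<Sum>j\<in>words I d. \<Prod>l\<in>I. \<psi> l (i l, j l) * cnj (\<psi> l (i l, j l)))"
    by (simp add: sum.cartesian_product' amplitude_def prod.distrib)
  also have "\<dots> = (\<Sum>i\<in>words I d. \<Prod>l\<in>I. \<Sum>k<d l. \<psi> l (i l, k) * cnj (\<psi> l (i l, k)))"
    unfolding words_def by (simp add: prod_sum_PiE[OF finI])
  also have "\<dots> = (\<Prod>l\<in>I. \<Sum>a<d l. \<Sum>k<d l. \<psi> l (a, k) * cnj (\<psi> l (a, k)))"
    unfolding words_def by (rule prod_sum_PiE[OF finI, symmetric]) simp
  also have "\<dots> = 1" by (rule prod.neutral) (use sum_unit_on[OF \<psi>] in blast)
  finally show ?thesis by (simp add: unit_on_def)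
qed

lemma amplitude_split:
  assumes "m \<in> I"
  shows "amplitude I \<psi> (i(m := a)) j = \<psi> m (a, j m) * (\<Prod>l\<in>I - {m}. \<psi> l (i l, j l))"
proof -
  have "amplitude I \<psi> (i(m := a)) j = \<psi> m (a, j m) * (\<Prod>l\<in>I - {m}. \<psi> l ((i(m := a)) l, j l))"
    unfolding amplitude_def using finI assms by (subst prod.remove[of I m]) auto
  also have "(\<Prod>l\<in>I - {m}. \<psi> l ((i(m := a)) l, j l)) = (\<Prod>l\<in>I - {m}. \<psi> l (i l, j l))"
    by (intro prod.cong) auto
  finally show ?thesis .
qed

text \<open>Alice's letters away from \<open>m\<close> are traced out; a sum over words of a product
  over letters factors into a product of sums.\<close>

lemma amplitude_reduced:
  assumes m: "m \<in> I"
  shows "(\<Sum>i\<in>(\<Pi>\<^sub>E l\<in>I - {m}. {..<d l}). amplitude I \<psi> (i(m := a)) j * cnj (amplitude I \<psi> (i(m := a')) j'))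
    = \<psi> m (a, j m) * cnj (\<psi> m (a', j' m)) * (\<Prod>l\<in>I - {m}. reduced d \<psi> l (j l) (j' l))"
proof -
  have "(\<Sum>i\<in>(\<Pi>\<^sub>E l\<in>I - {m}. {..<d l}). amplitude I \<psi> (i(m := a)) j * cnj (amplitude I \<psi> (i(m := a')) j'))
      = (\<Sum>i\<in>(\<Pi>\<^sub>E l\<in>I - {m}. {..<d l}). \<psi> m (a, j m) * cnj (\<psi> m (a', j' m)) *
          (\<Prod>l\<in>I - {m}. \<psi> l (i l, j l) * cnj (\<psi> l (i l, j' l))))"
    by (simp add: amplitude_split[OF m] prod.distrib mult_ac)
  also have "\<dots> = \<psi> m (a, j m) * cnj (\<psi> m (a', j' m)) *
      (\<Sum>i\<in>(\<Pi>\<^sub>E l\<in>I - {m}. {..<d l}). \<Prod>l\<in>I - {m}. \<psi> l (i l, j l) * cnj (\<psi> l (i l, j' l)))"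
    by (rule sum_distrib_left[symmetric])
  also have "(\<Sum>i\<in>(\<Pi>\<^sub>E l\<in>I - {m}. {..<d l}). \<Prod>l\<in>I - {m}. \<psi> l (i l, j l) * cnj (\<psi> l (i l, j' l)))
      = (\<Prod>l\<in>I - {m}. reduced d \<psi> l (j l) (j' l))"
    unfolding reduced_def using finI by (intro prod_sum_PiE[symmetric]) auto
  finally show ?thesis .
qed

text \<open>The tested copy is the one that went through the channel, and every other reduced state
  contributes its trace 1.\<close>

lemma trk_sent_same:
  assumes m: "m \<in> I"
  shows "trk (B \<times> words I d) (on_position I m t) (sent_kernel I d \<psi> c m) = trk (B \<times> {..<d m}) t (out_kernel (d m) c (\<psi> m))"
proof -
  have one: "(\<Sum>i\<in>(\<Pi>\<^sub>E l\<in>I - {m}. {..<d l}). \<Prod>l\<in>I - {m}. reduced d \<psi> l (i l) (i l)) = 1"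
  proof -
    have "(\<Sum>i\<in>(\<Pi>\<^sub>E l\<in>I - {m}. {..<d l}). \<Prod>l\<in>I - {m}. reduced d \<psi> l (i l) (i l))
        = (\<Prod>l\<in>I - {m}. \<Sum>k<d l. reduced d \<psi> l k k)"
      using finI by (intro prod_sum_PiE[symmetric]) auto
    also have "\<dots> = 1" by (rule prod.neutral) (auto simp: reduced_trace)
    finally show ?thesis .
  qed
  have prod: "(\<Prod>l\<in>I - {m}. reduced d \<psi> l ((i(m := a)) l) ((i(m := a')) l)) = (\<Prod>l\<in>I - {m}. reduced d \<psi> l (i l) (i l))" for i a a'
    by (intro prod.cong) auto
  show ?thesis
    unfolding words_def trk_on_position[OF finI m finite_lessThan]
    by (rule trk_cong) (auto simp: sent_kernel_def prod one sum_distrib_left[symmetric])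
qed

text \<open>The channel output is correlated only with copy \<open>m'\<close>, which the test at
  \<open>m\<close> traces out. What remains is the channel output of the \<open>A\<close> marginal
  next to an independent copy at \<open>m\<close>.\<close>

lemma trk_sent_other:
  assumes m: "m \<in> I" "m' \<in> I" "m \<noteq> m'" and d: "d m' = p" "d m = p" and \<psi>': "\<psi> m' = f" "\<psi> m = f"
  shows "trk (B \<times> words I d) (on_position I m t) (sent_kernel I d \<psi> c m') = trk (B \<times> {..<p}) t (prod_kernel p c f)"
proof -
  let ?R = "\<Pi>\<^sub>E l\<in>I - {m}. {..<d l}"
  have "(\<Sum>i\<in>?R. sent_kernel I d \<psi> c m' (b, i(m := a)) (b', i(m := a'))) = prod_kernel p c f (b, a) (b', a')"
    for b b' a a'
  proof -
    \<comment> \<open>Treating the channel output as the factor of position \<open>m'\<close> gives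
      one product over all letters other than \<open>m\<close>, so the sum over words
      factors.\<close>
    have "sent_kernel I d \<psi> c m' (b, i(m := a)) (b', i(m := a')) = reduced d \<psi> m a a' *
        (\<Prod>l\<in>I - {m}. if l = m' then out_kernel p c f (b, i l) (b', i l) else reduced d \<psi> l (i l) (i l))" for i
    proof -
      have I: "I - {m'} = insert m (I - {m} - {m'})" using m by auto
      have "(\<Prod>l\<in>I - {m'}. reduced d \<psi> l ((i(m := a)) l) ((i(m := a')) l))
          = reduced d \<psi> m a a' * (\<Prod>l\<in>I - {m} - {m'}. reduced d \<psi> l ((i(m := a)) l) ((i(m := a')) l))"
        unfolding I using finI by (subst prod.insert) auto
      also have "(\<Prod>l\<in>I - {m} - {m'}. reduced d \<psi> l ((i(m := a)) l) ((i(m := a')) l))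
          = (\<Prod>l\<in>I - {m} - {m'}. if l = m' then out_kernel p c f (b, i l) (b', i l) else reduced d \<psi> l (i l) (i l))"
        by (intro prod.cong) auto
      finally show ?thesis
        using m finI d \<psi>' by (subst prod.remove[of "I - {m}" m']) (auto simp: sent_kernel_def)
    qed
    hence "(\<Sum>i\<in>?R. sent_kernel I d \<psi> c m' (b, i(m := a)) (b', i(m := a'))) = reduced d \<psi> m a a' * (\<Sum>i\<in>?R.
        \<Prod>l\<in>I - {m}. if l = m' then out_kernel p c f (b, i l) (b', i l) else reduced d \<psi> l (i l) (i l))"
      by (simp add: sum_distrib_left)
    also have "(\<Sum>i\<in>?R. \<Prod>l\<in>I - {m}. if l = m' then out_kernel p c f (b, i l) (b', i l) else reduced d \<psi> l (i l) (i l))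
        = (\<Prod>l\<in>I - {m}. \<Sum>k<d l. if l = m' then out_kernel p c f (b, k) (b', k) else reduced d \<psi> l k k)"
      using finI by (intro prod_sum_PiE[symmetric]) auto
    also have "\<dots> = (\<Prod>l\<in>I - {m}. if l = m' then \<Sum>k<p. out_kernel p c f (b, k) (b', k) else 1)"
      by (intro prod.cong) (auto simp: reduced_trace d)
    also have "\<dots> = (\<Sum>k<p. out_kernel p c f (b, k) (b', k))"
      using m finI by simp
    also have "\<dots> = (\<Sum>\<alpha><p. \<Sum>\<alpha>'<p. c b b' \<alpha> \<alpha>' * (\<Sum>k<p. f (\<alpha>, k) * cnj (f (\<alpha>', k))))"
      unfolding out_kernel_def lift_fst_def prod.case
      by (subst sum3_rotate) (simp add: sum_distrib_left)
    finally have e: "(\<Sum>i\<in>?R. sent_kernel I d \<psi> c m' (b, i(m := a)) (b', i(m := a')))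
        = reduced d \<psi> m a a' * (\<Sum>\<alpha><p. \<Sum>\<alpha>'<p. c b b' \<alpha> \<alpha>' * (\<Sum>k<p. f (\<alpha>, k) * cnj (f (\<alpha>', k))))" .
    have r: "(\<Sum>y<p. f (y, a) * cnj (f (y, a'))) = reduced d \<psi> m a a'"
      using d \<psi>' by (simp add: reduced_def)
    show ?thesis
      unfolding e prod_kernel_def lift_fst_def marg_kernel_def prod.case r
      by (simp add: sum_distrib_left mult_ac)
  qed
  thus ?thesis
    unfolding words_def trk_on_position[OF finI m(1) finite_lessThan] d
    by (intro trk_cong) auto
qed

end

section \<open>The shared state, the encoder and the decoder on enumerated words\<close>

context
  fixes I :: "nat set" and d :: "nat \<Rightarrow> nat" and \<psi> :: "nat \<Rightarrow> nat \<times> nat \<Rightarrow> complex"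
    and K p n :: nat and dec :: "nat \<Rightarrow> nat \<Rightarrow> nat"
  assumes finI: "finite I" and \<psi>: "\<And>l. l \<in> I \<Longrightarrow> unit_on ({..<d l} \<times> {..<d l}) (\<psi> l)"
    and dec: "bij_betw dec {..<n} (words I d)"
    and K: "\<And>m. m < K \<Longrightarrow> m \<in> I \<and> d m = p"
begin

definition enc :: "(nat \<Rightarrow> nat) \<Rightarrow> nat" where "enc = inv_into {..<n} dec"

lemma enc_dec: "y < n \<Longrightarrow> enc (dec y) = y"
  using dec by (simp add: enc_def bij_betw_def inv_into_f_f)

lemma dec_enc: "j \<in> words I d \<Longrightarrow> dec (enc j) = j"
  using dec by (simp add: enc_def bij_betw_def f_inv_into_f)

lemma enc_less: "j \<in> words I d \<Longrightarrow> enc j < n"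
  using dec inv_into_into[of j dec "{..<n}"] by (simp add: enc_def bij_betw_def)

lemma dec_word: "y < n \<Longrightarrow> dec y \<in> words I d"
  using dec by (auto simp: bij_betw_def)

lemma sum_dec: "(\<Sum>y<n. h (dec y)) = (\<Sum>j\<in>words I d. h j)"
  by (rule sum.reindex_bij_betw[OF dec])

lemma word_upd:
  assumes "m < K" "i \<in> (\<Pi>\<^sub>E l\<in>I - {m}. {..<d l})" "a < p"
  shows "i(m := a) \<in> words I d"
proof -
  have m: "m \<in> I" "d m = p" using K assms(1) by auto
  have "i(m := a) \<in> (\<Pi>\<^sub>E l\<in>insert m (I - {m}). {..<d l})"
    using assms m by (intro PiE_fun_upd) simp_all
  thus ?thesis using m by (simp add: words_def insert_absorb)
qed

definition shared_state :: "complex vec" where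
  "shared_state = vec (n * n) (\<lambda>i. amplitude I \<psi> (dec (i div n)) (dec (i mod n)))"

lemma state_fun_shared: "\<lbrakk>x < n; y < n\<rbrakk> \<Longrightarrow> state_fun n shared_state (x, y) = amplitude I \<psi> (dec x) (dec y)"
  by (simp add: state_fun_def shared_state_def pair_less)

lemma shared_state_carrier: "shared_state \<in> carrier_vec (n * n)"
  by (simp add: shared_state_def)

lemma shared_state_pure: "shared_state \<in> pure_states (n * n)"
proof -
  have "(\<Sum>z\<in>{..<n} \<times> {..<n}. state_fun n shared_state z * cnj (state_fun n shared_state z))
      = (\<Sum>x<n. \<Sum>y<n. amplitude I \<psi> (dec x) (dec y) * cnj (amplitude I \<psi> (dec x) (dec y)))"
    unfolding sum.cartesian_product' by (intro sum.cong refl) (simp add: state_fun_shared)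
  also have "\<dots> = (\<Sum>i\<in>words I d. \<Sum>j\<in>words I d. amplitude I \<psi> i j * cnj (amplitude I \<psi> i j))"
    using sum_dec[of "\<lambda>i. \<Sum>y<n. amplitude I \<psi> i (dec y) * cnj (amplitude I \<psi> i (dec y))"]
    by (simp add: sum_dec[of "\<lambda>j. amplitude I \<psi> _ j * cnj (amplitude I \<psi> _ j)"])
  also have "\<dots> = 1"
    using sum_unit_on[OF amplitude_unit[OF finI \<psi>]] by simp
  finally show ?thesis by (simp add: pure_states_iff unit_on_def shared_state_carrier)
qed

text \<open>Kraus labels of the encoder: the message and the letters of the copies that Alice
  discards.\<close>

definition slots :: "(nat \<times> (nat \<Rightarrow> nat)) set" where
  "slots = (SIGMA m:{..<K}. \<Pi>\<^sub>E l\<in>I - {m}. {..<d l})"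

definition slot_index :: "nat \<times> (nat \<Rightarrow> nat) \<Rightarrow> nat \<Rightarrow> nat" where
  "slot_index z a = fst z * n + enc ((snd z)(fst z := a))"

text \<open>The Kraus operator of \<open>(m, i)\<close> is the sum over a of |a><m, i(m := a)|: read
  the message, output the half at that position, and discard the rest.\<close>

definition encoder :: "complex mat \<Rightarrow> complex mat" where
  "encoder = kraus_map (K * n) p slots (\<lambda>z a x. of_bool (x = slot_index z a))"

lemma finite_rest: "finite (\<Pi>\<^sub>E l\<in>I - {m}. {..<d l})"
  using finI by (intro finite_PiE) auto

lemma sum_slots: "(\<Sum>z\<in>slots. h z) = (\<Sum>m<K. \<Sum>i\<in>(\<Pi>\<^sub>E l\<in>I - {m}. {..<d l}). h (m, i))"
  unfolding slots_def by (subst sum.Sigma) (simp_all add: finite_rest)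

lemma slot_index_less:
  assumes "z \<in> slots" "a < p"
  shows "slot_index z a < K * n"
proof -
  obtain m i where z: "z = (m, i)" "m \<in> {..<K}" "i \<in> (\<Pi>\<^sub>E l\<in>I - {m}. {..<d l})"
    using assms(1) unfolding slots_def by (rule SigmaE)
  hence "enc (i(m := a)) < n" using assms(2) by (intro enc_less word_upd) simp_all
  thus ?thesis using z by (simp add: slot_index_def pair_less)
qed

text \<open>A slot and an output letter determine the input basis vector and conversely, which is
  the completeness relation of the encoder.\<close>

lemma sum_slot_index: "(\<Sum>a<p. \<Sum>z\<in>slots. h (slot_index z a)) = (\<Sum>x<K * n. h x :: complex)"
proof -
  have "(\<Sum>x<K * n. h x) = (\<Sum>m<K. \<Sum>y<n. h (m * n + enc (dec y)))"
    by (simp add: sum_pair enc_dec)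
  also have "\<dots> = (\<Sum>m<K. \<Sum>j\<in>words I d. h (m * n + enc j))"
    by (simp add: sum_dec[of "\<lambda>j. h (_ * n + enc j)"])
  also have "\<dots> = (\<Sum>m<K. \<Sum>a<p. \<Sum>i\<in>(\<Pi>\<^sub>E l\<in>I - {m}. {..<d l}). h (m * n + enc (i(m := a))))"
    unfolding words_def
  proof (intro sum.cong refl)
    fix m assume "m \<in> {..<K}"
    hence "m \<in> I" "d m = p" using K by auto
    thus "(\<Sum>j\<in>(\<Pi>\<^sub>E l\<in>I. {..<d l}). h (m * n + enc j))
        = (\<Sum>a<p. \<Sum>i\<in>(\<Pi>\<^sub>E l\<in>I - {m}. {..<d l}). h (m * n + enc (i(m := a))))"
      by (simp add: sum_PiE_split)
  qed
  also have "\<dots> = (\<Sum>a<p. \<Sum>m<K. \<Sum>i\<in>(\<Pi>\<^sub>E l\<in>I - {m}. {..<d l}). h (m * n + enc (i(m := a))))"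
    by (rule sum.swap)
  finally show ?thesis by (simp add: sum_slots slot_index_def)
qed

lemma encoder_channel: "quantum_channel (K * n) p encoder"
  unfolding encoder_def
proof (rule kraus_channel)
  fix x x' assume x: "x < K * n" "x' < K * n"
  have "(\<Sum>a<p. \<Sum>z\<in>slots. of_bool (x = slot_index z a) * cnj (of_bool (x' = slot_index z a)))
      = (\<Sum>y<K * n. of_bool (x = y) * cnj (of_bool (x' = y)))"
    by (rule sum_slot_index)
  also have "\<dots> = (\<Sum>y<K * n. if y = x then of_bool (x = x') else 0)"
    by (intro sum.cong refl) auto
  finally show "(\<Sum>a<p. \<Sum>z\<in>slots. of_bool (x = slot_index z a) * cnj (of_bool (x' = slot_index z a)))
      = of_bool (x = x')"
    using x by simp
qed

lemma encoder_output:
  assumes m: "m < K" and a: "a < p" "a' < p" and y: "y < n" "y' < n"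
  shows "pair_kernel n (apply_fst (K * n) p n encoder (message_state K shared_state m)) (a, y) (a', y')
    = \<psi> m (a, dec y m) * cnj (\<psi> m (a', dec y' m)) * (\<Prod>l\<in>I - {m}. reduced d \<psi> l (dec y l) (dec y' l))"
proof -
  let ?M = "pair_kernel n (message_state K shared_state m)"
  let ?F = "\<lambda>z a x. of_bool (x = slot_index z a) :: complex"
  have "pair_kernel n (apply_fst (K * n) p n encoder (message_state K shared_state m)) (a, y) (a', y')
      = (\<Sum>x<K * n. \<Sum>x'<K * n. superop (K * n) encoder a a' x x' * ?M (x, y) (x', y'))"
    using encoder_channel a y by (simp add: pair_kernel_apply_fst quantum_channel_def lift_fst_def)
  also have "\<dots> = (\<Sum>x<K * n. \<Sum>x'<K * n. \<Sum>z\<in>slots. ?F z a x * cnj (?F z a' x') * ?M (x, y) (x', y'))"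
    unfolding encoder_def by (intro sum.cong refl) (simp add: superop_kraus a sum_distrib_right)
  also have "\<dots> = (\<Sum>z\<in>slots. \<Sum>x<K * n. \<Sum>x'<K * n. ?F z a x * cnj (?F z a' x') * ?M (x, y) (x', y'))"
    by (rule sum3_rotate[symmetric])
  also have "\<dots> = (\<Sum>z\<in>slots. \<Sum>x<K * n. \<Sum>x'<K * n. ?M (x, y) (x', y') * of_bool (x = slot_index z a \<and> x' = slot_index z a'))"
    by (intro sum.cong refl) simp
  also have "\<dots> = (\<Sum>z\<in>slots. ?M (slot_index z a, y) (slot_index z a', y'))"
    by (rule sum.cong[OF refl], rule sum_unit2) (use a slot_index_less in auto)
  also have "\<dots> = (\<Sum>m'<K. \<Sum>i\<in>(\<Pi>\<^sub>E l\<in>I - {m'}. {..<d l}). of_bool (m' = m) *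
      (amplitude I \<psi> (i(m' := a)) (dec y) * cnj (amplitude I \<psi> (i(m' := a')) (dec y'))))"
    unfolding sum_slots slot_index_def fst_conv snd_conv
  proof (intro sum.cong refl)
    fix m' i assume *: "m' \<in> {..<K}" "i \<in> (\<Pi>\<^sub>E l\<in>I - {m'}. {..<d l})"
    have w: "i(m' := a) \<in> words I d" "i(m' := a') \<in> words I d"
      using * a by (auto intro!: word_upd)
    show "?M (m' * n + enc (i(m' := a)), y) (m' * n + enc (i(m' := a')), y')
      = of_bool (m' = m) * (amplitude I \<psi> (i(m' := a)) (dec y) * cnj (amplitude I \<psi> (i(m' := a')) (dec y')))"
      using * m y enc_less[OF w(1)] enc_less[OF w(2)]
      by (simp add: pair_kernel_message_state[OF shared_state_carrier] state_fun_shared dec_enc w)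
  qed
  also have "\<dots> = (\<Sum>m'<K. if m' = m then (\<Sum>i\<in>(\<Pi>\<^sub>E l\<in>I - {m}. {..<d l}).
      amplitude I \<psi> (i(m := a)) (dec y) * cnj (amplitude I \<psi> (i(m := a')) (dec y'))) else 0)"
    by (intro sum.cong refl) auto
  also have "\<dots> = \<psi> m (a, dec y m) * cnj (\<psi> m (a', dec y' m)) * (\<Prod>l\<in>I - {m}. reduced d \<psi> l (dec y l) (dec y' l))"
    using m K by (simp add: amplitude_reduced[OF finI \<psi>])
  finally show ?thesis .
qed

context
  fixes N :: "complex mat \<Rightarrow> complex mat" and dB :: nat
  assumes N: "quantum_channel p dB N"
begin

abbreviation received :: "nat \<Rightarrow> complex mat" where
  "received \<equiv> received_state p dB N K n n shared_state encoder"

lemma received_entry: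
  assumes m: "m < K" and ij: "i < dB * n" "j < dB * n"
  shows "received m $$ (i, j)
    = sent_kernel I d \<psi> (superop p N) m (i div n, dec (i mod n)) (j div n, dec (j mod n))"
proof -
  have n: "0 < n" using ij by (auto intro: gr0I)
  have "received m $$ (i, j) = pair_kernel n (received m) (i div n, i mod n) (j div n, j mod n)"
    by (simp add: pair_kernel_def)
  also have "\<dots> = lift_fst p (superop p N) (pair_kernel n (apply_fst (K * n) p n encoder (message_state K shared_state m)))
      (i div n, i mod n) (j div n, j mod n)"
    using N ij n unfolding received_state_def
    by (intro pair_kernel_apply_fst) (simp_all add: quantum_channel_def less_mult_imp_div_less)
  also have "\<dots> = sent_kernel I d \<psi> (superop p N) m (i div n, dec (i mod n)) (j div n, dec (j mod n))"
    using n K[OF m]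
    by (simp add: lift_fst_def encoder_output m sent_kernel_def out_kernel_def sum_distrib_right mult.assoc)
  finally show ?thesis .
qed

text \<open>The same test is placed at each position of \<open>S\<close>. Message m passes it at its
  own position with probability at least 1 - \<epsilon>, and at any other position with the type II
  error.\<close>

lemma position_decoder:
  assumes S: "S \<subseteq> {..<K}" "S \<noteq> {}" and f: "\<And>m. m < K \<Longrightarrow> \<psi> m = f"
    and feas: "feasible p dB (superop p N) \<epsilon> f t"
  shows "\<exists>D. quantum_channel (dB * n) K D \<and> (\<forall>m\<in>S. 1 - Re (D (received m) $$ (m, m))
    \<le> 2 * \<epsilon> + 4 * real (card S) * Re (trk ({..<dB} \<times> {..<p}) t (prod_kernel p (superop p N) f)))"
proof -
  let ?J = "{..<dB} \<times> words I d" and ?c = "superop p N" and ?I = "{..<dB} \<times> {..<p}"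
  let ?\<rho> = "sent_kernel I d \<psi> ?c"
  have finS: "finite S" using S finite_subset by blast
  have finJ: "finite ?J" using finite_words[OF finI \<psi>] by simp
  define g where "g i = (i div n, dec (i mod n))" for i
  have g: "bij_betw g {..<dB * n} ?J"
  proof (rule bij_betwI[where g = "\<lambda>(b, j). b * n + enc j"])
    show "g \<in> {..<dB * n} \<rightarrow> ?J"
      by (auto simp: g_def less_mult_imp_div_less intro!: dec_word mod_less_divisor gr0I)
    show "(\<lambda>(b, j). b * n + enc j) \<in> ?J \<rightarrow> {..<dB * n}"
      by (auto intro!: pair_less enc_less)
    show "(\<lambda>(b, j). b * n + enc j) (g i) = i" if "i \<in> {..<dB * n}" for i
    proof -
      have "i mod n < n" using that by (auto intro!: mod_less_divisor gr0I)
      thus ?thesis by (simp add: g_def enc_dec)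
    qed
    show "g ((\<lambda>(b, j). b * n + enc j) z) = z" if "z \<in> ?J" for z
    proof -
      obtain b j where z: "z = (b, j)" "j \<in> words I d" using \<open>z \<in> ?J\<close> by auto
      thus ?thesis using enc_less[OF z(2)] by (simp add: g_def dec_enc)
    qed
  qed
  have rec: "received m $$ (i, j) = ?\<rho> m (g i) (g j)" if "m < K" "i < dB * n" "j < dB * n" for m i j
    using received_entry[OF that] by (simp add: g_def)
  have rec_psd: "psd (dB * n) (received m)" for m
    unfolding received_state_def
    by (intro channel_apply_fst_psd[OF N] channel_apply_fst_psd[OF encoder_channel] psd_message_state
        shared_state_carrier)
  have \<rho>: "pos ?J (?\<rho> m)" if "m < K" for m
    unfolding pos_reindex[OF g]
    using rec_psd[of m] unfolding psd_iff_pos by (auto intro: pos_eqI simp: rec[OF that])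
  have mI: "m \<in> I" and dm: "d m = p" if "m < K" for m using K[OF that] by auto
  define T where "T m = on_position I m t" for m
  have T: "pos ?J (T m)" "pos ?J (\<lambda>i j. idk i j - T m i j)" if "m \<in> S" for m
  proof -
    have m: "m < K" using that S by auto
    show "pos ?J (T m)"
      unfolding T_def words_def using feas
      by (intro pos_on_position finI mI[OF m]) (simp_all add: feasible_def dm[OF m])
    have "pos ?J (on_position I m (\<lambda>i j. idk i j - t i j))"
      unfolding words_def using feas
      by (intro pos_on_position finI mI[OF m]) (simp_all add: feasible_def dm[OF m])
    thus "pos ?J (\<lambda>i j. idk i j - T m i j)"
      by (rule pos_eqI) (simp add: on_position_diff T_def on_position_idk[OF mI[OF m]] words_def)
  qed
  obtain \<Lambda> where \<Lambda>: "\<And>m. m \<in> S \<Longrightarrow> pos ?J (\<Lambda> m)"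
    and \<Lambda>1: "pos ?J (\<lambda>i j. idk i j - (\<Sum>m\<in>S. \<Lambda> m i j))"
    and HN: "\<And>m. m \<in> S \<Longrightarrow> pos ?J (\<lambda>i j. 2 * (idk i j - T m i j) + 4 * (\<Sum>k\<in>S - {m}. T k i j)
            - (idk i j - \<Lambda> m i j))"
    using hayashi_nagaoka[of ?J S T, OF finJ finS T] by blast
  obtain m0 where m0: "m0 \<in> S" using S by blast
  \<comment> \<open>The operators \<Lambda> may sum to less than the identity. The missing part is
    given to an arbitrary message of \<open>S\<close>, which can only raise success
    probabilities.\<close>
  define \<Lambda>' where "\<Lambda>' m i j = \<Lambda> m i j + of_bool (m = m0) * (idk i j - (\<Sum>k\<in>S. \<Lambda> k i j))" for m i j
  have \<Lambda>': "pos ?J (\<Lambda>' m)" if "m \<in> S" for m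
    using pos_add[OF \<Lambda>[OF that] \<Lambda>1] \<Lambda>[OF that] by (cases "m = m0") (simp_all add: \<Lambda>'_def[abs_def])
  have sum1: "(\<Sum>m\<in>S. \<Lambda>' m i j) = idk i j" for i j
    using m0 finS by (simp add: \<Lambda>'_def sum.distrib sum_distrib_right[symmetric] of_bool_def)
  obtain D where D: "quantum_channel (dB * n) K D"
    and Dm: "\<And>m X. \<lbrakk>m \<in> S; X \<in> carrier_mat (dB * n) (dB * n)\<rbrakk> \<Longrightarrow>
      D X $$ (m, m) = trk {..<dB * n} (\<lambda>i j. \<Lambda>' m (g i) (g j)) (\<lambda>i j. X $$ (i, j))"
    using povm_decoder[OF g finS S(1) \<Lambda>' sum1] by blast
  have "1 - Re (D (received m) $$ (m, m)) \<le> 2 * \<epsilon> + 4 * real (card S) * Re (trk ?I t (prod_kernel p ?c f))"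
    if m: "m \<in> S" for m
  proof -
    have mK: "m < K" using m S by auto
    \<comment> \<open>Paired with the received state, the operator inequality bounds the error by
      twice the miss probability at \<open>m\<close> plus four times the passing probabilities at
      the other positions.\<close>
    have trk_lin: "trk ?J (\<lambda>i j. 2 * (idk i j - T m i j) + 4 * (\<Sum>k\<in>S - {m}. T k i j) - (idk i j - \<Lambda> m i j)) (?\<rho> m)
        = trk ?J idk (?\<rho> m) - 2 * trk ?J (T m) (?\<rho> m) + 4 * (\<Sum>k\<in>S - {m}. trk ?J (T k) (?\<rho> m)) + trk ?J (\<Lambda> m) (?\<rho> m)"
      unfolding trk_diff_left trk_add_left trk_scale_left trk_sum_left by simp
    have same: "trk ?J (on_position I m s) (?\<rho> m) = trk ?I s (out_kernel p ?c f)" for s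
      using trk_sent_same[OF finI \<psi> mI[OF mK]] by (simp add: dm[OF mK] f[OF mK])
    have other: "trk ?J (T k) (?\<rho> m) = trk ?I t (prod_kernel p ?c f)" if "k \<in> S - {m}" for k
    proof -
      have k: "k < K" "k \<noteq> m" using that S by auto
      show ?thesis unfolding T_def
        by (rule trk_sent_other[OF finI \<psi> mI[OF k(1)] mI[OF mK] k(2) dm[OF mK] dm[OF k(1)] f[OF mK] f[OF k(1)]])
    qed
    \<comment> \<open>The identity is the trivial test placed at position \<open>m\<close>, so
      normalization of the received state reduces to that of a single copy.\<close>
    have "trk ?J idk (?\<rho> m) = trk ?J (on_position I m idk) (?\<rho> m)"
      by (rule trk_cong) (simp_all add: on_position_idk[OF mI[OF mK]] words_def)
    also have "\<dots> = 1"
      unfolding same by (rule trk_idk_out[OF N]) (use feas in \<open>simp add: feasible_def\<close>)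
    finally have tr1: "trk ?J idk (?\<rho> m) = 1" .
    let ?x = "Re (trk ?I t (prod_kernel p ?c f))"
    have x: "0 \<le> ?x"
    proof -
      have "0 \<le> trk ?I t (prod_kernel p ?c f)"
        using feas pos_prod_kernel[OF N] by (intro trk_nonneg) (simp_all add: feasible_def)
      thus ?thesis by (simp add: zero_le_complex_iff)
    qed
    have "D (received m) $$ (m, m) = trk ?J (\<Lambda>' m) (?\<rho> m)"
      unfolding trk_reindex[OF g] using rec_psd[of m]
      by (subst Dm[OF m]) (auto simp: psd_def rec[OF mK] intro!: trk_cong)
    also have "\<dots> = trk ?J (\<Lambda> m) (?\<rho> m)
        + of_bool (m = m0) * trk ?J (\<lambda>i j. idk i j - (\<Sum>k\<in>S. \<Lambda> k i j)) (?\<rho> m)"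
      unfolding \<Lambda>'_def trk_add_left trk_scale_left ..
    also have "Re (trk ?J (\<Lambda> m) (?\<rho> m)) \<le> Re \<dots>"
      using trk_nonneg[OF finJ \<Lambda>1 \<rho>[OF mK]] by (simp add: zero_le_complex_iff)
    finally have "Re (trk ?J (\<Lambda> m) (?\<rho> m)) \<le> Re (D (received m) $$ (m, m))" .
    moreover have "0 \<le> trk ?J (\<lambda>i j. 2 * (idk i j - T m i j) + 4 * (\<Sum>k\<in>S - {m}. T k i j)
            - (idk i j - \<Lambda> m i j)) (?\<rho> m)"
      by (rule trk_nonneg[OF finJ HN[OF m] \<rho>[OF mK]])
    hence "0 \<le> Re (1 - 2 * trk ?I t (out_kernel p ?c f)
        + 4 * (\<Sum>k\<in>S - {m}. trk ?I t (prod_kernel p ?c f)) + trk ?J (\<Lambda> m) (?\<rho> m)) + 0"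
      unfolding trk_lin by (simp add: other tr1 same T_def[of m] zero_le_complex_iff)
    hence "0 \<le> 1 - 2 * Re (trk ?I t (out_kernel p ?c f)) + 4 * (real (card (S - {m})) * ?x)
        + Re (trk ?J (\<Lambda> m) (?\<rho> m))"
      by simp
    moreover have "1 - \<epsilon> \<le> Re (trk ?I t (out_kernel p ?c f))" using feas by (simp add: feasible_def)
    moreover have "real (card (S - {m})) * ?x \<le> real (card S) * ?x"
      using x finS by (intro mult_right_mono) (auto intro: card_mono)
    ultimately show ?thesis by argo
  qed
  thus ?thesis using D by blast
qed

end

end

text \<open>The state and the encoder are fixed before \<open>S\<close> is quantified; only the
  decoder is chosen afterwards.\<close>

lemma ea_achievability:
  assumes N: "quantum_channel dA dB N" and feas: "feasible dA dB (superop dA N) \<epsilon> f t"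
  shows "\<exists>n \<theta> \<E>. entangled n n \<theta> \<and> \<theta> \<in> pure_states (n * n) \<and> quantum_channel (K * n) dA \<E> \<and>
    (\<forall>S. S \<subseteq> {..<K} \<and> S \<noteq> {} \<longrightarrow> (\<exists>D. quantum_channel (dB * n) K D \<and>
      (\<forall>m\<in>S. 1 - Re (D (received_state dA dB N K n n \<theta> \<E> m) $$ (m, m)) \<le> 2 * \<epsilon> +
        4 * real (card S) * Re (trk ({..<dB} \<times> {..<dA}) t (prod_kernel dA (superop dA N) f)))))"
proof -
  define I where "I = {..K}"
  define d where "d l = (if l < K then dA else 2)" for l
  \<comment> \<open>Position \<open>K\<close> carries a Bell pair that the code ignores; it keeps the shared state entangled
    even when \<open>f\<close> is a product state or there are no messages.\<close>
  define bell :: "nat \<times> nat \<Rightarrow> complex" where "bell = (\<lambda>(a, k). of_bool (a = k) / complex_of_real (sqrt 2))"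
  define \<psi> where "\<psi> l = (if l < K then f else bell)" for l
  have finI: "finite I" by (simp add: I_def)
  have s2: "complex_of_real (sqrt 2) * complex_of_real (sqrt 2) = 2"
    by (simp flip: of_real_mult)
  have f: "unit_on ({..<dA} \<times> {..<dA}) f" using feas by (simp add: feasible_def)
  have "unit_on ({..<2} \<times> {..<2}) bell"
    by (simp add: unit_on_def sum.cartesian_product' bell_def numeral_2_eq_2 s2[unfolded numeral_2_eq_2])
  hence \<psi>: "unit_on ({..<d l} \<times> {..<d l}) (\<psi> l)" for l
    using f by (simp add: d_def \<psi>_def)
  have K: "m < K \<Longrightarrow> m \<in> I \<and> d m = dA" for m by (simp add: I_def d_def)
  define n where "n = card (words I d)"
  have "finite (words I d)" by (rule finite_words[where d = d and \<psi> = \<psi>, OF finI \<psi>])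
  then obtain dec where dec: "bij_betw dec {..<n} (words I d)"
    using ex_bij_betw_nat_finite[of "words I d"] by (auto simp: n_def atLeast0LessThan)
  note facts = finI \<psi> dec K
  let ?\<theta> = "shared_state I \<psi> n dec" and ?E = "encoder I d K dA n dec"
  have "entangled n n ?\<theta>"
    unfolding entangled_def
  proof
    assume "\<exists>u\<in>carrier_vec n. \<exists>w\<in>carrier_vec n. ?\<theta> = tensor_vec u w"
    then obtain u w where u: "u \<in> carrier_vec n" and w: "w \<in> carrier_vec n" and uw: "?\<theta> = tensor_vec u w"
      by blast
    have enc: "enc n dec i < n" if "i \<in> words I d" for i
      by (rule enc_less[where I = I and d = d and \<psi> = \<psi> and K = K and p = dA, OF facts that])
    have dec_enc: "dec (enc n dec i) = i" if "i \<in> words I d" for i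
      by (rule dec_enc[where I = I and d = d and \<psi> = \<psi> and K = K and p = dA, OF facts that])
    have shared: "state_fun n ?\<theta> (x, y) = amplitude I \<psi> (dec x) (dec y)" if "x < n" "y < n" for x y
      by (rule state_fun_shared[where I = I and d = d and \<psi> = \<psi> and K = K and p = dA, OF facts that])
    have amp: "amplitude I \<psi> i j = u $ enc n dec i * w $ enc n dec j" if "i \<in> words I d" "j \<in> words I d" for i j
    proof -
      have l: "enc n dec i < n" "enc n dec j < n" using enc that by auto
      hence "amplitude I \<psi> i j = state_fun n ?\<theta> (enc n dec i, enc n dec j)"
        using dec_enc that by (simp add: shared)
      also have "\<dots> = u $ enc n dec i * w $ enc n dec j"
        using u w l by (simp add: uw state_fun_def tensor_vec_def pair_less)
      finally show ?thesis .
    qed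
    have "\<exists>z\<in>{..<dA} \<times> {..<dA}. f z \<noteq> 0"
      using f by (rule contrapos_pp) (simp add: unit_on_def sum.cartesian_product')
    then obtain a k where ak: "a < dA" "k < dA" "f (a, k) \<noteq> 0" by auto
    \<comment> \<open>These words agree at all message positions, where the amplitude of
      \<open>f\<close> is nonzero, and differ only at the Bell pair. A product vector would make the
      resulting 2 by 2 minor of amplitudes vanish, but it equals
      \<open>f (a, k) ^ (2 * K) / 2\<close>.\<close>
    define i where "i s = (\<lambda>l\<in>I. if l < K then a else s)" for s :: nat
    define j where "j s = (\<lambda>l\<in>I. if l < K then k else s)" for s :: nat
    have ij: "i s \<in> words I d" "j s \<in> words I d" if "s < 2" for s
      using that ak by (auto simp: words_def i_def j_def d_def)
    have "amplitude I \<psi> (i s) (j s') = f (a, k) ^ K * bell (s, s')" for s s'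
      unfolding amplitude_def I_def lessThan_Suc_atMost[symmetric] prod.lessThan_Suc
      by (simp add: \<psi>_def i_def j_def I_def)
    moreover have "amplitude I \<psi> (i 0) (j 0) * amplitude I \<psi> (i 1) (j 1)
        = amplitude I \<psi> (i 0) (j 1) * amplitude I \<psi> (i 1) (j 0)"
      using ij by (simp add: amp)
    ultimately show False using ak by (simp add: bell_def)
  qed
  moreover have "\<exists>D. quantum_channel (dB * n) K D \<and>
      (\<forall>m\<in>S. 1 - Re (D (received_state dA dB N K n n ?\<theta> ?E m) $$ (m, m)) \<le> 2 * \<epsilon> +
        4 * real (card S) * Re (trk ({..<dB} \<times> {..<dA}) t (prod_kernel dA (superop dA N) f)))"
    if "S \<subseteq> {..<K}" "S \<noteq> {}" for S
    by (rule position_decoder[where I = I and d = d and \<psi> = \<psi> and K = K and p = dA, OF facts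
          N that _ feas]) (simp_all add: \<psi>_def)
  ultimately show ?thesis
    using shared_state_pure[where I = I and d = d and \<psi> = \<psi> and K = K and p = dA, OF facts]
      encoder_channel[where I = I and d = d and \<psi> = \<psi> and K = K and p = dA, OF facts] K by blast
qed

text \<open>The first conjunct says that the supremum \<open>max_D_H\<close> is a maximum. The
  converse assumes that some promise set exists: if \<open>2 powr (\<alpha> * R)\<close> is not the
  size of any set of messages, the decoding condition of \<open>ea_code\<close> is vacuous.\<close>

theorem theorem9:
  fixes dA dB :: nat and N :: "complex mat \<Rightarrow> complex mat" and \<epsilon> \<alpha> :: real
  assumes "0 < dA" and "0 < dB" and "quantum_channel dA dB N"
    and "0 < \<epsilon>" and "\<epsilon> < 1" and "0 < \<alpha>"
  shows "(\<exists>\<psi> \<in> pure_states (dA * dA). D_H_channel dA dB N \<epsilon> \<psi> = max_D_H dA dB N \<epsilon>) \<and>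
    (\<forall>R \<delta>. 0 < \<delta> \<and> \<delta> < 1 \<and>
        ereal R \<le> ereal (1 / \<alpha>) * max_D_H dA dB N \<epsilon> - ereal (4 / \<alpha> * log 2 (2 / \<delta>)) \<longrightarrow>
        (\<exists>eA eB \<theta> \<E> \<D>. entangled eA eB \<theta> \<and>
           ea_code dA dB N R (2 * \<epsilon> + 3 * \<delta>) \<alpha> eA eB \<theta> \<E> \<D>)) \<and>
    (\<forall>R eA eB \<theta> \<E> \<D>. promise_sets R \<alpha> \<noteq> {} \<and> ea_code dA dB N R \<epsilon> \<alpha> eA eB \<theta> \<E> \<D> \<longrightarrow>
        ereal R \<le> ereal (1 / \<alpha>) * max_D_H dA dB N \<epsilon>)"
proof -
  note N = assms(3) and \<alpha> = assms(6)
  let ?I = "{..<dB} \<times> {..<dA}" and ?c = "superop dA N"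
  obtain \<psi> f t where \<psi>: "\<psi> \<in> pure_states (dA * dA)" "D_H_channel dA dB N \<epsilon> \<psi> = max_D_H dA dB N \<epsilon>"
    and feas: "feasible dA dB ?c \<epsilon> f t"
    and max: "max_D_H dA dB N \<epsilon> = log_recip (Re (trk ?I t (prod_kernel dA ?c f)))"
    using max_D_H_attained[OF N assms(1,4)] by blast
  define x where "x = Re (trk ?I t (prod_kernel dA ?c f))"
  have x: "0 \<le> x"
  proof -
    have "0 \<le> trk ?I t (prod_kernel dA ?c f)"
      using feas pos_prod_kernel[OF N] by (intro trk_nonneg) (simp_all add: feasible_def)
    thus ?thesis by (simp add: x_def zero_le_complex_iff)
  qed
  have "\<exists>eA eB \<theta> \<E> \<D>. entangled eA eB \<theta> \<and> ea_code dA dB N R (2 * \<epsilon> + 3 * \<delta>) \<alpha> eA eB \<theta> \<E> \<D>"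
    if \<delta>: "0 < \<delta>" "\<delta> < 1"
      and R: "ereal R \<le> ereal (1 / \<alpha>) * max_D_H dA dB N \<epsilon> - ereal (4 / \<alpha> * log 2 (2 / \<delta>))"
    for R \<delta>
  proof -
    let ?K = "num_messages R"
    \<comment> \<open>The rate bound gives
      \<open>2 powr (\<alpha> * R) * x \<le> (\<delta> / 2) ^ 4\<close>, so four times the left side
      is at most \<open>\<delta> ^ 4 / 4\<close>, and \<open>\<delta> ^ 4 \<le> \<delta>\<close>.
      For \<open>x = 0\<close> the divergence is infinite and the error term vanishes at every
      rate.\<close>
    have small: "4 * (2 powr (\<alpha> * R)) * x \<le> 3 * \<delta>"
    proof (cases "x = 0")
      case False
      hence x0: "0 < x" using x by simp
      have "R \<le> (1 / \<alpha>) * log 2 (1 / x) - 4 / \<alpha> * log 2 (2 / \<delta>)"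
        using R False unfolding max x_def[symmetric] by (simp add: log_recip_def)
      hence "\<alpha> * R \<le> \<alpha> * ((1 / \<alpha>) * log 2 (1 / x) - 4 / \<alpha> * log 2 (2 / \<delta>))"
        using \<alpha> by (intro mult_left_mono) auto
      also have "\<dots> = log 2 (1 / x) - 4 * log 2 (2 / \<delta>)"
        using \<alpha> by (simp add: field_simps)
      also have "\<dots> = log 2 (1 / x) - log 2 ((2 / \<delta>) ^ 4)"
        using \<delta> by (subst log_nat_power) auto
      also have "\<dots> = log 2 (1 / x / (2 / \<delta>) ^ 4)"
        using x0 \<delta> by (subst log_divide) auto
      finally have "2 powr (\<alpha> * R) \<le> 2 powr log 2 (1 / x / (2 / \<delta>) ^ 4)"
        by (intro powr_mono) auto
      also have "\<dots> = 1 / x / (2 / \<delta>) ^ 4" using x0 \<delta> by (intro powr_log_cancel) auto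
      also have "\<dots> = \<delta> ^ 4 / (16 * x)" using x0 \<delta> by (simp add: field_simps)
      finally have "4 * (2 powr (\<alpha> * R)) * x \<le> 4 * (\<delta> ^ 4 / (16 * x)) * x"
        using x0 by (intro mult_right_mono mult_left_mono) auto
      also have "\<dots> = \<delta> ^ 4 / 4" using x0 by simp
      also have "\<delta> ^ 4 \<le> \<delta> ^ 1" using \<delta> by (intro power_decreasing) auto
      finally show ?thesis using \<delta> by simp
    qed (use \<delta> in simp)
    obtain n \<theta> \<E> where code: "entangled n n \<theta> \<and> \<theta> \<in> pure_states (n * n) \<and> quantum_channel (?K * n) dA \<E> \<and>
      (\<forall>S. S \<subseteq> {..<?K} \<and> S \<noteq> {} \<longrightarrow> (\<exists>D. quantum_channel (dB * n) ?K D \<and>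
        (\<forall>m\<in>S. 1 - Re (D (received_state dA dB N ?K n n \<theta> \<E> m) $$ (m, m)) \<le> 2 * \<epsilon> + 4 * real (card S) * x)))"
      using ea_achievability[OF N feas, of ?K] unfolding x_def[symmetric] by (elim exE)
    hence n: "entangled n n \<theta>" "\<theta> \<in> pure_states (n * n)" "quantum_channel (?K * n) dA \<E>" by simp_all
    have "\<exists>D. quantum_channel (dB * n) ?K D \<and>
        (\<forall>m\<in>S. 1 - Re (D (received_state dA dB N ?K n n \<theta> \<E> m) $$ (m, m)) \<le> 2 * \<epsilon> + 3 * \<delta>)"
      if S: "S \<in> promise_sets R \<alpha>" for S
    proof -
      have c: "real (card S) = 2 powr (\<alpha> * R)" and SK: "S \<subseteq> {..<?K}"
        using S by (auto simp: promise_sets_def)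
      have "S \<noteq> {}" using c by auto
      then obtain E where E: "quantum_channel (dB * n) ?K E"
        "\<forall>m\<in>S. 1 - Re (E (received_state dA dB N ?K n n \<theta> \<E> m) $$ (m, m)) \<le> 2 * \<epsilon> + 4 * real (card S) * x"
        using code[THEN conjunct2, THEN conjunct2, THEN conjunct2, THEN spec, of S] SK by blast
      thus ?thesis using small unfolding c by (intro exI[of _ E]) force
    qed
    then obtain \<D> where "\<forall>S\<in>promise_sets R \<alpha>. quantum_channel (dB * n) ?K (\<D> S) \<and>
        (\<forall>m\<in>S. 1 - Re (\<D> S (received_state dA dB N ?K n n \<theta> \<E> m) $$ (m, m)) \<le> 2 * \<epsilon> + 3 * \<delta>)"
      using bchoice[of "promise_sets R \<alpha>" "\<lambda>S D. quantum_channel (dB * n) ?K D \<and>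
        (\<forall>m\<in>S. 1 - Re (D (received_state dA dB N ?K n n \<theta> \<E> m) $$ (m, m)) \<le> 2 * \<epsilon> + 3 * \<delta>)"] by blast
    hence "ea_code dA dB N R (2 * \<epsilon> + 3 * \<delta>) \<alpha> n n \<theta> \<E> \<D>"
      using n by (simp add: ea_code_def Let_def)
    thus ?thesis using n by blast
  qed
  moreover have "ereal R \<le> ereal (1 / \<alpha>) * max_D_H dA dB N \<epsilon>"
    if S: "S \<in> promise_sets R \<alpha>" and code: "ea_code dA dB N R \<epsilon> \<alpha> eA eB \<theta> \<E> \<D>"
    for R eA eB \<theta> \<E> \<D> S
  proof -
    have c: "real (card S) = 2 powr (\<alpha> * R)" and SK: "S \<subseteq> {..<num_messages R}"
      using S by (auto simp: promise_sets_def)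
    have "S \<noteq> {}" using c by auto
    have "ereal (log 2 (card S)) \<le> max_D_H dA dB N \<epsilon>"
      using code S unfolding ea_code_def Let_def
      by (intro ea_converse[OF N _ _ _ SK \<open>S \<noteq> {}\<close>, of eA \<E> eB "\<D> S" \<theta>]) auto
    hence le: "ereal (\<alpha> * R) \<le> max_D_H dA dB N \<epsilon>" unfolding c by simp
    show ?thesis
    proof (cases "max_D_H dA dB N \<epsilon>")
      case (real r)
      thus ?thesis using le \<alpha> by (simp add: field_simps)
    qed (use le \<alpha> in auto)
  qed
  ultimately show ?thesis using \<psi> by blast
qed

end
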